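(* Consider a sequence of linear models $y = X\beta + z$ satisfying the working assumption stated in the context, and suppose additionally that $k/p\to\epsilon$ and $n/p\to\delta$ for arbitrary positive constants $\epsilon<1$ and $\delta$. Then, for each of the three procedures forward stepwise regression, the lasso, and least angle regression, the rank $T$ of the first noise variable selected by the procedure satisfies $$T\le e^{(1+o_{\mathbb P}(1))\sqrt{2\delta(\log p)/\epsilon}}.$$
   Context: Asymptotics. We consider a sequence of problems indexed by $(k_l,n_l,p_l)$ with $k_l,n_l,p_l\to\infty$ as $l\to\infty$; the index $l$ is suppressed. All limits are as $l\to\infty$. $o_{\mathbb P}(1)$ denotes a sequence of random variables converging to zero in probability. Constants do not depend on $l$. Working assumption. $y=X\beta+z$, where $X\in\mathbb R^{n\times p}$ has independent $\mathcal N(0,1/n)$ entries, $z\in\mathbb R^n$ has independent $\mathcal N(0,\sigma^2)$ entries ($\sigma=0$ allowed), and $X$ and $z$ are independent. The (nonrandom) vector $\beta\in\mathbb R^p$ has $k$ fixed components equal to some $M\neq 0$ and the rest are zero. The nonrandom parameters $\sigma\ge 0$ and $M$ may vary with $l$. Moreover $c_1 p/\log^{c_2}p\le n\le c_3p$ and $c_4 n\le k\le\min\{0.99p,\; c_5 n\log^{0.99}p\}$ for arbitrary positive constants $c_1,\dots,c_5$; here the number $0.99$ can be replaced by any positive number smaller than 1. Signal and noise variables. Variable $j$ (column $X_j$) is a signal variable if $\beta_j\ne0$ and a noise (spurious) variable if $\beta_j=0$. Procedures (no intercept, no normalization of columns). - Forward stepwise: start from the empty set; at each step add the variable that, together with the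 variables already selected, gives the smallest least-squares residual sum of squares for $y$. - Lasso: the path of minimizers of $\frac12\|y-Xb\|_2^2+\lambda\|b\|_1$ over $b\in\mathbb R^p$ as $\lambda$ decreases from $\infty$ to $0$; a variable is selected when its coefficient first becomes nonzero along the path. - Least angle regression: start with zero coefficients and with the variable having the largest absolute inner product with $y$; move the coefficients of the included variables in their joint least-squares direction (for the current residual) until an unselected variable has as large an absolute inner product with the current residual; that variable is included in the next step; continue until the residual is zero or all variables are included. Rank. For a given procedure, $T$ is the rank of the first noise variable: one plus the number of signal variables selected before the first noise variable. *)

theory Defs
  imports "HOL-Probability.Probability" "Jordan_Normal_Form.Matrix"
begin

unbundle no inner_syntax
unbundle no vec_syntax

section \<open>Probabilistic notions\<close>

text \<open>The normal law parametrised by its \<^emph>\<open>variance\<close> (the library's density takes the standard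
  deviation); variance \<open>0\<close> is the point mass.\<close>

definition normal_law :: "real \<Rightarrow> real \<Rightarrow> real measure" where
  "normal_law \<mu> v =
     (if v = 0 then return borel \<mu> else density lborel (normal_density \<mu> (sqrt v)))"

text \<open>The members of the sequence live on possibly different probability spaces.\<close>

definition little_o_P_1 :: "(nat \<Rightarrow> 'a measure) \<Rightarrow> (nat \<Rightarrow> 'a \<Rightarrow> real) \<Rightarrow> bool" where
  "little_o_P_1 P R \<longleftrightarrow>
     (\<forall>l. R l \<in> borel_measurable (P l)) \<and>
     (\<forall>e>0. (\<lambda>l. measure (P l) {\<omega> \<in> space (P l). \<bar>R l \<omega>\<bar> > e}) \<longlonglongrightarrow> 0)"

section \<open>Least squares\<close>

definition sq_norm2 :: "real vec \<Rightarrow> real" where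
  "sq_norm2 v = v \<bullet> v"

definition coeffs_on :: "real mat \<Rightarrow> nat set \<Rightarrow> real vec set" where
  "coeffs_on X A = {b \<in> carrier_vec (dim_col X). \<forall>j<dim_col X. j \<notin> A \<longrightarrow> b $ j = 0}"

definition least_squares_coeffs :: "real mat \<Rightarrow> real vec \<Rightarrow> nat set \<Rightarrow> real vec \<Rightarrow> bool" where
  "least_squares_coeffs X y A b \<longleftrightarrow>
     is_arg_min (\<lambda>b. sq_norm2 (y - X *\<^sub>v b)) (\<lambda>b. b \<in> coeffs_on X A) b"

definition rss :: "real mat \<Rightarrow> real vec \<Rightarrow> nat set \<Rightarrow> real" where
  "rss X y A = (INF b \<in> coeffs_on X A. sq_norm2 (y - X *\<^sub>v b))"

section \<open>The three procedures\<close>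

text \<open>Variables are the column indices \<open>j < dim_col X\<close>. The procedures are formulated as relations,
  so that every way of breaking a tie is covered.\<close>

definition forward_stepwise_order :: "real mat \<Rightarrow> real vec \<Rightarrow> nat list \<Rightarrow> bool" where
  "forward_stepwise_order X y js \<longleftrightarrow>
     distinct js \<and> set js = {..<dim_col X} \<and>
     (\<forall>m<length js. \<forall>j<dim_col X. j \<notin> set (take m js) \<longrightarrow>
        rss X y (insert (js ! m) (set (take m js))) \<le> rss X y (insert j (set (take m js))))"

definition lasso_objective :: "real mat \<Rightarrow> real vec \<Rightarrow> real \<Rightarrow> real vec \<Rightarrow> real" where
  "lasso_objective X y lam b = 1 / 2 * sq_norm2 (y - X *\<^sub>v b) + lam * (\<Sum>j<dim_col X. \<bar>b $ j\<bar>)"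

definition lasso_path :: "real mat \<Rightarrow> real vec \<Rightarrow> (real \<Rightarrow> real vec) \<Rightarrow> bool" where
  "lasso_path X y b \<longleftrightarrow>
     (\<forall>lam>0. is_arg_min (lasso_objective X y lam) (\<lambda>b. b \<in> carrier_vec (dim_col X)) (b lam))"

text \<open>A state \<open>(js, b)\<close> of least angle regression consists of the variables included so far, in
  order of inclusion, and the coefficients at which the last one was included. The step length
  \<open>\<gamma>\<close> is the first one at which an unselected variable catches up with the included ones; if the
  residual vanishes there, there is no further step. The full least-squares move \<open>\<gamma> = 1\<close> makes
  all inner products with included variables zero, so that \<open>\<gamma> \<le> 1\<close> always.\<close>

definition lars_start :: "real mat \<Rightarrow> real vec \<Rightarrow> nat list \<times> real vec \<Rightarrow> bool" where
  "lars_start X y s \<longleftrightarrow>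
     (\<exists>j<dim_col X. (\<forall>i<dim_col X. \<bar>col X i \<bullet> y\<bar> \<le> \<bar>col X j \<bullet> y\<bar>) \<and> s = ([j], 0\<^sub>v (dim_col X)))"

definition lars_catches_up :: "real mat \<Rightarrow> real vec \<Rightarrow> nat set \<Rightarrow> nat \<Rightarrow> bool" where
  "lars_catches_up X r A j \<longleftrightarrow>
     j < dim_col X \<and> j \<notin> A \<and> (\<forall>i\<in>A. \<bar>col X i \<bullet> r\<bar> \<le> \<bar>col X j \<bullet> r\<bar>)"

inductive lars_step ::
    "real mat \<Rightarrow> real vec \<Rightarrow> nat list \<times> real vec \<Rightarrow> nat list \<times> real vec \<Rightarrow> bool"
  for X :: "real mat" and y :: "real vec" where
  "least_squares_coeffs X (y - X *\<^sub>v b) (set js) d \<Longrightarrow>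
   0 \<le> \<gamma> \<Longrightarrow>
   lars_catches_up X (y - X *\<^sub>v (b + \<gamma> \<cdot>\<^sub>v d)) (set js) j \<Longrightarrow>
   (\<And>\<gamma>' j'. 0 \<le> \<gamma>' \<Longrightarrow> \<gamma>' < \<gamma> \<Longrightarrow>
      \<not> lars_catches_up X (y - X *\<^sub>v (b + \<gamma>' \<cdot>\<^sub>v d)) (set js) j') \<Longrightarrow>
   y - X *\<^sub>v (b + \<gamma> \<cdot>\<^sub>v d) \<noteq> 0\<^sub>v (dim_row X) \<Longrightarrow>
   lars_step X y (js, b) (js @ [j], b + \<gamma> \<cdot>\<^sub>v d)"

definition lars_order :: "real mat \<Rightarrow> real vec \<Rightarrow> nat list \<Rightarrow> bool" where
  "lars_order X y js \<longleftrightarrow>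
     (\<exists>s b. lars_start X y s \<and> (lars_step X y)\<^sup>*\<^sup>* s (js, b) \<and> (\<nexists>s'. lars_step X y (js, b) s'))"

section \<open>Rank of the first noise variable\<close>

definition list_rank :: "real vec \<Rightarrow> nat list \<Rightarrow> nat" where
  "list_rank \<beta> js = 1 + length (takeWhile (\<lambda>j. \<beta> $ j \<noteq> 0) js)"

text \<open>A variable \<open>i\<close> is selected before the first noise variable iff its coefficient is nonzero at
  some \<open>lam\<close> such that all noise coefficients have been zero from \<open>\<infinity>\<close> down to \<open>lam\<close>.\<close>

definition path_rank :: "real vec \<Rightarrow> (real \<Rightarrow> real vec) \<Rightarrow> nat" where
  "path_rank \<beta> b = 1 + card {i. i < dim_vec \<beta> \<and> \<beta> $ i \<noteq> 0 \<and>
     (\<exists>lam>0. b lam $ i \<noteq> 0 \<and> (\<forall>\<mu>\<ge>lam. \<forall>j<dim_vec \<beta>. \<beta> $ j = 0 \<longrightarrow> b \<mu> $ j = 0))}"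

datatype procedure = Forward_Stepwise | Lasso | Least_Angle_Regression

text \<open>\<open>first_noise_rank proc X y \<beta> T\<close>: \<open>T\<close> is the rank of the first noise variable in some run of
  \<open>proc\<close>. If a run selects no noise variable at all, \<open>T\<close> is one plus the number of variables that
  it selects.\<close>

fun first_noise_rank ::
    "procedure \<Rightarrow> real mat \<Rightarrow> real vec \<Rightarrow> real vec \<Rightarrow> nat \<Rightarrow> bool" where
  "first_noise_rank Forward_Stepwise X y \<beta> T \<longleftrightarrow>
     (\<exists>js. forward_stepwise_order X y js \<and> T = list_rank \<beta> js)"
| "first_noise_rank Lasso X y \<beta> T \<longleftrightarrow>
     (\<exists>b. lasso_path X y b \<and> T = path_rank \<beta> b)"
| "first_noise_rank Least_Angle_Regression X y \<beta> T \<longleftrightarrow>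
     (\<exists>js. lars_order X y js \<and> T = list_rank \<beta> js)"

end

theory Submission
  imports Defs "HOL-Real_Asymp.Real_Asymp"
begin

text \<open>Ranking the variables by their scores \<open>\<bar>X\<^sub>j \<bullet> y\<bar>\<close> is marginal screening. The proof shows that,
up to the first noise variable, each of the three procedures is marginal screening with a negligible
error, and then counts the signal variables whose score beats all the noise scores.

\<^emph>\<open>Deterministic part.\<close> The columns of a Gaussian design are nearly orthonormal: all entries of
the Gram matrix are within \<open>\<mu>\<close> of those of the identity, where \<open>\<mu>\<close> is of order \<open>(log p)\<^sup>2 / sqrt n\<close>.
While at most \<open>N\<close> variables are active, the coefficients have \<open>l\<^sub>1\<close>-norm of order \<open>N B\<close>, where \<open>B\<close>
bounds the scores, so that they perturb the correlation of an inactive variable with the residual by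
at most a multiple of \<open>\<mu> N B\<close>. For \<open>N = exp (O (sqrt (log p)))\<close> this tends to zero even when compared
with the standard deviation \<open>\<rho> = |y| / sqrt n\<close> of a noise score. Hence the score of each of the first \<open>N\<close>
selected variables is at least that of the best noise variable not yet selected, minus a small \<open>e\<close>, and
the rank is at most one plus the number of signal variables with such a large score
(\<open>first_noise_rank_le\<close>). For forward stepwise regression this follows from a comparison of residual
sums of squares, for least angle regression from an invariant of the steps, and for the lasso from
the optimality conditions at one well-chosen penalty.

\<^emph>\<open>Probabilistic part.\<close> Given \<open>y\<close>, the \<open>p - k\<close> noise scores are independent normal variables with
standard deviation \<open>\<rho>\<close>, so that the largest exceeds \<open>\<rho> (sqrt (2 log p) - o(1))\<close>. The score of a
signal variable is \<open>M |X\<^sub>j|\<^sup>2\<close> plus the product of \<open>X\<^sub>j\<close> with the response \<open>y - M X\<^sub>j\<close> of the model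
without \<open>j\<close>. The latter is normal with standard deviation about \<open>\<rho>\<close> because \<open>X\<^sub>j\<close> is independent of
\<open>y - M X\<^sub>j\<close>, and the former is in absolute value at most \<open>\<rho> (sqrt (\<delta> / \<epsilon>) + o(1))\<close> because \<open>n \<rho>\<^sup>2\<close> is at least
\<open>(1 - o(1)) k M\<^sup>2\<close>. A signal variable can thus beat the noise only if a standard normal variable exceeds
\<open>sqrt (2 log p) - sqrt (\<delta> / \<epsilon>) - o(1)\<close> in absolute value, which has probability
\<open>1 / p * exp ((1 + o(1)) sqrt (2 \<delta> log p / \<epsilon>))\<close>. Markov's inequality for the number of such signal
variables gives the claimed bound. All these events are estimated for a fixed noise vector \<open>z\<close> and
then integrated over \<open>z\<close> (\<open>prob_freeze\<close>). The estimates hold for every fixed slack \<open>h\<close>; a diagonal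
choice of \<open>h\<close> tending to zero yields the \<open>o(1)\<close> in probability (\<open>random_exponent_bound\<close>).\<close>

section \<open>Least squares with nearly orthonormal columns\<close>

text \<open>The response is replaced by what the procedures see of it: the scores, bounded by \<open>B\<close>, and the
Gram matrix, within the coherence \<open>\<mu>\<close> of the identity.\<close>

locale near_orthonormal_design =
  fixes X :: "real mat" and y :: "real vec" and \<mu> B :: real
  assumes y_dim: "y \<in> carrier_vec (dim_row X)"
    and gram: "\<And>i j. i < dim_col X \<Longrightarrow> j < dim_col X \<Longrightarrow>
          \<bar>col X i \<bullet> col X j - (if i = j then 1 else 0)\<bar> \<le> \<mu>"
    and corr_bound: "\<And>i. i < dim_col X \<Longrightarrow> \<bar>col X i \<bullet> y\<bar> \<le> B"
begin

abbreviation p where "p \<equiv> dim_col X"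
definition score where "score i = col X i \<bullet> y"
definition G where "G i j = col X i \<bullet> col X j"

lemma col_mult_mat_vec:
  assumes "i < p" "b \<in> carrier_vec p"
  shows "col X i \<bullet> (X *\<^sub>v b) = (\<Sum>j<p. G i j * b $ j)"
proof -
  have "col X i \<bullet> (X *\<^sub>v b) = (\<Sum>a<dim_row X. X $$ (a, i) * (\<Sum>j<p. X $$ (a, j) * b $ j))"
    using assms by (auto simp: scalar_prod_def lessThan_atLeast0 intro!: sum.cong)
  also have "\<dots> = (\<Sum>j<p. \<Sum>a<dim_row X. X $$ (a, i) * X $$ (a, j) * b $ j)"
    by (subst sum.swap) (simp add: sum_distrib_left mult.assoc)
  also have "\<dots> = (\<Sum>j<p. G i j * b $ j)"
    unfolding G_def using assms
    by (auto simp: scalar_prod_def lessThan_atLeast0 sum_distrib_right intro!: sum.cong)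
  finally show ?thesis .
qed

lemma fit_carrier [simp]: "X *\<^sub>v b \<in> carrier_vec (dim_row X)"
  by (rule carrier_vecI) simp

lemma gram_G: "i < p \<Longrightarrow> j < p \<Longrightarrow> \<bar>G i j - (if i = j then 1 else 0)\<bar> \<le> \<mu>"
  unfolding G_def by (rule gram)

lemma residual_corr:
  assumes "i < p" "b \<in> carrier_vec p"
  shows "col X i \<bullet> (y - X *\<^sub>v b) = score i - (\<Sum>j<p. G i j * b $ j)"
  using assms y_dim col_mult_mat_vec[OF assms]
  by (subst scalar_prod_minus_distrib[of _ "dim_row X"]) (auto simp: score_def)

lemma mult_mat_vec_scalar:
  assumes "b \<in> carrier_vec p" "w \<in> carrier_vec (dim_row X)"
  shows "(X *\<^sub>v b) \<bullet> w = (\<Sum>i<p. b $ i * (col X i \<bullet> w))"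
proof -
  have "(X *\<^sub>v b) \<bullet> w = (\<Sum>a<dim_row X. (\<Sum>i<p. X $$ (a, i) * b $ i) * w $ a)"
    using assms by (auto simp: scalar_prod_def lessThan_atLeast0 intro!: sum.cong)
  also have "\<dots> = (\<Sum>i<p. \<Sum>a<dim_row X. X $$ (a, i) * b $ i * w $ a)"
    by (subst sum.swap) (simp add: sum_distrib_right)
  also have "\<dots> = (\<Sum>i<p. b $ i * (col X i \<bullet> w))"
    using assms
    by (auto simp: scalar_prod_def lessThan_atLeast0 sum_distrib_left mult_ac intro!: sum.cong)
  finally show ?thesis .
qed

definition quad where "quad b = (\<Sum>i<p. \<Sum>j<p. b i * b j * G i j)"

lemma quad_fit:
  assumes "b \<in> carrier_vec p"
  shows "(X *\<^sub>v b) \<bullet> (X *\<^sub>v b) = quad (\<lambda>i. b $ i)"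
proof -
  have "(X *\<^sub>v b) \<bullet> (X *\<^sub>v b) = (\<Sum>i<p. b $ i * (col X i \<bullet> (X *\<^sub>v b)))"
    using assms by (intro mult_mat_vec_scalar) auto
  also have "\<dots> = quad (\<lambda>i. b $ i)"
    unfolding quad_def
    by (rule sum.cong) (use assms in \<open>auto simp: col_mult_mat_vec sum_distrib_left mult_ac\<close>)
  finally show ?thesis .
qed

lemma quad_nonneg: "0 \<le> quad b"
proof -
  have "quad b = quad (\<lambda>i. vec p b $ i)" unfolding quad_def by simp
  also have "\<dots> = (X *\<^sub>v vec p b) \<bullet> (X *\<^sub>v vec p b)" by (rule quad_fit[symmetric]) simp
  also have "\<dots> \<ge> 0" unfolding scalar_prod_def by (simp add: sum_nonneg)
  finally show ?thesis .
qed

lemma sq_norm2_residual: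
  assumes "b \<in> carrier_vec p"
  shows "sq_norm2 (y - X *\<^sub>v b) = y \<bullet> y - 2 * (\<Sum>i<p. b $ i * score i) + quad (\<lambda>i. b $ i)"
proof -
  let ?u = "X *\<^sub>v b"
  have u: "?u \<in> carrier_vec (dim_row X)" by simp
  have "sq_norm2 (y - ?u) = y \<bullet> y - ?u \<bullet> y - (y \<bullet> ?u - ?u \<bullet> ?u)"
    unfolding sq_norm2_def using y_dim u
    by (simp add: scalar_prod_minus_distrib[of _ "dim_row X"] minus_scalar_prod_distrib[of _ "dim_row X"])
  moreover have "y \<bullet> ?u = ?u \<bullet> y"
    using y_dim u by (rule comm_scalar_prod)
  ultimately show ?thesis
    using mult_mat_vec_scalar[OF assms y_dim] quad_fit[OF assms] by (simp add: score_def)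
qed

lemma mu_nonneg: "i < p \<Longrightarrow> 0 \<le> \<mu>"
  using gram[of i i] by linarith

text \<open>Coordinates outside \<open>i\<close> enter the \<open>i\<close>-th coordinate of \<open>G b\<close> only through off-diagonal entries. This
is the sole way in which active variables disturb the correlation of another one with the residual.\<close>

lemma gram_row:
  assumes "i < p"
  shows "\<bar>(\<Sum>j<p. G i j * b j) - b i\<bar> \<le> \<mu> * (\<Sum>j<p. \<bar>b j\<bar>)"
proof -
  have "b i = (\<Sum>j<p. (if i = j then 1 else 0) * b j)"
    using assms by (simp add: sum.delta' if_distrib[of "\<lambda>z. z * _"] cong: if_cong)
  then have "(\<Sum>j<p. G i j * b j) - b i = (\<Sum>j<p. (G i j - (if i = j then 1 else 0)) * b j)"
    by (simp add: sum_subtractf left_diff_distrib)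
  also have "\<bar>\<dots>\<bar> \<le> (\<Sum>j<p. \<bar>(G i j - (if i = j then 1 else 0)) * b j\<bar>)"
    by (rule sum_abs)
  also have "\<dots> \<le> (\<Sum>j<p. \<mu> * \<bar>b j\<bar>)"
    by (intro sum_mono) (use gram_G assms in \<open>simp add: abs_mult mult_right_mono del: abs_le_D1\<close>)
  finally show ?thesis by (simp add: sum_distrib_left)
qed

lemma quad_approx: "\<bar>quad b - (\<Sum>i<p. (b i)\<^sup>2)\<bar> \<le> \<mu> * (\<Sum>i<p. \<bar>b i\<bar>)\<^sup>2"
proof -
  have "quad b - (\<Sum>i<p. (b i)\<^sup>2) = (\<Sum>i<p. b i * ((\<Sum>j<p. G i j * b j) - b i))"
    unfolding quad_def
    by (simp add: sum_subtractf right_diff_distrib sum_distrib_left mult_ac power2_eq_square)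
  also have "\<bar>\<dots>\<bar> \<le> (\<Sum>i<p. \<bar>b i * ((\<Sum>j<p. G i j * b j) - b i)\<bar>)"
    by (rule sum_abs)
  also have "\<dots> \<le> (\<Sum>i<p. \<bar>b i\<bar> * (\<mu> * (\<Sum>j<p. \<bar>b j\<bar>)))"
    by (rule sum_mono) (use gram_row in \<open>auto simp: abs_mult intro!: mult_left_mono\<close>)
  also have "\<dots> = \<mu> * (\<Sum>i<p. \<bar>b i\<bar>)\<^sup>2"
    by (subst sum_distrib_right[symmetric]) (simp add: power2_eq_square mult_ac)
  finally show ?thesis .
qed

end

text \<open>Cauchy-Schwarz on the support; it turns \<open>l\<^sub>1\<close> errors into \<open>l\<^sub>2\<close> errors for sparse vectors.\<close>

lemma sum_abs_squared_le_card:
  fixes b :: "nat \<Rightarrow> real"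
  assumes "finite I" "A \<subseteq> I" "\<And>i. i \<in> I \<Longrightarrow> i \<notin> A \<Longrightarrow> b i = 0"
  shows "(\<Sum>i\<in>I. \<bar>b i\<bar>)\<^sup>2 \<le> card A * (\<Sum>i\<in>I. (b i)\<^sup>2)"
proof -
  have "(\<Sum>i\<in>I. \<bar>b i\<bar>) = (\<Sum>i\<in>A. \<bar>b i\<bar> * 1)" "(\<Sum>i\<in>I. (b i)\<^sup>2) = (\<Sum>i\<in>A. (b i)\<^sup>2)"
    using assms by (auto intro!: sum.mono_neutral_right)
  then show ?thesis
    using Cauchy_Schwarz_ineq_sum[of "\<lambda>i. \<bar>b i\<bar>" "\<lambda>_. 1" A] by (simp add: mult.commute)
qed

context near_orthonormal_design begin

lemma quad_sandwich:
  assumes "A \<subseteq> {..<p}" "\<And>i. i < p \<Longrightarrow> i \<notin> A \<Longrightarrow> b i = 0"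
  shows "\<bar>quad b - (\<Sum>i<p. (b i)\<^sup>2)\<bar> \<le> \<mu> * card A * (\<Sum>i<p. (b i)\<^sup>2)"
proof (cases "p = 0")
  case False
  have "\<mu> * (\<Sum>i<p. \<bar>b i\<bar>)\<^sup>2 \<le> \<mu> * (card A * (\<Sum>i<p. (b i)\<^sup>2))"
    by (rule mult_left_mono[OF sum_abs_squared_le_card]) (use assms mu_nonneg[of 0] False in auto)
  then show ?thesis using quad_approx[of b] by (simp add: mult_ac)
qed (simp add: quad_def)

lemma bdd_below_sq_norm2: "bdd_below ((\<lambda>b. sq_norm2 (y - X *\<^sub>v b)) ` S)"
  by (rule bdd_belowI[of _ 0]) (auto simp: sq_norm2_def scalar_prod_def sum_nonneg)

text \<open>The coefficients \<open>score\<close> on \<open>A\<close> would be the least squares solution for exactly orthonormal columns.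
They are used as a competitor, so that the least squares solution itself is never needed.\<close>

lemma rss_upper:
  assumes "A \<subseteq> {..<p}"
  shows "rss X y A \<le> y \<bullet> y - (1 - \<mu> * card A) * (\<Sum>i\<in>A. (score i)\<^sup>2)"
proof -
  define b where "b = vec p (\<lambda>i. if i \<in> A then score i else 0)"
  have b: "b \<in> carrier_vec p" "b \<in> coeffs_on X A"
    unfolding b_def coeffs_on_def by auto
  have fin: "finite A" using assms finite_subset by blast
  have s1: "(\<Sum>i<p. b $ i * score i) = (\<Sum>i\<in>A. (score i)\<^sup>2)" "(\<Sum>i<p. (b $ i)\<^sup>2) = (\<Sum>i\<in>A. (score i)\<^sup>2)"
    unfolding b_def using assms
    by (auto intro!: sum.mono_neutral_cong_right simp: power2_eq_square)
  have "rss X y A \<le> sq_norm2 (y - X *\<^sub>v b)"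
    unfolding rss_def by (rule cINF_lower[OF bdd_below_sq_norm2 b(2)])
  also have "\<dots> = y \<bullet> y - 2 * (\<Sum>i\<in>A. (score i)\<^sup>2) + quad (\<lambda>i. b $ i)"
    using sq_norm2_residual[OF b(1)] s1 by simp
  also have "\<dots> \<le> y \<bullet> y - (1 - \<mu> * card A) * (\<Sum>i\<in>A. (score i)\<^sup>2)"
    using quad_sandwich[of A "\<lambda>i. b $ i"] assms s1
    by (auto simp: b_def algebra_simps)
  finally show ?thesis .
qed

text \<open>The restricted objective dominates a separable quadratic with curvature \<open>1 - \<mu> |A|\<close>, whose minimum is
explicit by completing squares.\<close>

lemma rss_lower:
  assumes "A \<subseteq> {..<p}" "\<mu> * card A < 1"
  shows "y \<bullet> y - (\<Sum>i\<in>A. (score i)\<^sup>2) / (1 - \<mu> * card A) \<le> rss X y A"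
  unfolding rss_def
proof (rule cINF_greatest)
  show "coeffs_on X A \<noteq> {}"
    by (auto simp: coeffs_on_def intro!: exI[of _ "0\<^sub>v p"])
next
  fix b assume "b \<in> coeffs_on X A"
  then have b: "b \<in> carrier_vec p" "\<And>i. i < p \<Longrightarrow> i \<notin> A \<Longrightarrow> b $ i = 0"
    unfolding coeffs_on_def by auto
  define \<kappa> where "\<kappa> = 1 - \<mu> * card A"
  have \<kappa>: "\<kappa> > 0" using assms by (simp add: \<kappa>_def)
  have s1: "(\<Sum>i<p. b $ i * score i) = (\<Sum>i\<in>A. b $ i * score i)" "(\<Sum>i<p. (b $ i)\<^sup>2) = (\<Sum>i\<in>A. (b $ i)\<^sup>2)"
    using assms b by (auto intro!: sum.mono_neutral_right)
  have "0 \<le> \<kappa> * (\<Sum>i\<in>A. (b $ i - score i / \<kappa>)\<^sup>2)"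
    using \<kappa> by (simp add: sum_nonneg)
  also have "\<dots> = (\<Sum>i\<in>A. \<kappa> * (b $ i)\<^sup>2 - 2 * (b $ i * score i) + (score i)\<^sup>2 / \<kappa>)"
    unfolding sum_distrib_left using \<kappa>
    by (intro sum.cong) (auto simp: power2_diff field_simps power2_eq_square)
  also have "\<dots> = \<kappa> * (\<Sum>i\<in>A. (b $ i)\<^sup>2) - 2 * (\<Sum>i\<in>A. b $ i * score i) + (\<Sum>i\<in>A. (score i)\<^sup>2) / \<kappa>"
    by (simp add: sum.distrib sum_subtractf sum_distrib_left sum_divide_distrib)
  finally have *: "2 * (\<Sum>i\<in>A. b $ i * score i) \<le> \<kappa> * (\<Sum>i\<in>A. (b $ i)\<^sup>2) + (\<Sum>i\<in>A. (score i)\<^sup>2) / \<kappa>"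
    by simp
  have "\<kappa> * (\<Sum>i\<in>A. (b $ i)\<^sup>2) \<le> quad (\<lambda>i. b $ i)"
    using quad_sandwich[OF assms(1), of "\<lambda>i. b $ i"] b s1 by (auto simp: \<kappa>_def algebra_simps)
  with * show "y \<bullet> y - (\<Sum>i\<in>A. (score i)\<^sup>2) / (1 - \<mu> * card A) \<le> sq_norm2 (y - X *\<^sub>v b)"
    using sq_norm2_residual[OF b(1)] s1 unfolding \<kappa>_def[symmetric] by simp
qed

text \<open>In the orthonormal case adding a variable lowers the residual sum of squares by its squared score. The
sandwich of the previous two lemmas costs a factor \<open>(1 - \<mu> (|A| + 1))\<^sup>2\<close> applied to at most \<open>|A| + 1\<close> squared
scores, which is the error term here.\<close>

lemma stepwise_comparison:
  assumes "A \<subseteq> {..<p}" "i < p" "j < p" "i \<notin> A" "j \<notin> A"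
    and small: "\<mu> * Suc (card A) < 1"
    and le: "rss X y (insert i A) \<le> rss X y (insert j A)"
  shows "(score j)\<^sup>2 - 2 * \<mu> * (Suc (card A))\<^sup>2 * B\<^sup>2 \<le> (score i)\<^sup>2"
proof -
  have fin: "finite A" using assms finite_subset by blast
  define \<kappa> where "\<kappa> = 1 - \<mu> * Suc (card A)"
  have mu: "\<mu> \<ge> 0" using mu_nonneg assms by blast
  have \<kappa>: "\<kappa> > 0" "\<kappa> \<le> 1" using assms mu by (auto simp: \<kappa>_def)
  have lo: "y \<bullet> y - (\<Sum>a\<in>insert i A. (score a)\<^sup>2) / \<kappa> \<le> rss X y (insert i A)"
    using rss_lower[of "insert i A"] assms fin by (auto simp: \<kappa>_def)
  have up: "rss X y (insert j A) \<le> y \<bullet> y - \<kappa> * (\<Sum>a\<in>insert j A. (score a)\<^sup>2)"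
    using rss_upper[of "insert j A"] assms fin by (auto simp: \<kappa>_def)
  define s where "s = (\<Sum>a\<in>A. (score a)\<^sup>2)"
  have "\<kappa> * (\<Sum>a\<in>insert j A. (score a)\<^sup>2) \<le> (\<Sum>a\<in>insert i A. (score a)\<^sup>2) / \<kappa>"
    using lo up le by linarith
  then have "\<kappa> * ((score j)\<^sup>2 + s) \<le> ((score i)\<^sup>2 + s) / \<kappa>"
    using fin assms by (simp add: s_def)
  then have key: "\<kappa>\<^sup>2 * ((score j)\<^sup>2 + s) \<le> (score i)\<^sup>2 + s"
    using \<kappa> by (simp add: field_simps power2_eq_square)
  have sq: "(score a)\<^sup>2 \<le> B\<^sup>2" if "a < p" for a
    using corr_bound[OF that] by (simp add: score_def abs_le_square_iff[symmetric])
  have "s \<le> (\<Sum>a\<in>A. B\<^sup>2)"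
    unfolding s_def by (rule sum_mono) (use sq assms in auto)
  then have "(score j)\<^sup>2 + s \<le> Suc (card A) * B\<^sup>2"
    using sq[OF \<open>j < p\<close>] by (simp add: algebra_simps)
  moreover have "1 - \<kappa>\<^sup>2 \<le> 2 * (\<mu> * Suc (card A))"
    unfolding \<kappa>_def by (simp add: power2_diff)
  moreover have "0 \<le> (score j)\<^sup>2 + s" by (simp add: s_def sum_nonneg)
  ultimately have "(1 - \<kappa>\<^sup>2) * ((score j)\<^sup>2 + s) \<le> (2 * (\<mu> * Suc (card A))) * (Suc (card A) * B\<^sup>2)"
    using mu by (intro mult_mono) auto
  then show ?thesis using key by (simp add: algebra_simps power2_eq_square)
qed

end

lemma real_le_of_all_small:
  fixes x z K :: real
  assumes "\<And>t. 0 < t \<Longrightarrow> t \<le> 1 \<Longrightarrow> x \<le> z + t * K"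
  shows "x \<le> z"
proof (rule ccontr)
  assume "\<not> x \<le> z"
  define t where "t = min 1 ((x - z) / (2 * (\<bar>K\<bar> + 1)))"
  have t: "0 < t" "t \<le> 1" using \<open>\<not> x \<le> z\<close> by (auto simp: t_def)
  have "t * K \<le> t * (\<bar>K\<bar> + 1)" using t by (intro mult_left_mono) auto
  also have "\<dots> \<le> (x - z) / (2 * (\<bar>K\<bar> + 1)) * (\<bar>K\<bar> + 1)"
    by (rule mult_right_mono) (auto simp: t_def)
  also have "\<dots> = (x - z) / 2" by (simp add: field_simps)
  finally show False using assms[OF t] \<open>\<not> x \<le> z\<close> by (simp add: field_simps)
qed

section \<open>Optimality conditions\<close>

lemma mult_mat_vec_unit_vec:
  fixes X :: "real mat"
  assumes "i < dim_col X"
  shows "X *\<^sub>v unit_vec (dim_col X) i = col X i"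
  using assms by (intro eq_vecI) auto

text \<open>Both the normal equations and the lasso optimality conditions come from varying one coordinate.\<close>

lemma sq_norm2_perturb:
  fixes X :: "real mat"
  assumes "w \<in> carrier_vec (dim_row X)" "b \<in> carrier_vec (dim_col X)" "i < dim_col X"
  shows "sq_norm2 (w - X *\<^sub>v (b + h \<cdot>\<^sub>v unit_vec (dim_col X) i)) =
    sq_norm2 (w - X *\<^sub>v b) - 2 * h * (col X i \<bullet> (w - X *\<^sub>v b)) + h\<^sup>2 * (col X i \<bullet> col X i)"
proof -
  let ?n = "dim_row X" and ?v = "col X i" and ?r = "w - X *\<^sub>v b"
  have score: "?v \<in> carrier_vec ?n" "?r \<in> carrier_vec ?n" "X *\<^sub>v b \<in> carrier_vec ?n"
    using assms by (auto intro!: carrier_vecI)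
  have X: "X \<in> carrier_mat ?n (dim_col X)" by simp
  have "X *\<^sub>v (b + h \<cdot>\<^sub>v unit_vec (dim_col X) i) = X *\<^sub>v b + h \<cdot>\<^sub>v ?v"
    using assms by (simp add: mult_add_distrib_mat_vec[OF X] mult_mat_vec[OF X] mult_mat_vec_unit_vec)
  then have "w - X *\<^sub>v (b + h \<cdot>\<^sub>v unit_vec (dim_col X) i) = ?r - h \<cdot>\<^sub>v ?v"
    using assms score by (intro eq_vecI) auto
  then have "sq_norm2 (w - X *\<^sub>v (b + h \<cdot>\<^sub>v unit_vec (dim_col X) i)) =
      ?r \<bullet> ?r - h * (?v \<bullet> ?r) - (h * (?r \<bullet> ?v) - h * (h * (?v \<bullet> ?v)))"
    unfolding sq_norm2_def using score
    by (simp add: scalar_prod_minus_distrib[of _ ?n] minus_scalar_prod_distrib[of _ ?n] algebra_simps)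
  moreover have "?r \<bullet> ?v = ?v \<bullet> ?r" using score by (intro comm_scalar_prod[of _ ?n])
  ultimately show ?thesis unfolding sq_norm2_def by (simp add: power2_eq_square algebra_simps)
qed

lemma normal_equation:
  fixes X :: "real mat"
  assumes ls: "least_squares_coeffs X w A d" and w: "w \<in> carrier_vec (dim_row X)"
    and i: "i \<in> A" "i < dim_col X"
  shows "col X i \<bullet> (w - X *\<^sub>v d) = 0"
proof -
  define g where "g = col X i \<bullet> (w - X *\<^sub>v d)"
  define a where "a = col X i \<bullet> col X i"
  have d: "d \<in> coeffs_on X A" "d \<in> carrier_vec (dim_col X)"
    using ls unfolding least_squares_coeffs_def is_arg_min_def coeffs_on_def by auto
  have key: "2 * h * g \<le> h\<^sup>2 * a" for h
  proof -
    have "d + h \<cdot>\<^sub>v unit_vec (dim_col X) i \<in> coeffs_on X A"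
      using d i unfolding coeffs_on_def by auto
    then have "sq_norm2 (w - X *\<^sub>v d) \<le> sq_norm2 (w - X *\<^sub>v (d + h \<cdot>\<^sub>v unit_vec (dim_col X) i))"
      using ls unfolding least_squares_coeffs_def is_arg_min_def by (meson not_less)
    then show ?thesis
      using sq_norm2_perturb[OF w d(2) i(2), of h] by (simp add: g_def a_def)
  qed
  have "2 * g\<^sup>2 \<le> 0 + t * (g\<^sup>2 * a)" if "0 < t" for t
    proof -
    have "t * (2 * g\<^sup>2) \<le> t * (t * (g\<^sup>2 * a))"
      using key[of "t * g"] by (simp add: power2_eq_square mult_ac)
    then show ?thesis using that by simp
  qed
  then have "2 * g\<^sup>2 \<le> 0"
    by (rule real_le_of_all_small)
  then show ?thesis by (simp add: g_def)
qed

context near_orthonormal_design begin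

definition residual_correlation where "residual_correlation b i = col X i \<bullet> (y - X *\<^sub>v b)"

lemma residual_correlation_eq:
  "b \<in> carrier_vec p \<Longrightarrow> i < p \<Longrightarrow> residual_correlation b i = score i - (\<Sum>j<p. G i j * b $ j)"
  unfolding residual_correlation_def by (rule residual_corr)

lemma residual_correlation_off_support:
  assumes "b \<in> carrier_vec p" "i < p" "b $ i = 0"
  shows "\<bar>residual_correlation b i - score i\<bar> \<le> \<mu> * (\<Sum>j<p. \<bar>b $ j\<bar>)"
  using gram_row[OF assms(2), of "\<lambda>j. b $ j"] residual_correlation_eq[OF assms(1,2)] assms(3) by simp

text \<open>Optimality along a coordinate line is an inequality between a line and a parabola plus an absolute
value. Small steps in either direction give the first claim; shrinking \<open>b $ i\<close> towards zero gives the
second, since there the penalty changes linearly even when \<open>b $ i\<close> is small.\<close>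

lemma lasso_kkt:
  assumes min: "is_arg_min (lasso_objective X y lam) (\<lambda>b. b \<in> carrier_vec p) b"
    and lam: "0 < lam" and i: "i < p"
  shows "\<bar>residual_correlation b i\<bar> \<le> lam"
    and "b $ i * residual_correlation b i = lam * \<bar>b $ i\<bar>"
proof -
  define g where "g = residual_correlation b i"
  define a where "a = G i i"
  have b: "b \<in> carrier_vec p" using min by (simp add: is_arg_min_def)
  have key: "h * g \<le> h\<^sup>2 * a / 2 + lam * (\<bar>b $ i + h\<bar> - \<bar>b $ i\<bar>)" for h
  proof -
    let ?b = "b + h \<cdot>\<^sub>v unit_vec p i"
    have "?b \<in> carrier_vec p" using b by auto
    then have le: "lasso_objective X y lam b \<le> lasso_objective X y lam ?b"
      using min unfolding is_arg_min_def by (meson not_less)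
    have "(\<Sum>j<p. \<bar>?b $ j\<bar>) - (\<Sum>j<p. \<bar>b $ j\<bar>) = (\<Sum>j<p. if j = i then \<bar>b $ i + h\<bar> - \<bar>b $ i\<bar> else 0)"
      unfolding sum_subtractf[symmetric] using b i by (intro sum.cong) auto
    also have "\<dots> = \<bar>b $ i + h\<bar> - \<bar>b $ i\<bar>" using i by (simp add: sum.delta)
    finally have l1: "(\<Sum>j<p. \<bar>?b $ j\<bar>) = (\<Sum>j<p. \<bar>b $ j\<bar>) + (\<bar>b $ i + h\<bar> - \<bar>b $ i\<bar>)"
      by simp
    show ?thesis
      using le sq_norm2_perturb[OF y_dim b i, of h]
      unfolding lasso_objective_def l1 residual_correlation_def[symmetric] g_def[symmetric]
        G_def[symmetric] a_def[symmetric]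
      by (simp add: algebra_simps)
  qed
  have "\<bar>g\<bar> \<le> lam + t * (a / 2)" if t: "0 < t" for t
  proof -
    have "(t * sgn g) * g \<le> (t * sgn g)\<^sup>2 * a / 2 + lam * (\<bar>b $ i + t * sgn g\<bar> - \<bar>b $ i\<bar>)"
      by (rule key)
    moreover have "lam * (\<bar>b $ i + t * sgn g\<bar> - \<bar>b $ i\<bar>) \<le> lam * (t * \<bar>sgn g\<bar>)"
      using lam t abs_triangle_ineq[of "b $ i" "t * sgn g"]
      by (intro mult_left_mono) (auto simp: abs_mult)
    moreover have "t * sgn g * g = t * \<bar>g\<bar>" by (simp add: sgn_if abs_if)
    moreover have "a \<ge> 0" unfolding a_def G_def scalar_prod_def by (simp add: sum_nonneg)
    moreover have "(t * sgn g)\<^sup>2 \<le> t * t" by (auto simp: sgn_if power2_eq_square)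
    ultimately have "t * \<bar>g\<bar> \<le> t * t * a / 2 + lam * (t * \<bar>sgn g\<bar>)"
      by (smt (verit) divide_right_mono mult_right_mono)
    also have "lam * (t * \<bar>sgn g\<bar>) \<le> lam * t" using lam t by (auto simp: sgn_if)
    finally have "t * \<bar>g\<bar> \<le> t * (lam + t * (a / 2))" by (simp add: algebra_simps)
    then show ?thesis using t by simp
  qed
  then show g_le: "\<bar>residual_correlation b i\<bar> \<le> lam"
    unfolding g_def by (rule real_le_of_all_small)
  have "lam * \<bar>b $ i\<bar> \<le> b $ i * g + t * ((b $ i)\<^sup>2 * a / 2)" if t: "0 < t" "t \<le> 1" for t
  proof -
    have "\<bar>b $ i + (- t * b $ i)\<bar> = (1 - t) * \<bar>b $ i\<bar>"
    proof -
      have "b $ i + (- t * b $ i) = (1 - t) * b $ i" by (simp add: algebra_simps)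
      then show ?thesis using t by (simp add: abs_mult)
    qed
    then have "(- t * b $ i) * g \<le> (- t * b $ i)\<^sup>2 * a / 2 + lam * ((1 - t) * \<bar>b $ i\<bar> - \<bar>b $ i\<bar>)"
      using key[of "- t * b $ i"] by simp
    then have "t * (lam * \<bar>b $ i\<bar>) \<le> t * (b $ i * g + t * ((b $ i)\<^sup>2 * a / 2))"
      by (simp add: algebra_simps power2_eq_square)
    then show ?thesis using t by simp
  qed
  then have 1: "lam * \<bar>b $ i\<bar> \<le> b $ i * g"
    by (rule real_le_of_all_small)
  have "b $ i * g \<le> \<bar>b $ i\<bar> * \<bar>g\<bar>" by (metis abs_ge_self abs_mult)
  also have "\<dots> \<le> \<bar>b $ i\<bar> * lam" using g_le by (intro mult_left_mono) (auto simp: g_def)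
  finally show "b $ i * residual_correlation b i = lam * \<bar>b $ i\<bar>"
    using 1 by (simp add: g_def mult.commute)
qed

end

section \<open>The procedures are close to marginal screening\<close>

text \<open>\<open>Big\<close> stands for the signal variables that come within \<open>e\<close> of the best noise score \<open>L\<close>. The smallness
condition makes coherence errors of order \<open>N \<mu> B\<close> a small fraction of \<open>e\<close>; forward stepwise regression, which
compares squared scores, needs the squares, and the constant \<open>32\<close> serves all three procedures.\<close>

locale screening = near_orthonormal_design +
  fixes L e :: real and Big :: "nat set" and N :: nat
  assumes e_pos: "0 < e" and e_le: "e \<le> L" and L_le: "L \<le> B"
    and Big_sub: "Big \<subseteq> {..<p}" and N_def: "N = Suc (card Big)"
    and small: "32 * (real N)\<^sup>2 * \<mu> * B\<^sup>2 \<le> e\<^sup>2"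
begin

lemma B_pos: "0 < B" and eB: "e \<le> B"
  using e_pos e_le L_le by auto

lemma N_pos: "1 \<le> real N" by (simp add: N_def)

lemma mu_small:
  assumes "0 \<le> \<mu>"
  shows "32 * real N * \<mu> * B \<le> e" "32 * real N * \<mu> \<le> 1" "32 * real N * \<mu> * B\<^sup>2 \<le> e\<^sup>2 / real N"
proof -
  show 3: "32 * real N * \<mu> * B\<^sup>2 \<le> e\<^sup>2 / real N"
    using small N_pos by (simp add: field_simps power2_eq_square)
  also have "\<dots> \<le> e\<^sup>2 / 1"
    using N_pos by (intro divide_left_mono) auto
  finally have "(32 * real N * \<mu> * B) * B \<le> e * e" using e_pos by (simp add: power2_eq_square)
  also have "\<dots> \<le> e * B" using eB e_pos by simp
  finally show 2: "32 * real N * \<mu> * B \<le> e" using B_pos by simp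
  then have "(32 * real N * \<mu>) * B \<le> 1 * B" using eB by simp
  then show "32 * real N * \<mu> \<le> 1" using B_pos by (simp only: mult_le_cancel_right_pos)
qed

text \<open>A lasso solution at a penalty near \<open>L\<close> could a priori have large support, so that sparsity cannot be
assumed. Split \<open>b\<close> into its parts \<open>b1\<close> on \<open>Big\<close> and \<open>b2\<close> off \<open>Big\<close>. Testing the optimality conditions
against \<open>b\<close> gives a cone condition, \<open>|b2|\<^sub>1\<close> being at most a multiple of \<open>|b1|\<^sub>1\<close>, because the scores off
\<open>Big\<close> fall short of the penalty by \<open>e / 2\<close>. On that cone the Gram matrix is still positive definite, which
bounds \<open>|b1|\<^sub>1\<close>. Testing against \<open>b2\<close> then shows that \<open>b2\<close> has to vanish: it interacts with \<open>b1\<close> only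
through the coherence, which cannot make up for \<open>e / 2\<close>.\<close>

lemma lasso_support:
  assumes min: "is_arg_min (lasso_objective X y lam) (\<lambda>b. b \<in> carrier_vec p) b"
    and lam: "0 < lam" "L - e / 2 \<le> lam"
    and outside: "\<And>i. i < p \<Longrightarrow> i \<notin> Big \<Longrightarrow> b $ i \<noteq> 0 \<Longrightarrow> \<bar>score i\<bar> \<le> L - e"
  shows "(\<Sum>i<p. \<bar>b $ i\<bar>) \<le> 2 * N * B" and "\<And>i. i < p \<Longrightarrow> i \<notin> Big \<Longrightarrow> b $ i = 0"
proof -
  have b: "b \<in> carrier_vec p" using min by (simp add: is_arg_min_def)
  define b1 where "b1 i = (if i \<in> Big then b $ i else 0)" for i
  define b2 where "b2 i = (if i \<in> Big then 0 else b $ i)" for i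
  define s1 where "s1 = (\<Sum>i<p. \<bar>b1 i\<bar>)"
  define s2 where "s2 = (\<Sum>i<p. \<bar>b2 i\<bar>)"
  have s0: "s1 \<ge> 0" "s2 \<ge> 0" by (auto simp: s1_def s2_def sum_nonneg)
  have split: "b $ i = b1 i + b2 i" "\<bar>b $ i\<bar> = \<bar>b1 i\<bar> + \<bar>b2 i\<bar>" "b1 i * b2 i = 0" for i
    by (auto simp: b1_def b2_def)
  have l1: "(\<Sum>i<p. \<bar>b $ i\<bar>) = s1 + s2"
    unfolding s1_def s2_def sum.distrib[symmetric] by (simp add: split(2))
  have res: "residual_correlation b i = score i - (\<Sum>j<p. G i j * b $ j)" if "i < p" for i
    using residual_correlation_eq[OF b that] .
  have b2_le: "b2 i * score i \<le> \<bar>b2 i\<bar> * (L - e)" if "i < p" for i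
  proof (cases "b2 i = 0")
    case False
    then have "\<bar>score i\<bar> \<le> L - e" using outside[OF that] by (auto simp: b2_def split: if_splits)
    then have "\<bar>b2 i\<bar> * \<bar>score i\<bar> \<le> \<bar>b2 i\<bar> * (L - e)" by (intro mult_left_mono) auto
    then show ?thesis by (metis abs_ge_self abs_mult order_trans)
  qed simp

  have q0: "0 \<le> quad (\<lambda>i. b $ i)" by (rule quad_nonneg)
  have mu: "0 \<le> \<mu>" if "p \<noteq> 0" using mu_nonneg[of 0] that by simp
  have p0: "s1 = 0 \<and> s2 = 0" if "p = 0" using that by (simp add: s1_def s2_def)

  have "lam * (s1 + s2) = (\<Sum>i<p. b $ i * residual_correlation b i)"
    unfolding l1[symmetric] sum_distrib_left
    by (rule sum.cong) (use lasso_kkt(2)[OF min lam(1)] in auto)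
  also have "\<dots> = (\<Sum>i<p. b $ i * score i) - quad (\<lambda>i. b $ i)"
    unfolding quad_def sum_subtractf[symmetric]
    by (rule sum.cong) (auto simp: res algebra_simps sum_distrib_left)
  also have "(\<Sum>i<p. b $ i * score i) \<le> (\<Sum>i<p. \<bar>b1 i\<bar> * B + \<bar>b2 i\<bar> * (L - e))"
  proof (rule sum_mono)
    fix i assume "i \<in> {..<p}"
    then have "i < p" by simp
    have "b1 i * score i \<le> \<bar>b1 i\<bar> * \<bar>score i\<bar>" by (metis abs_ge_self abs_mult)
    also have "\<dots> \<le> \<bar>b1 i\<bar> * B"
      using corr_bound[OF \<open>i < p\<close>] by (intro mult_left_mono) (auto simp: score_def)
    finally show "b $ i * score i \<le> \<bar>b1 i\<bar> * B + \<bar>b2 i\<bar> * (L - e)"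
      using b2_le[OF \<open>i < p\<close>] by (simp add: split(1) distrib_right)
  qed
  also have "\<dots> = s1 * B + s2 * (L - e)"
    by (simp add: s1_def s2_def sum.distrib sum_distrib_right)
  finally have id: "lam * (s1 + s2) + quad (\<lambda>i. b $ i) \<le> s1 * B + s2 * (L - e)" by simp
  have "s2 * (L - e) + s2 * (e / 2) \<le> s2 * lam"
    using mult_left_mono[OF lam(2) s0(2)] by (simp add: algebra_simps)
  moreover have "0 \<le> lam * s1" using lam s0 by simp
  \<comment> \<open>the cone condition, together with a bound on the fit\<close>
  ultimately have cone: "quad (\<lambda>i. b $ i) + s2 * (e / 2) \<le> s1 * B"
    using id by (simp add: algebra_simps)
  have s2_le: "s2 \<le> 2 * (B / e * s1)"
    using cone q0 e_pos by (simp add: field_simps)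
  have "1 * s1 \<le> B / e * s1"
    using eB e_pos s0 by (intro mult_right_mono) auto
  then have tot: "s1 + s2 \<le> 3 * (B / e * s1)"
    using s2_le by linarith
  \<comment> \<open>on the cone the quadratic form dominates half of the squared \<open>l\<^sub>2\<close>-norm of \<open>b1\<close>\<close>
  have s1_le: "s1 \<le> 2 * N * B"
  proof (cases "p = 0 \<or> s1 = 0")
    case True
    then show ?thesis using p0 B_pos by auto
  next
    case False
    then have mu0: "0 \<le> \<mu>" and s1p: "s1 > 0" using mu s0 by auto
    have "s1\<^sup>2 \<le> card Big * (\<Sum>i<p. (b1 i)\<^sup>2)"
      unfolding s1_def by (rule sum_abs_squared_le_card) (use Big_sub in \<open>auto simp: b1_def\<close>)
    also have "\<dots> \<le> N * (\<Sum>i<p. (b1 i)\<^sup>2)"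
      by (rule mult_right_mono) (auto simp: N_def sum_nonneg)
    also have "(\<Sum>i<p. (b1 i)\<^sup>2) \<le> (\<Sum>i<p. (b $ i)\<^sup>2)"
      by (rule sum_mono) (auto simp: b1_def)
    finally have a: "s1\<^sup>2 \<le> N * (\<Sum>i<p. (b $ i)\<^sup>2)" using N_pos by (simp add: mult_left_mono)
    have "\<mu> * (s1 + s2)\<^sup>2 \<le> \<mu> * (3 * (B / e * s1))\<^sup>2"
      using tot s0 mu0 by (intro mult_left_mono power_mono) auto
    also have "\<dots> = (9 * \<mu> * B\<^sup>2) / e\<^sup>2 * s1\<^sup>2"
      by (simp add: power_mult_distrib power_divide)
    also have "\<dots> \<le> (1 / (2 * N)) * s1\<^sup>2"
    proof (rule mult_right_mono)
      have "N * (9 * \<mu> * B\<^sup>2) \<le> e\<^sup>2 / N / 2"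
      proof -
        define Q R where "Q = N * \<mu> * B\<^sup>2" and "R = e\<^sup>2 / N"
        have "32 * Q \<le> R" using mu_small(3)[OF mu0] by (simp add: mult_ac Q_def R_def)
        moreover have "0 \<le> Q" using mu0 by (simp add: Q_def)
        ultimately have "9 * Q \<le> R / 2" by linarith
        then show ?thesis by (simp add: mult_ac Q_def R_def)
      qed
      also have "\<dots> \<le> e\<^sup>2 / 1 / 2"
        using N_pos by (intro divide_right_mono divide_left_mono) auto
      finally show "(9 * \<mu> * B\<^sup>2) / e\<^sup>2 \<le> 1 / (2 * N)"
        using N_pos e_pos by (simp add: field_simps)
    qed simp
    finally have "(\<Sum>i<p. (b $ i)\<^sup>2) - (1 / (2 * N)) * s1\<^sup>2 \<le> quad (\<lambda>i. b $ i)"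
      using quad_approx[of "\<lambda>i. b $ i"] unfolding l1 by linarith
    moreover have "s1\<^sup>2 / N \<le> (\<Sum>i<p. (b $ i)\<^sup>2)" using a N_pos by (simp add: field_simps)
    ultimately have "s1\<^sup>2 / (2 * N) \<le> quad (\<lambda>i. b $ i)" by (simp add: field_simps)
    also have "\<dots> \<le> s1 * B" using cone s0 e_pos
      by (smt (verit) mult_nonneg_nonneg divide_nonneg_pos)
    finally have "s1 * s1 \<le> s1 * (2 * N * B)" using N_pos by (simp add: field_simps power2_eq_square)
    then show ?thesis using s1p by simp
  qed
  \<comment> \<open>testing against \<open>b2\<close>: what \<open>b1\<close> contributes to the correlations off \<open>Big\<close> is below \<open>e / 16\<close>\<close>
  have s2_0: "s2 = 0"
  proof (cases "p = 0")
    case False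
    then have mu0: "0 \<le> \<mu>" using mu by auto
    have "lam * s2 = (\<Sum>i<p. b2 i * residual_correlation b i)"
      unfolding s2_def sum_distrib_left
    proof (rule sum.cong)
      fix i assume "i \<in> {..<p}"
      then show "lam * \<bar>b2 i\<bar> = b2 i * residual_correlation b i"
        using lasso_kkt(2)[OF min lam(1), of i] by (auto simp: b2_def)
    qed simp
    also have "\<dots> = (\<Sum>i<p. b2 i * score i - b2 i * (\<Sum>j<p. G i j * b2 j) - b2 i * (\<Sum>j<p. G i j * b1 j))"
      by (rule sum.cong) (auto simp: res split(1) algebra_simps sum.distrib)
    also have "\<dots> \<le> (\<Sum>i<p. \<bar>b2 i\<bar> * (L - e) - b2 i * (\<Sum>j<p. G i j * b2 j) + \<bar>b2 i\<bar> * (\<mu> * s1))"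
    proof (rule sum_mono)
      fix i assume "i \<in> {..<p}"
      then have i: "i < p" by simp
      have "- (b2 i * (\<Sum>j<p. G i j * b1 j)) = - b2 i * ((\<Sum>j<p. G i j * b1 j) - b1 i)"
      proof -
        have "b2 i * b1 i = 0" using split(3)[of i] by (simp add: mult.commute)
        then show ?thesis by (simp add: right_diff_distrib)
      qed
      also have "\<dots> \<le> \<bar>b2 i\<bar> * \<bar>(\<Sum>j<p. G i j * b1 j) - b1 i\<bar>"
        using abs_ge_self[of "- b2 i * ((\<Sum>j<p. G i j * b1 j) - b1 i)"]
        by (simp only: abs_mult abs_minus_cancel)
      also have "\<dots> \<le> \<bar>b2 i\<bar> * (\<mu> * s1)"
        using gram_row[OF i, of b1] by (intro mult_left_mono) (auto simp: s1_def)
      finally show "b2 i * score i - b2 i * (\<Sum>j<p. G i j * b2 j) - b2 i * (\<Sum>j<p. G i j * b1 j)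
          \<le> \<bar>b2 i\<bar> * (L - e) - b2 i * (\<Sum>j<p. G i j * b2 j) + \<bar>b2 i\<bar> * (\<mu> * s1)"
        using b2_le[OF i] by linarith
    qed
    also have "\<dots> = s2 * (L - e) - quad b2 + s2 * (\<mu> * s1)"
      by (simp add: s2_def quad_def sum.distrib sum_subtractf sum_distrib_right sum_distrib_left mult_ac)
    finally have "s2 * (lam - (L - e) - \<mu> * s1) \<le> 0"
      using quad_nonneg[of b2] by (simp add: algebra_simps)
    moreover have "\<mu> * s1 \<le> \<mu> * (2 * N * B)" using s1_le mu0 by (rule mult_left_mono)
    then have "\<mu> * s1 \<le> e / 16" using mu_small(1)[OF mu0] by (simp add: mult_ac)
    then have "0 < lam - (L - e) - \<mu> * s1" using lam(2) e_pos by simp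
    ultimately show ?thesis using s0(2) by (auto simp: mult_le_0_iff)
  qed (use p0 in auto)
  show "(\<Sum>i<p. \<bar>b $ i\<bar>) \<le> 2 * N * B" using l1 s1_le s2_0 by simp
  have b20: "b2 i = 0" if "i < p" for i
    using s2_0 that by (simp add: s2_def sum_nonneg_eq_0_iff)
  show "b $ i = 0" if "i < p" "i \<notin> Big" for i
    using b20[OF that(1)] that(2) by (simp add: b2_def)
qed

end

text \<open>\<open>j0\<close> is the noise variable with the score to beat.\<close>

locale noise_screening = screening +
  fixes \<beta> :: "real vec" and j0 :: nat
  assumes \<beta>_dim: "\<beta> \<in> carrier_vec p"
    and j0: "j0 < p" "\<beta> $ j0 = 0" "\<bar>score j0\<bar> = L"
    and Big_def: "Big = {i. i < p \<and> \<beta> $ i \<noteq> 0 \<and> L - e \<le> \<bar>score i\<bar>}"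
begin

lemma mu0: "0 \<le> \<mu>" using mu_nonneg j0 by blast

text \<open>At the penalty \<open>L - e / 2\<close> some noise coefficient is nonzero: otherwise all active variables would be in
\<open>Big\<close>, and the residual correlation of \<open>j0\<close>, nearly \<open>L\<close>, would violate the optimality conditions. All
variables that precede the noise are therefore active at some larger penalty, hence lie in \<open>Big\<close>.\<close>

lemma lasso_rank:
  assumes path: "lasso_path X y b"
  shows "path_rank \<beta> b \<le> 1 + card Big"
proof -
  define lam1 where "lam1 = L - e / 2"
  have lam1: "lam1 > 0" using e_pos e_le by (simp add: lam1_def)
  have min: "is_arg_min (lasso_objective X y lam) (\<lambda>b. b \<in> carrier_vec p) (b lam)" if "lam > 0" for lam
    using path that unfolding lasso_path_def by auto
  have supp: "(\<Sum>i<p. \<bar>b lam $ i\<bar>) \<le> 2 * N * B" "\<And>i. i < p \<Longrightarrow> i \<notin> Big \<Longrightarrow> b lam $ i = 0"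
    if "lam > 0" "lam1 \<le> lam" and z: "\<And>j. j < p \<Longrightarrow> \<beta> $ j = 0 \<Longrightarrow> b lam $ j = 0" for lam
    using lasso_support[OF min[OF that(1)] that(1)] that(2) z unfolding Big_def lam1_def by force+
  have noise: "\<not> (\<forall>j<p. \<beta> $ j = 0 \<longrightarrow> b lam1 $ j = 0)"
  proof
    assume *: "\<forall>j<p. \<beta> $ j = 0 \<longrightarrow> b lam1 $ j = 0"
    have carr: "b lam1 \<in> carrier_vec p" using min[OF lam1] by (simp add: is_arg_min_def)
    have "\<bar>residual_correlation (b lam1) j0 - score j0\<bar> \<le> \<mu> * (\<Sum>j<p. \<bar>b lam1 $ j\<bar>)"
      by (rule residual_correlation_off_support) (use carr * j0 in auto)
    also have "\<dots> \<le> \<mu> * (2 * N * B)" using supp(1)[OF lam1] * mu0 by (intro mult_left_mono) auto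
    also have "\<dots> \<le> e / 16" using mu_small(1)[OF mu0] by (simp add: mult_ac)
    finally have "L - e / 16 \<le> \<bar>residual_correlation (b lam1) j0\<bar>" using j0 by linarith
    then show False using lasso_kkt(1)[OF min[OF lam1] lam1 j0(1)] e_pos by (simp add: lam1_def)
  qed
  have "{i. i < dim_vec \<beta> \<and> \<beta> $ i \<noteq> 0 \<and>
     (\<exists>lam>0. b lam $ i \<noteq> 0 \<and> (\<forall>\<mu>\<ge>lam. \<forall>j<dim_vec \<beta>. \<beta> $ j = 0 \<longrightarrow> b \<mu> $ j = 0))} \<subseteq> Big"
  proof safe
    fix i lam assume i: "i < dim_vec \<beta>" "b lam $ i \<noteq> 0" and lam: "0 < lam"
      and z: "\<forall>\<mu>\<ge>lam. \<forall>j<dim_vec \<beta>. \<beta> $ j = 0 \<longrightarrow> b \<mu> $ j = 0"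
    have d: "dim_vec \<beta> = p" using \<beta>_dim by auto
    have "\<not> lam \<le> lam1" using noise z d by auto
    then show "i \<in> Big" using supp(2)[OF lam, of i] i z d by fastforce
  qed
  moreover have "finite Big" using Big_sub finite_subset by blast
  ultimately show ?thesis unfolding path_rank_def by (simp add: card_mono)
qed

text \<open>The common property of forward stepwise and least angle regression: up to \<open>e\<close>, each of the first \<open>N\<close>
selected variables has the largest score among the variables still available. Only the first \<open>N\<close> matter,
as \<open>Big\<close> has \<open>N - 1\<close> elements.\<close>

definition nearly_greedy where
  "nearly_greedy js \<longleftrightarrow> distinct js \<and> set js \<subseteq> {..<p} \<and>
     (\<forall>m<length js. m < N \<longrightarrow> (\<forall>j<p. j \<notin> set (take m js) \<longrightarrow> \<bar>score j\<bar> - e \<le> \<bar>score (js ! m)\<bar>))"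

text \<open>While no noise variable is selected, \<open>j0\<close> is available, so that every selected variable is in \<open>Big\<close>; with
\<open>N\<close> leading signal variables \<open>Big\<close> would have \<open>N\<close> elements.\<close>

lemma nearly_greedy_rank:
  assumes greedy: "nearly_greedy js"
  shows "list_rank \<beta> js \<le> 1 + card Big"
proof (rule ccontr)
  assume neg: "\<not> ?thesis"
  define t where "t = takeWhile (\<lambda>j. \<beta> $ j \<noteq> 0) js"
  have len: "N \<le> length t"
    using neg by (simp add: list_rank_def N_def t_def)
  obtain u where u: "js = t @ u" unfolding t_def by (metis takeWhile_dropWhile_id)
  have signal: "\<beta> $ j \<noteq> 0" if "j \<in> set t" for j
    using that unfolding t_def by (rule set_takeWhileD[THEN conjunct2])
  have "set (take N t) \<subseteq> Big"
  proof
    fix j assume "j \<in> set (take N t)"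
    then obtain m where m: "m < N" "j = t ! m" "m < length t"
      by (auto simp: in_set_conv_nth)
    then have j: "j = js ! m" "m < length js" "j \<in> set t" by (auto simp: u nth_append)
    have "set (take m js) \<subseteq> set t" using m by (auto simp: u dest: in_set_takeD)
    then have "j0 \<notin> set (take m js)" using signal j0 by auto
    then have "\<bar>score j0\<bar> - e \<le> \<bar>score j\<bar>"
      using greedy m(1) j j0(1) unfolding nearly_greedy_def by blast
    moreover have "j < p" using greedy j unfolding nearly_greedy_def by (auto simp: u)
    ultimately show "j \<in> Big" using signal[OF j(3)] j0 unfolding Big_def by auto
  qed
  moreover have "finite Big" using Big_sub finite_subset by blast
  ultimately have "card (set (take N t)) \<le> card Big" by (rule card_mono[rotated])
  moreover have "distinct (take N t)" using greedy unfolding nearly_greedy_def by (simp add: u)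
  ultimately show False using len by (simp add: distinct_card N_def)
qed

lemma forward_stepwise_greedy:
  assumes fs: "forward_stepwise_order X y js"
  shows "nearly_greedy js"
  unfolding nearly_greedy_def
proof (intro conjI allI impI)
  show d: "distinct js" and "set js \<subseteq> {..<p}" using fs unfolding forward_stepwise_order_def by auto
  fix m j assume m: "m < length js" "m < N" and j: "j < p" "j \<notin> set (take m js)"
  let ?A = "set (take m js)"
  have card: "card ?A = m" using d m by (simp add: distinct_card)
  have sub: "?A \<subseteq> {..<p}" using fs unfolding forward_stepwise_order_def by (auto dest: in_set_takeD)
  have i: "js ! m < p" using fs m unfolding forward_stepwise_order_def by (metis lessThan_iff nth_mem)
  have ni: "js ! m \<notin> ?A" using d m by (metis id_take_nth_drop not_distinct_conv_prefix distinct_append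
        distinct.simps(2) append_Cons append_assoc disjoint_iff list.set_intros(1))
  have mN: "real (Suc m) \<le> N" using m by simp
  have "\<mu> * Suc m \<le> \<mu> * N" using mN mu0 by (rule mult_left_mono)
  moreover have "32 * (\<mu> * N) \<le> 1" using mu_small(2)[OF mu0] by (simp add: mult_ac)
  moreover have "0 \<le> \<mu> * N" using mu0 by simp
  ultimately have "\<mu> * Suc (card ?A) < 1" unfolding card by linarith
  then have "(score j)\<^sup>2 - 2 * \<mu> * (Suc m)\<^sup>2 * B\<^sup>2 \<le> (score (js ! m))\<^sup>2"
    using stepwise_comparison[OF sub i j(1) ni j(2)] fs m j
    unfolding forward_stepwise_order_def card by simp
  moreover have "2 * \<mu> * (Suc m)\<^sup>2 * B\<^sup>2 \<le> 2 * \<mu> * (real N)\<^sup>2 * B\<^sup>2"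
  proof (intro mult_right_mono mult_left_mono)
    show "real ((Suc m)\<^sup>2) \<le> (real N)\<^sup>2" using power_mono[OF mN, of 2] by simp
  qed (use mu0 in auto)
  moreover have "2 * \<mu> * (real N)\<^sup>2 * B\<^sup>2 \<le> e\<^sup>2"
  proof -
    have "0 \<le> (real N)\<^sup>2 * \<mu> * B\<^sup>2" using mu0 by simp
    then have "2 * ((real N)\<^sup>2 * \<mu> * B\<^sup>2) \<le> e\<^sup>2" using small by linarith
    then show ?thesis by (simp only: mult_ac)
  qed
  ultimately have le: "\<bar>score j\<bar>\<^sup>2 \<le> \<bar>score (js ! m)\<bar>\<^sup>2 + e\<^sup>2" by simp
  also have "\<dots> \<le> (\<bar>score (js ! m)\<bar> + e)\<^sup>2" using e_pos by (simp add: power2_sum)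
  finally have "\<bar>score j\<bar> \<le> \<bar>score (js ! m)\<bar> + e"
    using e_pos by (simp add: power2_le_iff_abs_le)
  then show "\<bar>score j\<bar> - e \<le> \<bar>score (js ! m)\<bar>" by simp
qed

text \<open>The variable included last attains the largest absolute residual correlation over \<^emph>\<open>all\<close> variables,
and this maximum stays below \<open>B\<close>, which is what controls the coefficients.\<close>

definition lars_invariant where
  "lars_invariant s \<longleftrightarrow> (case s of (js, b) \<Rightarrow> nearly_greedy js \<and> js \<noteq> [] \<and> b \<in> carrier_vec p \<and>
     (\<forall>i<p. i \<notin> set js \<longrightarrow> b $ i = 0) \<and>
     (\<forall>i<p. \<bar>residual_correlation b i\<bar> \<le> \<bar>residual_correlation b (last js)\<bar>) \<and>
     \<bar>residual_correlation b (last js)\<bar> \<le> B)"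

lemma lars_invariant_start:
  assumes "lars_start X y s"
  shows "lars_invariant s"
proof -
  obtain j where j: "j < p" "\<And>i. i < p \<Longrightarrow> \<bar>score i\<bar> \<le> \<bar>score j\<bar>" "s = ([j], 0\<^sub>v p)"
    using assms unfolding lars_start_def score_def by auto
  have "residual_correlation (0\<^sub>v p) i = score i" if "i < p" for i
    using that by (subst residual_correlation_eq) auto
  then show ?thesis
    using j e_pos corr_bound[OF j(1)]
    by (auto simp: lars_invariant_def nearly_greedy_def score_def[symmetric]) (smt (verit))
qed

text \<open>Along a step the residual correlations of the included variables shrink by the common factor \<open>1 - \<gamma>\<close>, by
the normal equations, while those of the others move linearly and stay below until the step ends. The
coefficients stay of size \<open>O(B)\<close>, as the fitted values have correlations at most \<open>2 B\<close> with every variable and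
the Gram matrix is nearly the identity. A variable that is not yet included has coefficient zero, so that
its residual correlation is its score up to \<open>e / 2\<close>.\<close>

lemma lars_invariant_step:
  assumes step: "lars_step X y s s'" and inv: "lars_invariant s"
  shows "lars_invariant s'"
  using step
proof cases
  case (1 b js d \<gamma> j)
  let ?b = "b + \<gamma> \<cdot>\<^sub>v d" and ?A = "set js" and ?rc = residual_correlation
  have s: "nearly_greedy js" "js \<noteq> []" "b \<in> carrier_vec p" "\<And>i. i < p \<Longrightarrow> i \<notin> ?A \<Longrightarrow> b $ i = 0"
    "\<And>i. i < p \<Longrightarrow> \<bar>?rc b i\<bar> \<le> \<bar>?rc b (last js)\<bar>" "\<bar>?rc b (last js)\<bar> \<le> B"
    using inv unfolding lars_invariant_def 1 by auto
  have d: "d \<in> carrier_vec p" "\<And>i. i < p \<Longrightarrow> i \<notin> ?A \<Longrightarrow> d $ i = 0"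
    using 1(3) unfolding least_squares_coeffs_def is_arg_min_def coeffs_on_def by auto
  have A: "?A \<subseteq> {..<p}" using s(1) unfolding nearly_greedy_def by auto
  have j: "j < p" "j \<notin> ?A" using 1(5) unfolding lars_catches_up_def by auto
  define W where "W = \<bar>?rc b (last js)\<bar>"
  define v where "v i = (\<Sum>k<p. G i k * d $ k)" for i
  have lin: "?rc (b + g \<cdot>\<^sub>v d) i = ?rc b i - g * v i" if "i < p" for g i
    using that s(3) d(1)
    by (simp add: residual_correlation_eq v_def sum.distrib sum_distrib_left algebra_simps)
  have v_A: "v i = ?rc b i" if "i \<in> ?A" for i
  proof -
    have i: "i < p" using that A by auto
    have w: "y - X *\<^sub>v b \<in> carrier_vec (dim_row X)" using y_dim by auto
    have "col X i \<bullet> (y - X *\<^sub>v b) - col X i \<bullet> (X *\<^sub>v d) = 0"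
      using normal_equation[OF 1(3) w that i] w
      by (subst (asm) scalar_prod_minus_distrib[of _ "dim_row X"]) auto
    then show ?thesis
      using col_mult_mat_vec[OF i d(1)] by (simp add: v_def residual_correlation_def)
  qed
  have shrink: "?rc (b + g \<cdot>\<^sub>v d) i = (1 - g) * ?rc b i" if "i \<in> ?A" for g i
    using lin[of i g] v_A[OF that] that A by (auto simp: algebra_simps)
  have last: "last js \<in> ?A" using s(2) by simp
  have catch: "lars_catches_up X (y - X *\<^sub>v (b + g \<cdot>\<^sub>v d)) ?A i \<longleftrightarrow>
      i < p \<and> i \<notin> ?A \<and> (\<forall>k\<in>?A. \<bar>?rc (b + g \<cdot>\<^sub>v d) k\<bar> \<le> \<bar>?rc (b + g \<cdot>\<^sub>v d) i\<bar>)" for g i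
    unfolding lars_catches_up_def residual_correlation_def ..
  have \<gamma>1: "\<gamma> \<le> 1"
  proof (rule ccontr)
    assume "\<not> \<gamma> \<le> 1"
    then have "\<not> lars_catches_up X (y - X *\<^sub>v (b + 1 \<cdot>\<^sub>v d)) ?A j" using 1(6)[of 1 j] by simp
    then show False using j shrink[of _ 1] unfolding catch by simp
  qed
  have below: "\<bar>?rc ?b i\<bar> \<le> (1 - \<gamma>) * W" if i: "i < p" "i \<notin> ?A" for i
  proof (rule real_le_of_all_small)
    \<comment> \<open>approach the end \<open>\<gamma>\<close> of the step from the left, where no variable has caught up; for \<open>\<gamma> = 0\<close> use the invariant\<close>
    fix t :: real assume t: "0 < t" "t \<le> 1"
    define g where "g = \<gamma> * (1 - t)"
    have g: "0 \<le> g" "g \<le> 1" "g \<le> \<gamma>"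
    proof -
      show "0 \<le> g" using t 1(4) by (simp add: g_def)
      show "g \<le> \<gamma>" using t 1(4) by (simp add: g_def mult_left_le)
      then show "g \<le> 1" using \<gamma>1 by simp
    qed
    have at_g: "\<bar>?rc (b + g \<cdot>\<^sub>v d) i\<bar> \<le> (1 - g) * W"
    proof (cases "\<gamma> = 0")
      case True
      then show ?thesis using s(5)[OF i(1)] lin[OF i(1), of 0] by (simp add: g_def W_def lin[OF i(1)])
    next
      case False
      then have "g < \<gamma>" using t 1(4) by (simp add: g_def)
      then have "\<not> lars_catches_up X (y - X *\<^sub>v (b + g \<cdot>\<^sub>v d)) ?A i" using 1(6) g by blast
      then obtain k where k: "k \<in> ?A" "\<bar>?rc (b + g \<cdot>\<^sub>v d) i\<bar> < \<bar>?rc (b + g \<cdot>\<^sub>v d) k\<bar>"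
        using i unfolding catch by (auto simp: not_le)
      note k(2)
      also have "\<bar>?rc (b + g \<cdot>\<^sub>v d) k\<bar> = (1 - g) * \<bar>?rc b k\<bar>"
        using shrink[OF k(1)] g by (simp add: abs_mult)
      also have "\<dots> \<le> (1 - g) * W"
        unfolding W_def using s(5)[of k] k(1) A g by (intro mult_left_mono) auto
      finally show ?thesis by simp
    qed
    have "\<gamma> - g = t * \<gamma>" by (simp add: g_def algebra_simps)
    have "?rc ?b i = ?rc (b + g \<cdot>\<^sub>v d) i - t * \<gamma> * v i"
      unfolding lin[OF i(1)] by (simp add: g_def algebra_simps)
    then have "\<bar>?rc ?b i\<bar> \<le> (1 - g) * W + \<bar>t * \<gamma> * v i\<bar>" using at_g by linarith
    also have "\<bar>t * \<gamma> * v i\<bar> = t * (\<gamma> * \<bar>v i\<bar>)" using t 1(4) by (simp add: abs_mult)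
    also have "(1 - g) * W = (1 - \<gamma>) * W + t * (\<gamma> * W)" by (simp add: g_def algebra_simps)
    finally show "\<bar>?rc ?b i\<bar> \<le> (1 - \<gamma>) * W + t * (\<gamma> * (W + \<bar>v i\<bar>))"
      by (simp add: algebra_simps)
  qed
  have b': "?b \<in> carrier_vec p" "\<And>i. i < p \<Longrightarrow> i \<notin> ?A \<Longrightarrow> ?b $ i = 0"
    using s(3,4) d by auto
  have jmax: "\<bar>?rc ?b i\<bar> \<le> \<bar>?rc ?b j\<bar>" if i: "i < p" for i
  proof (cases "i \<in> ?A")
    case True
    then show ?thesis using 1(5) unfolding catch by blast
  next
    case False
    have "\<bar>?rc ?b i\<bar> \<le> (1 - \<gamma>) * W" using below i False .
    also have "\<dots> = \<bar>?rc ?b (last js)\<bar>" using shrink[OF last] \<gamma>1 by (simp add: W_def abs_mult)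
    also have "\<dots> \<le> \<bar>?rc ?b j\<bar>" using 1(5) last unfolding catch by blast
    finally show ?thesis .
  qed
  have jB: "\<bar>?rc ?b j\<bar> \<le> B"
  proof -
    have "\<bar>?rc ?b j\<bar> \<le> (1 - \<gamma>) * W" using below j .
    also have "\<dots> \<le> 1 * W" using 1(4) \<gamma>1 by (intro mult_right_mono) (auto simp: W_def)
    finally show ?thesis using s(6) by (simp add: W_def)
  qed
  have l1: "\<mu> * (\<Sum>i<p. \<bar>?b $ i\<bar>) \<le> e / 2" if lenN: "length js < N"
  proof -
    \<comment> \<open>\<open>S\<close> satisfies a self-bounding inequality, solved because \<open>N \<mu>\<close> is small\<close>
    define S where "S = (\<Sum>i<p. \<bar>?b $ i\<bar>)"
    have S0: "0 \<le> S" by (simp add: S_def sum_nonneg)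
    have "S = (\<Sum>i\<in>?A. \<bar>?b $ i\<bar>)"
      unfolding S_def using A b' by (intro sum.mono_neutral_right) auto
    also have "\<dots> \<le> (\<Sum>i\<in>?A. 2 * B + \<mu> * S)"
    proof (rule sum_mono)
      fix i assume "i \<in> ?A"
      then have i: "i < p" using A by auto
      have "\<bar>?b $ i\<bar> \<le> \<bar>(\<Sum>k<p. G i k * ?b $ k)\<bar> + \<mu> * S"
        using gram_row[OF i, of "\<lambda>k. ?b $ k"] unfolding S_def by linarith
      also have "(\<Sum>k<p. G i k * ?b $ k) = score i - ?rc ?b i"
        using residual_correlation_eq[OF b'(1) i] by simp
      also have "\<bar>score i - ?rc ?b i\<bar> \<le> 2 * B"
        using corr_bound[OF i] jmax[OF i] jB by (simp add: score_def)
      finally show "\<bar>?b $ i\<bar> \<le> 2 * B + \<mu> * S" by simp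
    qed
    also have "\<dots> = length js * (2 * B + \<mu> * S)"
      using s(1) by (simp add: nearly_greedy_def distinct_card)
    also have "\<dots> \<le> N * (2 * B + \<mu> * S)"
      using lenN mu0 S0 B_pos by (intro mult_right_mono) auto
    finally have 2: "S \<le> 2 * N * B + (N * \<mu>) * S" by (simp add: algebra_simps)
    have "(N * \<mu>) * S \<le> (1 / 32) * S" using mu_small(2)[OF mu0] S0 by (intro mult_right_mono) auto
    then have "S \<le> 4 * N * B" using 2 S0 B_pos by linarith
    then have "\<mu> * S \<le> \<mu> * (4 * N * B)" using mu0 by (rule mult_left_mono)
    also have "\<dots> \<le> e / 2" using mu_small(1)[OF mu0] e_pos by (simp add: mult_ac)
    finally show ?thesis unfolding S_def .
  qed
  have new: "\<bar>score i\<bar> - e \<le> \<bar>score j\<bar>" if "length js < N" "i < p" "i \<notin> ?A" for i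
    using residual_correlation_off_support[OF b'(1) that(2) b'(2)[OF that(2,3)]]
      residual_correlation_off_support[OF b'(1) j(1) b'(2)[OF j]] jmax[OF that(2)] l1[OF that(1)]
    by linarith
  have "nearly_greedy (js @ [j])"
    using s(1) j new unfolding nearly_greedy_def by (auto simp: nth_append less_Suc_eq)
  then show ?thesis
    unfolding lars_invariant_def 1(2) using b' jmax jB by auto
qed

lemma lars_greedy:
  assumes "lars_order X y js"
  shows "nearly_greedy js"
proof -
  obtain s b where s: "lars_start X y s" "(lars_step X y)\<^sup>*\<^sup>* s (js, b)"
    using assms unfolding lars_order_def by blast
  from s(2) have "lars_invariant (js, b)"
    by (induction rule: rtranclp_induct) (auto intro: lars_invariant_start[OF s(1)] lars_invariant_step)
  then show ?thesis by (simp add: lars_invariant_def)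
qed

lemma first_noise_rank_le:
  assumes "first_noise_rank proc X y \<beta> T"
  shows "T \<le> 1 + card Big"
  using assms lasso_rank nearly_greedy_rank forward_stepwise_greedy lars_greedy
  by (cases proc) auto

end

section \<open>Normal tails, concentration and freezing\<close>

lemma nn_integral_normal_density: "0 < \<sigma> \<Longrightarrow> (\<integral>\<^sup>+x. ennreal (normal_density m \<sigma> x) \<partial>lborel) = 1"
  by (subst nn_integral_eq_integral) auto

lemma scaled_density_le_1:
  assumes x: "0 \<le> x" "0 \<le> h"
  shows "h * std_normal_density (x + h) \<le> 1"
proof -
  have "h\<^sup>2 \<le> (x + h)\<^sup>2" using x by (intro power_mono) auto
  moreover have "0 \<le> (h - 1)\<^sup>2" by simp
  then have "h \<le> 1 + h\<^sup>2 / 2" by (simp add: power2_diff)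
  ultimately have "h \<le> 1 + (x + h)\<^sup>2 / 2" by simp
  also have "\<dots> \<le> exp ((x + h)\<^sup>2 / 2)" by (rule exp_ge_add_one_self)
  finally have "h * exp (- (x + h)\<^sup>2 / 2) \<le> 1" by (simp add: exp_minus field_simps)
  moreover have "1 \<le> sqrt (2 * pi)" using pi_ge_two by simp
  ultimately have "h * exp (- (x + h)\<^sup>2 / 2) \<le> 1 * sqrt (2 * pi)" by linarith
  then show ?thesis by (simp add: std_normal_density_def field_simps)
qed

context prob_space begin

lemma prob_distributed:
  assumes D: "distributed M lborel Z f" and A: "A \<in> sets borel"
  shows "ennreal (prob {\<omega> \<in> space M. Z \<omega> \<in> A}) = (\<integral>\<^sup>+x. f x * indicator A x \<partial>lborel)"
proof -
  have "{\<omega> \<in> space M. Z \<omega> \<in> A} = Z -` A \<inter> space M" by auto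
  then show ?thesis
    using distributed_emeasure[OF D, of A] A by (simp add: emeasure_eq_measure)
qed

text \<open>On the event, the density is at most \<open>exp (- s\<^sup>2 / 2)\<close> times the density shifted to \<open>s\<close> or to \<open>-s\<close>,
according to the sign of \<open>x\<close>.\<close>

lemma std_normal_tail_le:
  assumes D: "distributed M lborel Z std_normal_density" and s: "0 \<le> s"
  shows "prob {\<omega> \<in> space M. s \<le> \<bar>Z \<omega>\<bar>} \<le> 2 * exp (- s\<^sup>2 / 2)"
proof -
  have "ennreal (prob {\<omega> \<in> space M. Z \<omega> \<in> {x. s \<le> \<bar>x\<bar>}}) =
      (\<integral>\<^sup>+x. ennreal (std_normal_density x) * indicator {x. s \<le> \<bar>x\<bar>} x \<partial>lborel)"
    by (rule prob_distributed[OF D]) measurable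
  also have "\<dots> \<le> (\<integral>\<^sup>+x. ennreal (exp (- s\<^sup>2 / 2)) *
      (ennreal (normal_density s 1 x) + ennreal (normal_density (-s) 1 x)) \<partial>lborel)"
  proof (rule nn_integral_mono)
    fix x :: real
    have shift: "std_normal_density x \<le> exp (- s\<^sup>2 / 2) * normal_density r 1 x"
      if "r\<^sup>2 = s\<^sup>2" "s\<^sup>2 \<le> r * x" for r
    proof -
      have "- x\<^sup>2 / 2 \<le> - s\<^sup>2 / 2 + - (x - r)\<^sup>2 / 2"
        using that by (simp add: power2_diff field_simps)
      then have "exp (- x\<^sup>2 / 2) \<le> exp (- s\<^sup>2 / 2) * exp (- (x - r)\<^sup>2 / 2)"
        by (simp only: exp_add[symmetric] exp_le_cancel_iff)
      then have "exp (- x\<^sup>2 / 2) / sqrt (2 * pi) \<le> exp (- s\<^sup>2 / 2) * exp (- (x - r)\<^sup>2 / 2) / sqrt (2 * pi)"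
        by (rule divide_right_mono) simp
      then show ?thesis by (simp add: normal_density_def)
    qed
    have "std_normal_density x \<le> exp (- s\<^sup>2 / 2) * (normal_density s 1 x + normal_density (-s) 1 x)"
      if "s \<le> \<bar>x\<bar>"
    proof (cases "0 \<le> x")
      case True
      then have "s\<^sup>2 \<le> s * x" using that s by (simp add: power2_eq_square mult_left_mono)
      then have "std_normal_density x \<le> exp (- s\<^sup>2 / 2) * normal_density s 1 x" by (intro shift) auto
      also have "\<dots> \<le> exp (- s\<^sup>2 / 2) * (normal_density s 1 x + normal_density (-s) 1 x)"
        by (intro mult_left_mono) auto
      finally show ?thesis .
    next
      case False
      then have "s * s \<le> s * (- x)" using that s by (intro mult_left_mono) auto
      then have "std_normal_density x \<le> exp (- s\<^sup>2 / 2) * normal_density (-s) 1 x"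
        by (intro shift) (auto simp: power2_eq_square)
      also have "\<dots> \<le> exp (- s\<^sup>2 / 2) * (normal_density s 1 x + normal_density (-s) 1 x)"
        by (intro mult_left_mono) auto
      finally show ?thesis .
    qed
    then show "ennreal (std_normal_density x) * indicator {x. s \<le> \<bar>x\<bar>} x \<le> ennreal (exp (- s\<^sup>2 / 2)) *
      (ennreal (normal_density s 1 x) + ennreal (normal_density (-s) 1 x))"
      by (auto simp: indicator_def ennreal_plus[symmetric] ennreal_mult[symmetric] simp del: ennreal_plus)
  qed
  also have "\<dots> = ennreal (exp (- s\<^sup>2 / 2)) * 2"
    by (simp add: nn_integral_cmult nn_integral_add nn_integral_normal_density one_add_one)
  also have "\<dots> = ennreal (2 * exp (- s\<^sup>2 / 2))"
    by (simp add: ennreal_mult mult.commute)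
  finally show ?thesis by (subst (asm) ennreal_le_iff) auto
qed

text \<open>The right tail beyond \<open>x\<close> contains the interval of length \<open>h\<close> above \<open>x\<close>, on which the density is at
least its value at \<open>x + h\<close>. The loss is harmless: \<open>h\<close> is the slack of the whole argument.\<close>

lemma std_normal_le_prob:
  assumes D: "distributed M lborel Z std_normal_density" and s: "0 \<le> x" "0 \<le> h"
  shows "prob {\<omega> \<in> space M. Z \<omega> \<le> x} \<le> 1 - h * std_normal_density (x + h)"
proof -
  have [measurable]: "Z \<in> borel_measurable M" using D by (simp add: distributed_def)
  have "ennreal (h * std_normal_density (x + h)) = (\<integral>\<^sup>+t. ennreal (std_normal_density (x + h)) * indicator {x<..x+h} t \<partial>lborel)"
    using s by (simp add: nn_integral_cmult_indicator ennreal_mult mult.commute)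
  also have "\<dots> \<le> (\<integral>\<^sup>+t. ennreal (std_normal_density t) * indicator {x<..} t \<partial>lborel)"
  proof (rule nn_integral_mono)
    fix t :: real
    have "std_normal_density (x + h) \<le> std_normal_density t" if "x < t" "t \<le> x + h"
      using that s by (simp add: normal_density_def divide_right_mono power_mono)
    then show "ennreal (std_normal_density (x + h)) * indicator {x<..x+h} t \<le>
        ennreal (std_normal_density t) * indicator {x<..} t"
      by (auto simp: indicator_def intro: ennreal_leI)
  qed
  also have "\<dots> = ennreal (prob {\<omega> \<in> space M. Z \<omega> \<in> {x<..}})"
    by (rule prob_distributed[OF D, symmetric]) simp
  finally have "h * std_normal_density (x + h) \<le> prob {\<omega> \<in> space M. Z \<omega> \<in> {x<..}}"
    by (subst (asm) ennreal_le_iff) auto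
  moreover have "prob {\<omega> \<in> space M. Z \<omega> \<le> x} = 1 - prob {\<omega> \<in> space M. Z \<omega> \<in> {x<..}}"
  proof -
    have "{\<omega> \<in> space M. Z \<omega> \<le> x} = space M - {\<omega> \<in> space M. Z \<omega> \<in> {x<..}}" by auto
    then show ?thesis by (simp add: prob_compl)
  qed
  ultimately show ?thesis by simp
qed

lemma nn_integral_exp_square_std_normal:
  assumes D: "distributed M lborel Z std_normal_density" and lam: "lam < 1 / 2"
  shows "(\<integral>\<^sup>+\<omega>. ennreal (exp (lam * (Z \<omega>)\<^sup>2)) \<partial>M) = ennreal (1 / sqrt (1 - 2 * lam))"
proof -
  define \<sigma> where "\<sigma> = 1 / sqrt (1 - 2 * lam)"
  have \<sigma>: "0 < \<sigma>" "\<sigma>\<^sup>2 = 1 / (1 - 2 * lam)" using lam by (auto simp: \<sigma>_def power_divide)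
  have "(\<integral>\<^sup>+\<omega>. ennreal (exp (lam * (Z \<omega>)\<^sup>2)) \<partial>M) =
      (\<integral>\<^sup>+x. ennreal (std_normal_density x) * ennreal (exp (lam * x\<^sup>2)) \<partial>lborel)"
    by (rule distributed_nn_integral[OF D, symmetric]) measurable
  also have "\<dots> = (\<integral>\<^sup>+x. ennreal \<sigma> * ennreal (normal_density 0 \<sigma> x) \<partial>lborel)"
  proof (rule nn_integral_cong)
    fix x :: real
    have "sqrt (2 * pi * \<sigma>\<^sup>2) = sqrt (2 * pi) * \<sigma>" using \<sigma>(1) by (simp add: real_sqrt_mult)
    moreover have "- x\<^sup>2 / (2 * \<sigma>\<^sup>2) = lam * x\<^sup>2 + - x\<^sup>2 / 2" using lam by (simp add: \<sigma>(2) field_simps)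
    then have "exp (- x\<^sup>2 / (2 * \<sigma>\<^sup>2)) = exp (lam * x\<^sup>2) * exp (- x\<^sup>2 / 2)"
      by (simp only: exp_add)
    ultimately have "std_normal_density x * exp (lam * x\<^sup>2) = \<sigma> * normal_density 0 \<sigma> x"
      using \<sigma>(1) unfolding normal_density_def by simp
    then show "ennreal (std_normal_density x) * ennreal (exp (lam * x\<^sup>2)) = ennreal \<sigma> * ennreal (normal_density 0 \<sigma> x)"
      using \<sigma>(1) by (simp add: ennreal_mult[symmetric])
  qed
  also have "\<dots> = ennreal \<sigma>"
    using \<sigma>(1) by (simp add: nn_integral_cmult nn_integral_normal_density)
  finally show ?thesis by (simp add: \<sigma>_def)
qed

lemma chi_square_chernoff:
  fixes Z :: "'i \<Rightarrow> 'a \<Rightarrow> real"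
  assumes I: "finite I" and ind: "indep_vars (\<lambda>_. borel) Z I"
    and D: "\<And>i. i \<in> I \<Longrightarrow> distributed M lborel (Z i) std_normal_density" and lam: "lam < 1 / 2"
  shows "prob {\<omega> \<in> space M. t \<le> lam * (\<Sum>i\<in>I. (Z i \<omega>)\<^sup>2)} \<le> exp (- t) * (1 / sqrt (1 - 2 * lam)) ^ card I"
proof -
  have Z[measurable]: "Z i \<in> borel_measurable M" if "i \<in> I" for i
    using ind that by (auto simp: indep_vars_def)
  have ind2: "indep_vars (\<lambda>_. borel) (\<lambda>i \<omega>. ennreal (exp (lam * (Z i \<omega>)\<^sup>2))) I"
    by (rule indep_vars_compose2[OF ind]) measurable
  have "ennreal (prob {\<omega> \<in> space M. t \<le> lam * (\<Sum>i\<in>I. (Z i \<omega>)\<^sup>2)}) =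
      (\<integral>\<^sup>+\<omega>. indicator {\<omega> \<in> space M. t \<le> lam * (\<Sum>i\<in>I. (Z i \<omega>)\<^sup>2)} \<omega> \<partial>M)"
    by (subst nn_integral_indicator) (auto simp: emeasure_eq_measure)
  also have "\<dots> \<le> (\<integral>\<^sup>+\<omega>. ennreal (exp (- t)) * (\<Prod>i\<in>I. ennreal (exp (lam * (Z i \<omega>)\<^sup>2))) \<partial>M)"
  proof (rule nn_integral_mono)
    fix \<omega>
    have "(\<Prod>i\<in>I. ennreal (exp (lam * (Z i \<omega>)\<^sup>2))) = ennreal (exp (lam * (\<Sum>i\<in>I. (Z i \<omega>)\<^sup>2)))"
      using I by (simp add: prod_ennreal exp_sum sum_distrib_left)
    moreover have "1 \<le> exp (- t) * exp (lam * (\<Sum>i\<in>I. (Z i \<omega>)\<^sup>2))" if "t \<le> lam * (\<Sum>i\<in>I. (Z i \<omega>)\<^sup>2)"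
      using that by (simp add: exp_add[symmetric])
    ultimately show "indicator {\<omega> \<in> space M. t \<le> lam * (\<Sum>i\<in>I. (Z i \<omega>)\<^sup>2)} \<omega> \<le>
        ennreal (exp (- t)) * (\<Prod>i\<in>I. ennreal (exp (lam * (Z i \<omega>)\<^sup>2)))"
      by (auto simp: indicator_def ennreal_mult[symmetric])
  qed
  also have "\<dots> = ennreal (exp (- t)) * (\<integral>\<^sup>+\<omega>. (\<Prod>i\<in>I. ennreal (exp (lam * (Z i \<omega>)\<^sup>2))) \<partial>M)"
    by (rule nn_integral_cmult) measurable
  also have "(\<integral>\<^sup>+\<omega>. (\<Prod>i\<in>I. ennreal (exp (lam * (Z i \<omega>)\<^sup>2))) \<partial>M) =
      (\<Prod>i\<in>I. \<integral>\<^sup>+\<omega>. ennreal (exp (lam * (Z i \<omega>)\<^sup>2)) \<partial>M)"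
    by (rule indep_vars_nn_integral[OF I ind2]) simp
  also have "\<dots> = (\<Prod>i\<in>I. ennreal (1 / sqrt (1 - 2 * lam)))"
    by (rule prod.cong) (simp_all add: nn_integral_exp_square_std_normal[OF D lam])
  also have "\<dots> = ennreal ((1 / sqrt (1 - 2 * lam)) ^ card I)"
    using lam by (simp add: ennreal_power)
  finally show ?thesis using lam
    by (simp add: ennreal_mult[symmetric] del: power_divide)
qed

text \<open>Chernoff bound at \<open>lam = s / 8\<close> for the upper and \<open>lam = - s / 8\<close> for the lower tail, with quadratic bounds
for the logarithm.\<close>

lemma chi_square_concentration:
  fixes Z :: "'i \<Rightarrow> 'a \<Rightarrow> real" and s :: real
  assumes I: "finite I" and ind: "indep_vars (\<lambda>_. borel) Z I"
    and D: "\<And>i. i \<in> I \<Longrightarrow> distributed M lborel (Z i) std_normal_density" and s: "0 < s" "s \<le> 1"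
  shows "prob {\<omega> \<in> space M. s * card I < \<bar>(\<Sum>i\<in>I. (Z i \<omega>)\<^sup>2) - card I\<bar>} \<le> 2 * exp (- real (card I) * s\<^sup>2 / 16)"
proof -
  let ?n = "real (card I)" and ?Q = "\<lambda>\<omega>. \<Sum>i\<in>I. (Z i \<omega>)\<^sup>2"
  have Z[measurable]: "Z i \<in> borel_measurable M" if "i \<in> I" for i
    using ind that by (auto simp: indep_vars_def)
  have root: "(1 / sqrt (1 - 2 * lam)) ^ card I = exp (?n * (- ln (1 - 2 * lam) / 2))" if "lam < 1 / 2" for lam
  proof -
    have "1 / sqrt (1 - 2 * lam) = exp (- ln (1 - 2 * lam) / 2)"
      using that by (simp add: exp_minus inverse_eq_divide ln_sqrt[symmetric])
    then show ?thesis by (simp only: exp_of_nat_mult)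
  qed
  have up: "prob {\<omega> \<in> space M. s / 8 * ((1 + s) * ?n) \<le> s / 8 * ?Q \<omega>} \<le> exp (- ?n * s\<^sup>2 / 16)"
  proof -
    have "prob {\<omega> \<in> space M. s / 8 * ((1 + s) * ?n) \<le> s / 8 * ?Q \<omega>}
        \<le> exp (- (s / 8 * ((1 + s) * ?n))) * (1 / sqrt (1 - 2 * (s / 8))) ^ card I"
      by (rule chi_square_chernoff[OF I ind D]) (use s in auto)
    also have "\<dots> = exp (?n * (- (s / 8 * (1 + s)) - ln (1 - s / 4) / 2))"
      by (subst root) (use s in \<open>auto simp: exp_add[symmetric] algebra_simps\<close>)
    also have "\<dots> \<le> exp (- ?n * s\<^sup>2 / 16)"
    proof -
      have "- (s / 4) - 2 * (s / 4)\<^sup>2 \<le> ln (1 - s / 4)"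
        by (rule ln_one_minus_pos_lower_bound) (use s in auto)
      then have "- (s / 8 * (1 + s)) - ln (1 - s / 4) / 2 \<le> - s\<^sup>2 / 16"
        by (simp add: power2_eq_square field_simps)
      then have "?n * (- (s / 8 * (1 + s)) - ln (1 - s / 4) / 2) \<le> ?n * (- s\<^sup>2 / 16)"
        by (rule mult_left_mono) simp
      then show ?thesis by simp
    qed
    finally show ?thesis .
  qed
  have lo: "prob {\<omega> \<in> space M. - s / 8 * ((1 - s) * ?n) \<le> - s / 8 * ?Q \<omega>} \<le> exp (- ?n * s\<^sup>2 / 16)"
  proof -
    have "prob {\<omega> \<in> space M. - s / 8 * ((1 - s) * ?n) \<le> - s / 8 * ?Q \<omega>}
        \<le> exp (- (- s / 8 * ((1 - s) * ?n))) * (1 / sqrt (1 - 2 * (- s / 8))) ^ card I"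
      by (rule chi_square_chernoff[OF I ind D]) (use s in auto)
    also have "\<dots> = exp (?n * (s / 8 * (1 - s) - ln (1 + s / 4) / 2))"
      by (subst root) (use s in \<open>auto simp: exp_add[symmetric] algebra_simps\<close>)
    also have "\<dots> \<le> exp (- ?n * s\<^sup>2 / 16)"
    proof -
      have ln_ge: "s / 4 - (s / 4)\<^sup>2 \<le> ln (1 + s / 4)"
        by (rule ln_one_plus_pos_lower_bound) (use s in auto)
      have "s / 8 * (1 - s) - ln (1 + s / 4) / 2 \<le> - s\<^sup>2 / 16"
      proof -
        have "s / 8 * (1 - s) = s / 8 - s\<^sup>2 / 8" by (simp add: power2_eq_square right_diff_distrib)
        moreover have "s / 4 - s\<^sup>2 / 16 \<le> ln (1 + s / 4)" using ln_ge by (simp add: power_divide)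
        moreover have "0 \<le> s\<^sup>2" by simp
        ultimately show ?thesis by linarith
      qed
      then have "?n * (s / 8 * (1 - s) - ln (1 + s / 4) / 2) \<le> ?n * (- s\<^sup>2 / 16)"
        by (rule mult_left_mono) simp
      then show ?thesis by simp
    qed
    finally show ?thesis .
  qed
  have "{\<omega> \<in> space M. s * ?n < \<bar>?Q \<omega> - ?n\<bar>} \<subseteq> {\<omega> \<in> space M. s / 8 * ((1 + s) * ?n) \<le> s / 8 * ?Q \<omega>} \<union>
      {\<omega> \<in> space M. - s / 8 * ((1 - s) * ?n) \<le> - s / 8 * ?Q \<omega>}"
  proof safe
    fix \<omega> assume "\<omega> \<in> space M" and far: "s * ?n < \<bar>?Q \<omega> - ?n\<bar>"
      and "\<not> - s / 8 * ((1 - s) * ?n) \<le> - s / 8 * ?Q \<omega>"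
    then have "s / 8 * ((1 - s) * ?n) < s / 8 * ?Q \<omega>" by simp
    then have "(1 - s) * ?n < ?Q \<omega>" using s by simp
    then have "(1 + s) * ?n \<le> ?Q \<omega>" using far by (simp add: algebra_simps)
    then show "s / 8 * ((1 + s) * ?n) \<le> s / 8 * ?Q \<omega>" using s by (intro mult_left_mono) auto
  qed
  then have "prob {\<omega> \<in> space M. s * ?n < \<bar>?Q \<omega> - ?n\<bar>} \<le> prob ({\<omega> \<in> space M. s / 8 * ((1 + s) * ?n) \<le> s / 8 * ?Q \<omega>} \<union>
      {\<omega> \<in> space M. - s / 8 * ((1 - s) * ?n) \<le> - s / 8 * ?Q \<omega>})"
    by (intro finite_measure_mono) auto
  also have "\<dots> \<le> prob {\<omega> \<in> space M. s / 8 * ((1 + s) * ?n) \<le> s / 8 * ?Q \<omega>} +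
      prob {\<omega> \<in> space M. - s / 8 * ((1 - s) * ?n) \<le> - s / 8 * ?Q \<omega>}"
    by (intro measure_Un_le) auto
  finally show ?thesis using up lo by simp
qed

text \<open>Fubini: one of two independent random elements may be held fixed when an event is bounded uniformly. This
replaces conditional distributions throughout.\<close>

lemma prob_freeze:
  assumes U[measurable]: "U \<in> measurable M MU" and V[measurable]: "V \<in> measurable M MV"
    and product: "\<And>A B. A \<in> sets MU \<Longrightarrow> B \<in> sets MV \<Longrightarrow>
      prob {\<omega> \<in> space M. U \<omega> \<in> A \<and> V \<omega> \<in> B} = prob {\<omega> \<in> space M. U \<omega> \<in> A} * prob {\<omega> \<in> space M. V \<omega> \<in> B}"
    and E: "E \<in> sets (MU \<Otimes>\<^sub>M MV)"
    and le: "\<And>v. v \<in> space MV \<Longrightarrow> prob {\<omega> \<in> space M. (U \<omega>, v) \<in> E} \<le> b"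
  shows "prob {\<omega> \<in> space M. (U \<omega>, V \<omega>) \<in> E} \<le> b"
proof -
  obtain \<omega> where \<omega>: "\<omega> \<in> space M" using not_empty by auto
  interpret DU: prob_space "distr M MU U" by (rule prob_space_distr) simp
  interpret DV: prob_space "distr M MV V" by (rule prob_space_distr) simp
  interpret DP: pair_prob_space "distr M MU U" "distr M MV V" ..
  have eq: "distr M MU U \<Otimes>\<^sub>M distr M MV V = distr M (MU \<Otimes>\<^sub>M MV) (\<lambda>x. (U x, V x))"
  proof (rule pair_measure_eqI)
    show "sigma_finite_measure (distr M MU U)" "sigma_finite_measure (distr M MV V)" by unfold_locales
    fix A B assume "A \<in> sets (distr M MU U)" "B \<in> sets (distr M MV V)"
    then have [measurable]: "A \<in> sets MU" "B \<in> sets MV" by auto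
    have "emeasure (distr M MU U) A * emeasure (distr M MV V) B =
        ennreal (prob {\<omega> \<in> space M. U \<omega> \<in> A} * prob {\<omega> \<in> space M. V \<omega> \<in> B})"
      by (simp add: emeasure_distr emeasure_eq_measure ennreal_mult vimage_def Int_def conj_commute)
    also have "\<dots> = ennreal (prob {\<omega> \<in> space M. U \<omega> \<in> A \<and> V \<omega> \<in> B})"
      by (simp add: product)
    also have "\<dots> = emeasure (distr M (MU \<Otimes>\<^sub>M MV) (\<lambda>x. (U x, V x))) (A \<times> B)"
      by (subst emeasure_distr) (auto simp: emeasure_eq_measure intro!: arg_cong[where f=prob])
    finally show "emeasure (distr M MU U) A * emeasure (distr M MV V) B =
        emeasure (distr M (MU \<Otimes>\<^sub>M MV) (\<lambda>x. (U x, V x))) (A \<times> B)" .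
  qed simp
  have b: "0 \<le> b"
  proof -
    have "V \<omega> \<in> space MV" using V \<omega> by (rule measurable_space)
    then show ?thesis using le measure_nonneg order_trans by blast
  qed
  have "ennreal (prob {\<omega> \<in> space M. (U \<omega>, V \<omega>) \<in> E}) = emeasure (distr M (MU \<Otimes>\<^sub>M MV) (\<lambda>x. (U x, V x))) E"
    using E by (subst emeasure_distr)
      (auto simp: emeasure_eq_measure intro!: arg_cong[where f=prob])
  also have "\<dots> = emeasure (distr M MU U \<Otimes>\<^sub>M distr M MV V) E" by (simp only: eq)
  also have "\<dots> = (\<integral>\<^sup>+ v. emeasure (distr M MU U) ((\<lambda>u. (u, v)) -` E) \<partial>distr M MV V)"
    using E by (intro DP.emeasure_pair_measure_alt2) simp
  also have "\<dots> \<le> (\<integral>\<^sup>+ v. ennreal b \<partial>distr M MV V)"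
  proof (rule nn_integral_mono)
    fix v assume "v \<in> space (distr M MV V)"
    then have v: "v \<in> space MV" by simp
    have "(\<lambda>u. (u, v)) -` E \<in> sets MU" using E by (rule sets_Pair2)
    then have "emeasure (distr M MU U) ((\<lambda>u. (u, v)) -` E) = prob {\<omega> \<in> space M. (U \<omega>, v) \<in> E}"
      by (subst emeasure_distr) (auto simp: emeasure_eq_measure intro!: arg_cong[where f=prob])
    then show "emeasure (distr M MU U) ((\<lambda>u. (u, v)) -` E) \<le> ennreal b"
      using le[OF v] by (simp add: ennreal_leI)
  qed
  also have "\<dots> = ennreal b" using DV.emeasure_space_1 by simp
  finally show ?thesis using b by (simp add: ennreal_le_iff)
qed

lemma indep_var_freeze:
  assumes ind: "indep_var MU U MV V" and E: "E \<in> sets (MU \<Otimes>\<^sub>M MV)"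
    and le: "\<And>v. v \<in> space MV \<Longrightarrow> prob {\<omega> \<in> space M. (U \<omega>, v) \<in> E} \<le> b"
  shows "prob {\<omega> \<in> space M. (U \<omega>, V \<omega>) \<in> E} \<le> b"
proof (rule prob_freeze[OF indep_var_rv1[OF ind] indep_var_rv2[OF ind] _ E le])
  fix A B assume "A \<in> sets MU" "B \<in> sets MV"
  then have "prob ((\<lambda>x. (U x, V x)) -` (A \<times> B) \<inter> space M) = prob (U -` A \<inter> space M) * prob (V -` B \<inter> space M)"
    by (rule indep_varD[OF ind])
  then show "prob {\<omega> \<in> space M. U \<omega> \<in> A \<and> V \<omega> \<in> B} = prob {\<omega> \<in> space M. U \<omega> \<in> A} * prob {\<omega> \<in> space M. V \<omega> \<in> B}"
    by (simp add: vimage_def Int_def conj_commute)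
qed

text \<open>Coordinates with zero coefficient are dropped first, as they have no density.\<close>

lemma standard_normal_projection:
  assumes I: "finite I" and ind: "indep_vars (\<lambda>_. borel) U I" and \<tau>: "0 < \<tau>"
    and D: "\<And>i. i \<in> I \<Longrightarrow> distributed M lborel (U i) (normal_density 0 \<tau>)"
    and v: "0 < (\<Sum>i\<in>I. (v i)\<^sup>2)"
  shows "distributed M lborel (\<lambda>\<omega>. (\<Sum>i\<in>I. v i * U i \<omega>) / (\<tau> * sqrt (\<Sum>i\<in>I. (v i)\<^sup>2))) std_normal_density"
proof -
  define J where "J = {i \<in> I. v i \<noteq> 0}"
  have J: "finite J" "J \<subseteq> I" using I by (auto simp: J_def)
  have sJ: "(\<Sum>i\<in>I. (v i)\<^sup>2) = (\<Sum>i\<in>J. (v i)\<^sup>2)" "(\<lambda>\<omega>. \<Sum>i\<in>I. v i * U i \<omega>) = (\<lambda>\<omega>. \<Sum>i\<in>J. v i * U i \<omega>)"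
    using I by (auto simp: J_def fun_eq_iff intro!: sum.mono_neutral_right)
  have "J \<noteq> {}" using v unfolding sJ by auto
  have "distributed M lborel (\<lambda>\<omega>. \<Sum>i\<in>J. v i * U i \<omega>)
      (normal_density (\<Sum>i\<in>J. 0) (sqrt (\<Sum>i\<in>J. (\<bar>v i\<bar> * \<tau>)\<^sup>2)))"
  proof (rule sum_indep_normal[OF J(1) \<open>J \<noteq> {}\<close>])
    show "indep_vars (\<lambda>_. borel) (\<lambda>i \<omega>. v i * U i \<omega>) J"
      by (rule indep_vars_compose2[OF indep_vars_subset[OF ind J(2)]]) measurable
    fix i assume i: "i \<in> J"
    then show "0 < \<bar>v i\<bar> * \<tau>" using \<tau> by (simp add: J_def)
    show "distributed M lborel (\<lambda>\<omega>. v i * U i \<omega>) (normal_density 0 (\<bar>v i\<bar> * \<tau>))"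
      using normal_density_affine[OF D \<tau>, of i "v i" 0] i J by (auto simp: J_def)
  qed
  also have "sqrt (\<Sum>i\<in>J. (\<bar>v i\<bar> * \<tau>)\<^sup>2) = \<tau> * sqrt (\<Sum>i\<in>J. (v i)\<^sup>2)"
    using \<tau> by (simp add: power_mult_distrib sum_distrib_left[symmetric] real_sqrt_mult mult.commute)
  finally have "distributed M lborel (\<lambda>\<omega>. \<Sum>i\<in>I. v i * U i \<omega>) (normal_density 0 (\<tau> * sqrt (\<Sum>i\<in>I. (v i)\<^sup>2)))"
    by (simp add: sJ)
  then show ?thesis
    using normal_standard_normal_convert[of "\<tau> * sqrt (\<Sum>i\<in>I. (v i)\<^sup>2)" "\<lambda>\<omega>. \<Sum>i\<in>I. v i * U i \<omega>" 0] \<tau> v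
    by simp
qed

lemma projection_tail_fixed:
  assumes I: "finite I" and ind: "indep_vars (\<lambda>_. borel) U I" and \<tau>: "0 < \<tau>"
    and D: "\<And>i. i \<in> I \<Longrightarrow> distributed M lborel (U i) (normal_density 0 \<tau>)" and s: "0 \<le> s"
  shows "prob {\<omega> \<in> space M. s * (\<tau> * sqrt (\<Sum>i\<in>I. (v i)\<^sup>2)) < \<bar>\<Sum>i\<in>I. v i * U i \<omega>\<bar>} \<le> 2 * exp (- s\<^sup>2 / 2)"
proof (cases "0 < (\<Sum>i\<in>I. (v i)\<^sup>2)")
  case True
  let ?c = "\<tau> * sqrt (\<Sum>i\<in>I. (v i)\<^sup>2)"
  let ?Z = "\<lambda>\<omega>. (\<Sum>i\<in>I. v i * U i \<omega>) / ?c"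
  have c: "0 < ?c" using True \<tau> by simp
  have Z: "distributed M lborel ?Z std_normal_density"
    by (rule standard_normal_projection[OF I ind \<tau> D True])
  then have [measurable]: "?Z \<in> borel_measurable M" by (simp add: distributed_def)
  have "{\<omega> \<in> space M. s * ?c < \<bar>\<Sum>i\<in>I. v i * U i \<omega>\<bar>} \<subseteq> {\<omega> \<in> space M. s \<le> \<bar>?Z \<omega>\<bar>}"
    using c by (auto simp: abs_divide pos_le_divide_eq)
  then have "prob {\<omega> \<in> space M. s * ?c < \<bar>\<Sum>i\<in>I. v i * U i \<omega>\<bar>} \<le> prob {\<omega> \<in> space M. s \<le> \<bar>?Z \<omega>\<bar>}"
    by (rule finite_measure_mono) measurable
  also have "\<dots> \<le> 2 * exp (- s\<^sup>2 / 2)" by (rule std_normal_tail_le[OF Z s])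
  finally show ?thesis .
next
  case False
  then have "\<forall>i\<in>I. v i = 0" using I
    by (metis (mono_tags, lifting) not_less sum_nonneg_eq_0_iff order_antisym sum_nonneg zero_le_power2 power_eq_0_iff)
  then have "{\<omega> \<in> space M. s * (\<tau> * sqrt (\<Sum>i\<in>I. (v i)\<^sup>2)) < \<bar>\<Sum>i\<in>I. v i * U i \<omega>\<bar>} = {}" by simp
  then show ?thesis by (simp only: measure_empty) simp
qed

lemma projection_tail:
  assumes I: "finite I" and ind: "indep_vars (\<lambda>_. borel) U I" and \<tau>: "0 < \<tau>"
    and D: "\<And>i. i \<in> I \<Longrightarrow> distributed M lborel (U i) (normal_density 0 \<tau>)" and s: "0 \<le> s"
    and indV: "indep_var (PiM I (\<lambda>_. borel)) (\<lambda>\<omega>. \<lambda>i\<in>I. U i \<omega>) MV V"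
    and w: "\<And>i. i \<in> I \<Longrightarrow> (\<lambda>v. w v i) \<in> borel_measurable MV"
  shows "prob {\<omega> \<in> space M. s * (\<tau> * sqrt (\<Sum>i\<in>I. (w (V \<omega>) i)\<^sup>2)) < \<bar>\<Sum>i\<in>I. w (V \<omega>) i * U i \<omega>\<bar>}
    \<le> 2 * exp (- s\<^sup>2 / 2)"
proof -
  have V: "V \<in> measurable M MV" and U: "(\<lambda>\<omega>. \<lambda>i\<in>I. U i \<omega>) \<in> measurable M (PiM I (\<lambda>_. borel))"
    using indV indep_var_rv1 indep_var_rv2 by blast+
  define E where "E = {uv \<in> space (PiM I (\<lambda>_. borel) \<Otimes>\<^sub>M MV).
    s * (\<tau> * sqrt (\<Sum>i\<in>I. (w (snd uv) i)\<^sup>2)) < \<bar>\<Sum>i\<in>I. w (snd uv) i * (fst uv i)\<bar>}"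
  have m1[measurable]: "(\<lambda>uv. w (snd uv) i) \<in> borel_measurable (PiM I (\<lambda>_. borel) \<Otimes>\<^sub>M MV)" if "i \<in> I" for i
    using measurable_compose[OF measurable_snd w[OF that]] .
  have m2[measurable]: "(\<lambda>uv. fst uv i) \<in> borel_measurable (PiM I (\<lambda>_. borel) \<Otimes>\<^sub>M MV)" if "i \<in> I" for i
    using measurable_compose[OF measurable_fst measurable_component_singleton[OF that]] .
  have E: "E \<in> sets (PiM I (\<lambda>_. borel) \<Otimes>\<^sub>M MV)" unfolding E_def by measurable
  have "prob {\<omega> \<in> space M. ((\<lambda>i\<in>I. U i \<omega>), V \<omega>) \<in> E} \<le> 2 * exp (- s\<^sup>2 / 2)"
  proof (rule indep_var_freeze[OF indV E])
    fix v assume v: "v \<in> space MV"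
    have "{\<omega> \<in> space M. ((\<lambda>i\<in>I. U i \<omega>), v) \<in> E} =
        {\<omega> \<in> space M. s * (\<tau> * sqrt (\<Sum>i\<in>I. (w v i)\<^sup>2)) < \<bar>\<Sum>i\<in>I. w v i * U i \<omega>\<bar>}"
      using v by (auto simp: E_def space_pair_measure space_PiM)
    then show "prob {\<omega> \<in> space M. ((\<lambda>i\<in>I. U i \<omega>), v) \<in> E} \<le> 2 * exp (- s\<^sup>2 / 2)"
      using projection_tail_fixed[OF I ind \<tau> D s, of "w v"] by simp
  qed
  also have "{\<omega> \<in> space M. ((\<lambda>i\<in>I. U i \<omega>), V \<omega>) \<in> E} = {\<omega> \<in> space M.
      s * (\<tau> * sqrt (\<Sum>i\<in>I. (w (V \<omega>) i)\<^sup>2)) < \<bar>\<Sum>i\<in>I. w (V \<omega>) i * U i \<omega>\<bar>}"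
    using measurable_space[OF V] by (auto simp: E_def space_pair_measure space_PiM)
  finally show ?thesis .
qed

text \<open>Given the direction, the projections of the independent columns are independent standard normal
variables after scaling, and the probabilities multiply. A vanishing direction is excluded, as then the
event would be certain.\<close>

lemma all_projections_small:
  assumes A: "finite A" and J: "finite J" and ind: "indep_vars (\<lambda>_. borel) U (A \<times> J)" and \<tau>: "0 < \<tau>"
    and D: "\<And>i. i \<in> A \<times> J \<Longrightarrow> distributed M lborel (U i) (normal_density 0 \<tau>)"
    and x: "0 \<le> x" "0 \<le> h"
    and indV: "indep_var (PiM (A \<times> J) (\<lambda>_. borel)) (\<lambda>\<omega>. \<lambda>i\<in>A \<times> J. U i \<omega>) MV V"
    and w: "\<And>a. a \<in> A \<Longrightarrow> (\<lambda>v. w v a) \<in> borel_measurable MV"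
  shows "prob {\<omega> \<in> space M. 0 < (\<Sum>a\<in>A. (w (V \<omega>) a)\<^sup>2) \<and>
      (\<forall>j\<in>J. (\<Sum>a\<in>A. w (V \<omega>) a * U (a, j) \<omega>) \<le> x * (\<tau> * sqrt (\<Sum>a\<in>A. (w (V \<omega>) a)\<^sup>2)))}
    \<le> (1 - h * std_normal_density (x + h)) ^ card J"
proof -
  let ?P = "PiM (A \<times> J) (\<lambda>_. borel)"
  have V: "V \<in> measurable M MV" using indV indep_var_rv2 by blast
  define E where "E = {uv \<in> space (?P \<Otimes>\<^sub>M MV). 0 < (\<Sum>a\<in>A. (w (snd uv) a)\<^sup>2) \<and>
    (\<forall>j\<in>J. (\<Sum>a\<in>A. w (snd uv) a * fst uv (a, j)) \<le> x * (\<tau> * sqrt (\<Sum>a\<in>A. (w (snd uv) a)\<^sup>2)))}"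
  have m1[measurable]: "(\<lambda>uv. w (snd uv) a) \<in> borel_measurable (?P \<Otimes>\<^sub>M MV)" if "a \<in> A" for a
    using measurable_compose[OF measurable_snd w[OF that]] .
  have m2[measurable]: "(\<lambda>uv. fst uv (a, j)) \<in> borel_measurable (?P \<Otimes>\<^sub>M MV)" if "a \<in> A" "j \<in> J" for a j
    using measurable_compose[OF measurable_fst measurable_component_singleton[of "(a, j)" "A \<times> J" "\<lambda>_. borel"]] that by simp
  have E: "E \<in> sets (?P \<Otimes>\<^sub>M MV)"
  proof -
    have *: "E = {uv \<in> space (?P \<Otimes>\<^sub>M MV). 0 < (\<Sum>a\<in>A. (w (snd uv) a)\<^sup>2)} \<inter> {uv \<in> space (?P \<Otimes>\<^sub>M MV).
      \<forall>j\<in>J. (\<Sum>a\<in>A. w (snd uv) a * fst uv (a, j)) \<le> x * (\<tau> * sqrt (\<Sum>a\<in>A. (w (snd uv) a)\<^sup>2))}"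
      unfolding E_def by auto
    show ?thesis unfolding *
      by (intro sets.Int sets.sets_Collect_finite_All[OF _ J]) measurable
  qed
  have "prob {\<omega> \<in> space M. ((\<lambda>i\<in>A \<times> J. U i \<omega>), V \<omega>) \<in> E} \<le> (1 - h * std_normal_density (x + h)) ^ card J"
  proof (rule indep_var_freeze[OF indV E])
    fix v assume v: "v \<in> space MV"
    let ?c = "\<tau> * sqrt (\<Sum>a\<in>A. (w v a)\<^sup>2)"
    have eq: "{\<omega> \<in> space M. ((\<lambda>i\<in>A \<times> J. U i \<omega>), v) \<in> E} = {\<omega> \<in> space M. 0 < (\<Sum>a\<in>A. (w v a)\<^sup>2) \<and>
        (\<forall>j\<in>J. (\<Sum>a\<in>A. w v a * U (a, j) \<omega>) \<le> x * ?c)}"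
      using v by (auto simp: E_def space_pair_measure space_PiM)
    show "prob {\<omega> \<in> space M. ((\<lambda>i\<in>A \<times> J. U i \<omega>), v) \<in> E} \<le> (1 - h * std_normal_density (x + h)) ^ card J"
    proof (cases "0 < (\<Sum>a\<in>A. (w v a)\<^sup>2) \<and> J \<noteq> {}")
      case False
      have "0 \<le> 1 - h * std_normal_density (x + h)" using scaled_density_le_1[OF x] by simp
      then show ?thesis unfolding eq using False prob_le_1 by auto
    next
      case True
      define Z where "Z j \<omega> = (\<Sum>a\<in>A. w v a * U (a, j) \<omega>) / ?c" for j \<omega>
      have c: "0 < ?c" using True \<tau> by simp
      have Z: "distributed M lborel (Z j) std_normal_density" if j: "j \<in> J" for j
      proof -
        have sub: "A \<times> {j} \<subseteq> A \<times> J" using j by auto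
        have re: "(\<Sum>i\<in>A \<times> {j}. f i) = (\<Sum>a\<in>A. f (a, j))" for f :: "_ \<Rightarrow> real"
          by (rule sum.reindex_bij_witness[of _ "\<lambda>a. (a, j)" fst]) auto
        show ?thesis
          using standard_normal_projection[of "A \<times> {j}" U \<tau> "\<lambda>i. w v (fst i)"] A \<tau> D sub True
            indep_vars_subset[OF ind sub] unfolding Z_def[abs_def] re by auto
      qed
      have indZ: "indep_vars (\<lambda>_. borel) Z J"
      proof -
        have "indep_vars (\<lambda>_. borel) (\<lambda>j \<omega>. (\<lambda>f. (\<Sum>a\<in>A. w v a * f (a, j)) / ?c) (\<lambda>i\<in>A \<times> {j}. U i \<omega>)) J"
        proof (rule indep_vars_compose2[where Y = "\<lambda>j f. (\<Sum>a\<in>A. w v a * f (a, j)) / ?c"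
              and M' = "\<lambda>j. PiM (A \<times> {j}) (\<lambda>_. borel)"])
          show "indep_vars (\<lambda>j. PiM (A \<times> {j}) (\<lambda>_. borel)) (\<lambda>j \<omega>. \<lambda>i\<in>A \<times> {j}. U i \<omega>) J"
            by (rule indep_vars_restrict[OF ind]) (auto simp: disjoint_family_on_def)
          fix j assume "j \<in> J"
          have [measurable]: "(\<lambda>f. f (a, j)) \<in> borel_measurable (PiM (A \<times> {j}) (\<lambda>_. borel))" if "a \<in> A" for a
            by (rule measurable_component_singleton) (use that in simp)
          show "(\<lambda>f. (\<Sum>a\<in>A. w v a * f (a, j)) / ?c) \<in> borel_measurable (PiM (A \<times> {j}) (\<lambda>_. borel))"
            by measurable
        qed
        then show ?thesis unfolding Z_def[abs_def] by (simp cong: sum.cong)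
      qed
      have "{\<omega> \<in> space M. ((\<lambda>i\<in>A \<times> J. U i \<omega>), v) \<in> E} = (\<Inter>j\<in>J. Z j -` {..x} \<inter> space M)"
        unfolding eq Z_def using c True by (auto simp: pos_divide_le_eq)
      then have "prob {\<omega> \<in> space M. ((\<lambda>i\<in>A \<times> J. U i \<omega>), v) \<in> E} = prob (\<Inter>j\<in>J. Z j -` {..x} \<inter> space M)"
        by simp
      also have "\<dots> = (\<Prod>j\<in>J. prob (Z j -` {..x} \<inter> space M))"
        by (rule indep_varsD[OF indZ]) (use True J in auto)
      also have "\<dots> \<le> (\<Prod>j\<in>J. 1 - h * std_normal_density (x + h))"
      proof (rule prod_mono)
        fix j assume "j \<in> J"
        have "Z j -` {..x} \<inter> space M = {\<omega> \<in> space M. Z j \<omega> \<le> x}" by auto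
        then show "0 \<le> prob (Z j -` {..x} \<inter> space M) \<and> prob (Z j -` {..x} \<inter> space M) \<le> 1 - h * std_normal_density (x + h)"
          using std_normal_le_prob[OF Z[OF \<open>j \<in> J\<close>] x] by simp
      qed
      finally show ?thesis by simp
    qed
  qed
  also have "{\<omega> \<in> space M. ((\<lambda>i\<in>A \<times> J. U i \<omega>), V \<omega>) \<in> E} = {\<omega> \<in> space M. 0 < (\<Sum>a\<in>A. (w (V \<omega>) a)\<^sup>2) \<and>
      (\<forall>j\<in>J. (\<Sum>a\<in>A. w (V \<omega>) a * U (a, j) \<omega>) \<le> x * (\<tau> * sqrt (\<Sum>a\<in>A. (w (V \<omega>) a)\<^sup>2)))}"
    using measurable_space[OF V] by (auto simp: E_def space_pair_measure space_PiM)
  finally show ?thesis .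
qed

lemma markov_count:
  fixes b t :: real
  assumes S: "finite S" and E: "\<And>i. i \<in> S \<Longrightarrow> {\<omega> \<in> space M. Q i \<omega>} \<in> events"
    and le: "\<And>i. i \<in> S \<Longrightarrow> prob {\<omega> \<in> space M. Q i \<omega>} \<le> b" and t: "0 < t"
  shows "prob {\<omega> \<in> space M. t \<le> real (card {i \<in> S. Q i \<omega>})} \<le> card S * b / t"
proof -
  define f where "f \<omega> = (\<Sum>i\<in>S. indicator {\<omega> \<in> space M. Q i \<omega>} \<omega> :: real)" for \<omega>
  have int: "integrable M f"
    unfolding f_def by (intro Bochner_Integration.integrable_sum integrable_real_indicator) (use E in \<open>auto simp: emeasure_eq_measure\<close>)
  have f: "f \<omega> = real (card {i \<in> S. Q i \<omega>})" if "\<omega> \<in> space M" for \<omega>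
    using S that by (simp add: f_def indicator_def sum.If_cases Int_def)
  have "{\<omega> \<in> space M. t \<le> real (card {i \<in> S. Q i \<omega>})} = {\<omega> \<in> space M. t \<le> f \<omega>}"
    using f by auto
  then have "prob {\<omega> \<in> space M. t \<le> real (card {i \<in> S. Q i \<omega>})} = prob {\<omega> \<in> space M. t \<le> f \<omega>}" by simp
  also have "\<dots> \<le> expectation f / t"
    by (rule integral_Markov_inequality_measure[OF int, of "{}"]) (use t in \<open>auto simp: f_def sum_nonneg\<close>)
  also have "expectation f = (\<Sum>i\<in>S. prob {\<omega> \<in> space M. Q i \<omega>})"
    unfolding f_def using E by (subst Bochner_Integration.integral_sum) (auto simp: emeasure_eq_measure)
  also have "(\<Sum>i\<in>S. prob {\<omega> \<in> space M. Q i \<omega>}) / t \<le> (\<Sum>i\<in>S. b) / t"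
    by (intro divide_right_mono sum_mono le) (use t in auto)
  finally show ?thesis by simp
qed

end

section \<open>The good event\<close>

text \<open>The events below are stated for a real array \<open>\<xi>\<close>, the entries of the design, and a real sequence \<open>\<zeta>\<close>,
the noise vector, so that they are sets in a product space and either argument can be frozen. In
\<open>response S m \<xi> \<zeta>\<close> the signal variables are \<open>S\<close> and their common coefficient is \<open>m\<close>; with \<open>S - {i}\<close> for \<open>S\<close>
it is the response after removal of the contribution of \<open>i\<close>, which is independent of column \<open>i\<close>.\<close>

definition response :: "nat set \<Rightarrow> real \<Rightarrow> (nat \<times> nat \<Rightarrow> real) \<Rightarrow> (nat \<Rightarrow> real) \<Rightarrow> nat \<Rightarrow> real" where
  "response S m \<xi> \<zeta> a = m * (\<Sum>j\<in>S. \<xi> (a, j)) + \<zeta> a"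

definition l2norm :: "nat \<Rightarrow> (nat \<Rightarrow> real) \<Rightarrow> real" where
  "l2norm n v = sqrt (\<Sum>a<n. (v a)\<^sup>2)"

definition gram_entry :: "nat \<Rightarrow> (nat \<times> nat \<Rightarrow> real) \<Rightarrow> nat \<Rightarrow> nat \<Rightarrow> real" where
  "gram_entry n \<xi> i j = (\<Sum>a<n. \<xi> (a, i) * \<xi> (a, j))"

definition leave_out_corr :: "nat \<Rightarrow> nat set \<Rightarrow> real \<Rightarrow> (nat \<times> nat \<Rightarrow> real) \<Rightarrow> (nat \<Rightarrow> real) \<Rightarrow> nat \<Rightarrow> real" where
  "leave_out_corr n S m \<xi> \<zeta> i = (\<Sum>a<n. response (S - {i}) m \<xi> \<zeta> a * \<xi> (a, i))"

definition good_columns :: "nat \<Rightarrow> nat \<Rightarrow> real \<Rightarrow> real \<Rightarrow> (nat \<times> nat \<Rightarrow> real) \<Rightarrow> bool" where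
  "good_columns n p \<mu> s \<xi> \<longleftrightarrow>
     (\<forall>i\<in>{..<p}. \<bar>gram_entry n \<xi> i i - 1\<bar> \<le> \<mu>) \<and>
     (\<forall>i\<in>{..<p}. \<forall>j\<in>{..<p} - {i}. \<bar>gram_entry n \<xi> i j\<bar> \<le> s * (1 / sqrt n * l2norm n (\<lambda>a. \<xi> (a, j))))"

definition good_correlations ::
    "nat \<Rightarrow> nat \<Rightarrow> nat set \<Rightarrow> real \<Rightarrow> real \<Rightarrow> (nat \<times> nat \<Rightarrow> real) \<Rightarrow> (nat \<Rightarrow> real) \<Rightarrow> bool" where
  "good_correlations n p S m s \<xi> \<zeta> \<longleftrightarrow>
     (\<forall>i\<in>{..<p}. \<bar>leave_out_corr n S m \<xi> \<zeta> i\<bar> \<le> s * (1 / sqrt n * l2norm n (response (S - {i}) m \<xi> \<zeta>)))"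

text \<open>Together these bound the norm of the response from below whatever the size of \<open>\<zeta>\<close>, because \<open>\<zeta>\<close> is nearly
orthogonal to the sum of the signal columns.\<close>

definition good_signal_sum ::
    "nat \<Rightarrow> nat set \<Rightarrow> real \<Rightarrow> real \<Rightarrow> (nat \<times> nat \<Rightarrow> real) \<Rightarrow> (nat \<Rightarrow> real) \<Rightarrow> bool" where
  "good_signal_sum n S \<mu> s \<xi> \<zeta> \<longleftrightarrow>
     \<bar>(\<Sum>a<n. \<Sum>j\<in>S. \<zeta> a * \<xi> (a, j))\<bar> \<le> s * (1 / sqrt n * sqrt (real (card S) * (\<Sum>a<n. (\<zeta> a)\<^sup>2))) \<and>
     \<bar>(\<Sum>a<n. (\<Sum>j\<in>S. \<xi> (a, j))\<^sup>2) - real (card S)\<bar> \<le> \<mu> * real (card S)"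

definition good_noise ::
    "nat \<Rightarrow> nat \<Rightarrow> nat set \<Rightarrow> real \<Rightarrow> real \<Rightarrow> (nat \<times> nat \<Rightarrow> real) \<Rightarrow> (nat \<Rightarrow> real) \<Rightarrow> bool" where
  "good_noise n p S m x \<xi> \<zeta> \<longleftrightarrow>
     (0 < (\<Sum>a<n. (response S m \<xi> \<zeta> a)\<^sup>2) \<longrightarrow>
      (\<exists>j\<in>{..<p} - S. x * (1 / sqrt n * l2norm n (response S m \<xi> \<zeta>)) < (\<Sum>a<n. response S m \<xi> \<zeta> a * \<xi> (a, j))))"

text \<open>The event that a signal variable whose own contribution to the response has been removed is still large,
measured in standard deviations.\<close>

definition strong_signal ::
    "nat \<Rightarrow> nat set \<Rightarrow> real \<Rightarrow> real \<Rightarrow> (nat \<times> nat \<Rightarrow> real) \<Rightarrow> (nat \<Rightarrow> real) \<Rightarrow> nat \<Rightarrow> bool" where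
  "strong_signal n S m x' \<xi> \<zeta> i \<longleftrightarrow>
     x' * (1 / sqrt n * l2norm n (response (S - {i}) m \<xi> \<zeta>)) < \<bar>leave_out_corr n S m \<xi> \<zeta> i\<bar>"

definition good_count ::
    "nat \<Rightarrow> nat set \<Rightarrow> real \<Rightarrow> real \<Rightarrow> real \<Rightarrow> (nat \<times> nat \<Rightarrow> real) \<Rightarrow> (nat \<Rightarrow> real) \<Rightarrow> bool" where
  "good_count n S m x' t \<xi> \<zeta> \<longleftrightarrow> real (card {i \<in> S. strong_signal n S m x' \<xi> \<zeta> i}) < t"

definition good ::
    "nat \<Rightarrow> nat \<Rightarrow> nat set \<Rightarrow> real \<Rightarrow> real \<Rightarrow> real \<Rightarrow> real \<Rightarrow> real \<Rightarrow> real \<Rightarrow> (nat \<times> nat \<Rightarrow> real) \<Rightarrow> (nat \<Rightarrow> real) \<Rightarrow> bool" where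
  "good n p S m \<mu> s x x' t \<xi> \<zeta> \<longleftrightarrow> good_columns n p \<mu> s \<xi> \<and> good_correlations n p S m s \<xi> \<zeta> \<and>
     good_signal_sum n S \<mu> s \<xi> \<zeta> \<and> good_noise n p S m x \<xi> \<zeta> \<and> good_count n S m x' t \<xi> \<zeta>"

text \<open>Measurability is stated for coordinate maps on an arbitrary space, so that it serves both the original
space with a fixed noise vector and the product space.\<close>

context
  fixes N :: "'b measure" and F :: "'b \<Rightarrow> nat \<times> nat \<Rightarrow> real" and H :: "'b \<Rightarrow> nat \<Rightarrow> real"
    and n p :: nat and S :: "nat set"
  assumes F [measurable]: "\<And>a j. a < n \<Longrightarrow> j < p \<Longrightarrow> (\<lambda>\<omega>. F \<omega> (a, j)) \<in> borel_measurable N"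
    and H [measurable]: "\<And>a. a < n \<Longrightarrow> (\<lambda>\<omega>. H \<omega> a) \<in> borel_measurable N"
    and S: "S \<subseteq> {..<p}"
begin

lemma gram_entry_measurable:
  "i < p \<Longrightarrow> j < p \<Longrightarrow> (\<lambda>\<omega>. gram_entry n (F \<omega>) i j) \<in> borel_measurable N"
  unfolding gram_entry_def by (intro borel_measurable_sum borel_measurable_times F) auto

lemma signal_entry_measurable:
  "a < n \<Longrightarrow> j \<in> S \<Longrightarrow> (\<lambda>\<omega>. F \<omega> (a, j)) \<in> borel_measurable N"
  using S by (intro F) auto

lemma response_measurable:
  "S' \<subseteq> S \<Longrightarrow> a < n \<Longrightarrow> (\<lambda>\<omega>. response S' m (F \<omega>) (H \<omega>) a) \<in> borel_measurable N"
  unfolding response_def using S by (intro borel_measurable_add borel_measurable_times borel_measurable_sum F H) auto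

lemma response_measurable':
  "a < n \<Longrightarrow> (\<lambda>\<omega>. response (S - {i}) m (F \<omega>) (H \<omega>) a) \<in> borel_measurable N"
  "a < n \<Longrightarrow> (\<lambda>\<omega>. response S m (F \<omega>) (H \<omega>) a) \<in> borel_measurable N"
  by (auto intro: response_measurable)

lemma l2norm_measurable:
  "(\<And>a. a < n \<Longrightarrow> (\<lambda>\<omega>. f \<omega> a) \<in> borel_measurable N) \<Longrightarrow> (\<lambda>\<omega>. l2norm n (f \<omega>)) \<in> borel_measurable N"
  unfolding l2norm_def
  by (intro measurable_compose[OF _ borel_measurable_sqrt] borel_measurable_sum borel_measurable_power) auto

lemma leave_out_corr_measurable:
  "i < p \<Longrightarrow> (\<lambda>\<omega>. leave_out_corr n S m (F \<omega>) (H \<omega>) i) \<in> borel_measurable N"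
  unfolding leave_out_corr_def by (intro borel_measurable_sum borel_measurable_times F response_measurable') auto

lemma strong_signal_measurable:
  "i \<in> S \<Longrightarrow> Measurable.pred N (\<lambda>\<omega>. strong_signal n S m x' (F \<omega>) (H \<omega>) i)"
proof -
  assume "i \<in> S"
  then have [measurable]: "(\<lambda>\<omega>. leave_out_corr n S m (F \<omega>) (H \<omega>) i) \<in> borel_measurable N"
    using S by (intro leave_out_corr_measurable) auto
  have [measurable]: "(\<lambda>\<omega>. l2norm n (response (S - {i}) m (F \<omega>) (H \<omega>))) \<in> borel_measurable N"
    by (intro l2norm_measurable response_measurable')
  show ?thesis unfolding strong_signal_def by measurable
qed

lemma good_columns_measurable: "Measurable.pred N (\<lambda>\<omega>. good_columns n p \<mu> s (F \<omega>))"
  unfolding good_columns_def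
proof (intro pred_intros_logic pred_intros_finite, goal_cases)
  case (2 i)
  then have [measurable]: "(\<lambda>\<omega>. gram_entry n (F \<omega>) i i) \<in> borel_measurable N"
    by (simp add: gram_entry_measurable)
  show ?case by measurable
next
  case (5 i j)
  then have [measurable]: "(\<lambda>\<omega>. gram_entry n (F \<omega>) i j) \<in> borel_measurable N"
    "(\<lambda>\<omega>. l2norm n (\<lambda>a. F \<omega> (a, j))) \<in> borel_measurable N"
    by (auto intro!: l2norm_measurable gram_entry_measurable)
  show ?case by measurable
qed auto

lemma good_correlations_measurable: "Measurable.pred N (\<lambda>\<omega>. good_correlations n p S m s (F \<omega>) (H \<omega>))"
  unfolding good_correlations_def
proof (intro pred_intros_finite)
  fix i assume "i \<in> {..<p}"
  then have [measurable]: "(\<lambda>\<omega>. leave_out_corr n S m (F \<omega>) (H \<omega>) i) \<in> borel_measurable N"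
    "(\<lambda>\<omega>. l2norm n (response (S - {i}) m (F \<omega>) (H \<omega>))) \<in> borel_measurable N"
    by (auto intro!: l2norm_measurable leave_out_corr_measurable response_measurable')
  show "Measurable.pred N (\<lambda>\<omega>. \<bar>leave_out_corr n S m (F \<omega>) (H \<omega>) i\<bar>
      \<le> s * (1 / sqrt n * l2norm n (response (S - {i}) m (F \<omega>) (H \<omega>))))"
    by measurable
qed simp

lemma good_signal_sum_measurable: "Measurable.pred N (\<lambda>\<omega>. good_signal_sum n S \<mu> s (F \<omega>) (H \<omega>))"
proof -
  note signal_entry_measurable [measurable]
  show ?thesis unfolding good_signal_sum_def by measurable
qed

lemma good_noise_measurable: "Measurable.pred N (\<lambda>\<omega>. good_noise n p S m x (F \<omega>) (H \<omega>))"
proof -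
  note response_measurable' [measurable]
  have [measurable]: "(\<lambda>\<omega>. l2norm n (response S m (F \<omega>) (H \<omega>))) \<in> borel_measurable N"
    by (intro l2norm_measurable response_measurable')
  have "Measurable.pred N (\<lambda>\<omega>. \<exists>j\<in>{..<p} - S. x * (1 / sqrt n * l2norm n (response S m (F \<omega>) (H \<omega>)))
      < (\<Sum>a<n. response S m (F \<omega>) (H \<omega>) a * F \<omega> (a, j)))"
  proof (intro pred_intros_finite)
    fix j assume "j \<in> {..<p} - S"
    then have [measurable]: "(\<lambda>\<omega>. F \<omega> (a, j)) \<in> borel_measurable N" if "a < n" for a
      using that by (intro F) auto
    show "Measurable.pred N (\<lambda>\<omega>. x * (1 / sqrt n * l2norm n (response S m (F \<omega>) (H \<omega>)))
      < (\<Sum>a<n. response S m (F \<omega>) (H \<omega>) a * F \<omega> (a, j)))"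
      by measurable
  qed simp
  then show ?thesis unfolding good_noise_def by measurable
qed

lemma good_count_measurable: "Measurable.pred N (\<lambda>\<omega>. good_count n S m x' t (F \<omega>) (H \<omega>))"
proof -
  note strong_signal_measurable [measurable]
  have fin: "finite S" using S finite_subset by blast
  then have "real (card {i \<in> S. Q i}) = (\<Sum>i\<in>S. if Q i then 1 else 0)" for Q
    by (simp add: sum.If_cases Int_def)
  then show ?thesis
    unfolding good_count_def by measurable
qed

lemma good_measurable: "Measurable.pred N (\<lambda>\<omega>. good n p S m \<mu> s x x' t (F \<omega>) (H \<omega>))"
  unfolding good_def
  by (intro pred_intros_logic good_columns_measurable good_correlations_measurable
      good_signal_sum_measurable good_noise_measurable good_count_measurable)

end

lemma response_cong:
  "(\<And>j. j \<in> S \<Longrightarrow> \<xi> (a, j) = \<xi>' (a, j)) \<Longrightarrow> \<zeta> a = \<zeta>' a \<Longrightarrow> response S m \<xi> \<zeta> a = response S m \<xi>' \<zeta>' a"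
  by (simp add: response_def)

section \<open>Probability of the good event for a fixed noise vector\<close>

locale gaussian_design = prob_space M for M :: "'a measure" +
  fixes n p :: nat and U :: "nat \<times> nat \<Rightarrow> 'a \<Rightarrow> real" and S :: "nat set"
  assumes n_pos: "0 < n"
    and ind: "indep_vars (\<lambda>_. borel) U ({..<n} \<times> {..<p})"
    and normal: "\<And>i. i \<in> {..<n} \<times> {..<p} \<Longrightarrow> distributed M lborel (U i) (normal_density 0 (1 / sqrt n))"
    and S_sub: "S \<subseteq> {..<p}" and S_ne: "S \<noteq> {}"
begin

abbreviation \<xi> where "\<xi> \<omega> i \<equiv> U i \<omega>"

lemma tau_pos: "0 < 1 / sqrt n" using n_pos by simp

lemma U_measurable [measurable]: "a < n \<Longrightarrow> j < p \<Longrightarrow> U (a, j) \<in> borel_measurable M"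
proof -
  assume "a < n" "j < p"
  then have "(a, j) \<in> {..<n} \<times> {..<p}" by blast
  then have "distributed M lborel (U (a, j)) (normal_density 0 (1 / sqrt n))" by (rule normal)
  from distributed_measurable[OF this] have "U (a, j) \<in> measurable M lborel" .
  then show ?thesis unfolding measurable_lborel1 .
qed

lemma S_fin: "finite S" using S_sub finite_subset by blast

lemma cardS_pos: "0 < card S" using S_fin S_ne by (simp add: card_gt_0_iff)

lemma S_measurable [measurable]: "a < n \<Longrightarrow> j \<in> S \<Longrightarrow> U (a, j) \<in> borel_measurable M"
  using S_sub by (intro U_measurable) auto

lemma sum_column: "(\<Sum>k\<in>{..<n} \<times> {j}. f k) = (\<Sum>a<n. f (a, j))" for f :: "nat \<times> nat \<Rightarrow> real"
  by (rule sum.reindex_bij_witness[of _ "\<lambda>a. (a, j)" fst]) auto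

lemma sum_row: "(\<Sum>k\<in>{a} \<times> S. f k) = (\<Sum>j\<in>S. f (a, j))" for f :: "nat \<times> nat \<Rightarrow> real"
  by (rule sum.reindex_bij_witness[of _ "\<lambda>j. (a, j)" snd]) auto

lemma indep_block: "A \<subseteq> {..<n} \<Longrightarrow> J \<subseteq> {..<p} \<Longrightarrow> indep_vars (\<lambda>_. borel) U (A \<times> J)"
  by (rule indep_vars_subset[OF ind]) auto

lemma diag_entry_tail:
  assumes i: "i < p" and \<mu>: "0 < \<mu>" "\<mu> \<le> 1"
  shows "prob {\<omega> \<in> space M. \<mu> < \<bar>gram_entry n (\<xi> \<omega>) i i - 1\<bar>} \<le> 2 * exp (- real n * \<mu>\<^sup>2 / 16)"
proof -
  define Z where "Z a \<omega> = U (a, i) \<omega> / (1 / sqrt n)" for a \<omega>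
  have D: "distributed M lborel (Z a) std_normal_density" if "a \<in> {..<n}" for a
    using normal[of "(a, i)"] that i normal_standard_normal_convert[OF tau_pos, of "U (a, i)" 0]
    unfolding Z_def[abs_def] by simp
  have iZ: "indep_vars (\<lambda>_. borel) Z {..<n}"
  proof -
    have "indep_vars (\<lambda>_. borel) (\<lambda>a \<omega>. (\<lambda>f. f (a, i) / (1 / sqrt n)) (\<lambda>k\<in>{a} \<times> {i}. U k \<omega>)) {..<n}"
    proof (rule indep_vars_compose2[where Y = "\<lambda>a f. f (a, i) / (1 / sqrt n)" and M' = "\<lambda>a. PiM ({a} \<times> {i}) (\<lambda>_. borel)"])
      show "indep_vars (\<lambda>a. PiM ({a} \<times> {i}) (\<lambda>_. borel)) (\<lambda>a \<omega>. \<lambda>k\<in>{a} \<times> {i}. U k \<omega>) {..<n}"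
        by (rule indep_vars_restrict[OF ind]) (use i in \<open>auto simp: disjoint_family_on_def\<close>)
      fix a assume "a \<in> {..<n}"
      have [measurable]: "(\<lambda>f. f (a, i)) \<in> borel_measurable (PiM ({a} \<times> {i}) (\<lambda>_. borel))"
        by (rule measurable_component_singleton) simp
      show "(\<lambda>f. f (a, i) / (1 / sqrt n)) \<in> borel_measurable (PiM ({a} \<times> {i}) (\<lambda>_. borel))"
        by measurable
    qed
    then show ?thesis unfolding Z_def[abs_def] by simp
  qed
  have "(\<Sum>a<n. (Z a \<omega>)\<^sup>2) = n * gram_entry n (\<xi> \<omega>) i i" for \<omega>
    by (simp add: Z_def gram_entry_def power_mult_distrib sum_distrib_left power2_eq_square mult_ac)
      (simp add: mult.assoc[symmetric] sum_distrib_left)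
  then have "(\<mu> < \<bar>gram_entry n (\<xi> \<omega>) i i - 1\<bar>) = (\<mu> * n < \<bar>(\<Sum>a<n. (Z a \<omega>)\<^sup>2) - n\<bar>)" for \<omega>
  proof -
    assume *: "\<And>\<omega>. (\<Sum>a<n. (Z a \<omega>)\<^sup>2) = n * gram_entry n (\<xi> \<omega>) i i"
    have "(\<Sum>a<n. (Z a \<omega>)\<^sup>2) - n = n * (gram_entry n (\<xi> \<omega>) i i - 1)" unfolding * by (simp add: right_diff_distrib)
    then show ?thesis using n_pos by (simp add: abs_mult mult.commute)
  qed
  moreover have "prob {\<omega> \<in> space M. \<mu> * card {..<n} < \<bar>(\<Sum>a<n. (Z a \<omega>)\<^sup>2) - card {..<n}\<bar>}
      \<le> 2 * exp (- real (card {..<n}) * \<mu>\<^sup>2 / 16)"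
    by (rule chi_square_concentration) (use iZ D \<mu> in auto)
  ultimately show ?thesis by simp
qed

lemma off_diag_entry_tail:
  assumes ij: "i < p" "j < p" "i \<noteq> j" and s: "0 \<le> s"
  shows "prob {\<omega> \<in> space M. s * (1 / sqrt n * l2norm n (\<lambda>a. \<xi> \<omega> (a, j))) < \<bar>gram_entry n (\<xi> \<omega>) i j\<bar>} \<le> 2 * exp (- s\<^sup>2 / 2)"
proof -
  have re1: "(\<Sum>a<n. ((\<lambda>k\<in>{..<n} \<times> {j}. U k \<omega>) (fst (a, i), j))\<^sup>2) = (\<Sum>a<n. (\<xi> \<omega> (a, j))\<^sup>2)" for \<omega>
    by (intro sum.cong) auto
  have re2: "(\<Sum>a<n. (\<lambda>k\<in>{..<n} \<times> {j}. U k \<omega>) (fst (a, i), j) * U (a, i) \<omega>) = gram_entry n (\<xi> \<omega>) i j" for \<omega>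
    unfolding gram_entry_def by (intro sum.cong) auto
  have "prob {\<omega> \<in> space M. s * (1 / sqrt n * sqrt (\<Sum>k\<in>{..<n} \<times> {i}. ((\<lambda>k\<in>{..<n} \<times> {j}. U k \<omega>) (fst k, j))\<^sup>2))
      < \<bar>\<Sum>k\<in>{..<n} \<times> {i}. (\<lambda>k\<in>{..<n} \<times> {j}. U k \<omega>) (fst k, j) * U k \<omega>\<bar>} \<le> 2 * exp (- s\<^sup>2 / 2)"
  proof (rule projection_tail[where w = "\<lambda>v k. v (fst k, j)" and V = "\<lambda>\<omega>. \<lambda>k\<in>{..<n} \<times> {j}. U k \<omega>"
        and MV = "PiM ({..<n} \<times> {j}) (\<lambda>_. borel)"])
    show "indep_vars (\<lambda>_. borel) U ({..<n} \<times> {i})" by (rule indep_block) (use ij in auto)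
    show "indep_var (PiM ({..<n} \<times> {i}) (\<lambda>_. borel)) (\<lambda>\<omega>. \<lambda>k\<in>{..<n} \<times> {i}. U k \<omega>)
        (PiM ({..<n} \<times> {j}) (\<lambda>_. borel)) (\<lambda>\<omega>. \<lambda>k\<in>{..<n} \<times> {j}. U k \<omega>)"
      by (rule indep_var_restrict[OF ind]) (use ij in auto)
    fix k assume "k \<in> {..<n} \<times> {i}"
    then show "(\<lambda>v. v (fst k, j)) \<in> borel_measurable (PiM ({..<n} \<times> {j}) (\<lambda>_. borel))"
      by (intro measurable_component_singleton) auto
  qed (use tau_pos normal ij s in auto)
  then show ?thesis
    unfolding sum_column re1 re2 l2norm_def by simp
qed

lemma leave_out_tail:
  assumes i: "i < p" and s: "0 \<le> s"
  shows "prob {\<omega> \<in> space M. s * (1 / sqrt n * l2norm n (response (S - {i}) m (\<xi> \<omega>) \<zeta>)) < \<bar>leave_out_corr n S m (\<xi> \<omega>) \<zeta> i\<bar>}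
    \<le> 2 * exp (- s\<^sup>2 / 2)"
proof -
  let ?J = "{..<n} \<times> ({..<p} - {i})"
  have re: "response (S - {i}) m (\<lambda>k\<in>?J. U k \<omega>) \<zeta> a = response (S - {i}) m (\<xi> \<omega>) \<zeta> a" if "a < n" for a \<omega>
    using S_sub that by (intro response_cong) auto
  have re1: "(\<Sum>a<n. (response (S - {i}) m (\<lambda>k\<in>?J. U k \<omega>) \<zeta> (fst (a, i)))\<^sup>2) = (\<Sum>a<n. (response (S - {i}) m (\<xi> \<omega>) \<zeta> a)\<^sup>2)" for \<omega>
    by (intro sum.cong) (auto simp: re)
  have re2: "(\<Sum>a<n. response (S - {i}) m (\<lambda>k\<in>?J. U k \<omega>) \<zeta> (fst (a, i)) * U (a, i) \<omega>) = leave_out_corr n S m (\<xi> \<omega>) \<zeta> i" for \<omega>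
    unfolding leave_out_corr_def by (intro sum.cong) (auto simp: re)
  have "prob {\<omega> \<in> space M. s * (1 / sqrt n * sqrt (\<Sum>k\<in>{..<n} \<times> {i}. (response (S - {i}) m (\<lambda>k\<in>?J. U k \<omega>) \<zeta> (fst k))\<^sup>2))
      < \<bar>\<Sum>k\<in>{..<n} \<times> {i}. response (S - {i}) m (\<lambda>k\<in>?J. U k \<omega>) \<zeta> (fst k) * U k \<omega>\<bar>} \<le> 2 * exp (- s\<^sup>2 / 2)"
  proof (rule projection_tail[where w = "\<lambda>v k. response (S - {i}) m v \<zeta> (fst k)" and V = "\<lambda>\<omega>. \<lambda>k\<in>?J. U k \<omega>"
        and MV = "PiM ?J (\<lambda>_. borel)"])
    show "indep_vars (\<lambda>_. borel) U ({..<n} \<times> {i})" by (rule indep_block) (use i in auto)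
    show "indep_var (PiM ({..<n} \<times> {i}) (\<lambda>_. borel)) (\<lambda>\<omega>. \<lambda>k\<in>{..<n} \<times> {i}. U k \<omega>)
        (PiM ?J (\<lambda>_. borel)) (\<lambda>\<omega>. \<lambda>k\<in>?J. U k \<omega>)"
      by (rule indep_var_restrict[OF ind]) (use i in auto)
    fix k assume k: "k \<in> {..<n} \<times> {i}"
    have "(\<lambda>v. v (fst k, j)) \<in> borel_measurable (PiM ?J (\<lambda>_. borel))" if "j \<in> S - {i}" for j
      using k that S_sub by (intro measurable_component_singleton) auto
    then show "(\<lambda>v. response (S - {i}) m v \<zeta> (fst k)) \<in> borel_measurable (PiM ?J (\<lambda>_. borel))"
      unfolding response_def by (intro borel_measurable_add borel_measurable_times borel_measurable_sum) auto
  qed (use tau_pos normal i s in auto)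
  then show ?thesis
    unfolding sum_column re1 re2 l2norm_def by simp
qed

lemma noise_product_tail:
  fixes \<zeta> :: "nat \<Rightarrow> real"
  assumes s: "0 \<le> s"
  shows "prob {\<omega> \<in> space M. s * (1 / sqrt n * sqrt (card S * (\<Sum>a<n. (\<zeta> a)\<^sup>2))) < \<bar>\<Sum>a<n. \<Sum>j\<in>S. \<zeta> a * \<xi> \<omega> (a, j)\<bar>}
    \<le> 2 * exp (- s\<^sup>2 / 2)"
proof -
  have "prob {\<omega> \<in> space M. s * (1 / sqrt n * sqrt (\<Sum>k\<in>{..<n} \<times> S. (\<zeta> (fst k))\<^sup>2)) < \<bar>\<Sum>k\<in>{..<n} \<times> S. \<zeta> (fst k) * U k \<omega>\<bar>}
      \<le> 2 * exp (- s\<^sup>2 / 2)"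
    by (rule projection_tail_fixed[of "{..<n} \<times> S" U "1 / sqrt n" s "\<lambda>k. \<zeta> (fst k)"])
      (use S_fin indep_block[of "{..<n}" S] S_sub tau_pos normal s in auto)
  moreover have "(\<Sum>k\<in>{..<n} \<times> S. (\<zeta> (fst k))\<^sup>2) = card S * (\<Sum>a<n. (\<zeta> a)\<^sup>2)"
    by (simp add: sum.cartesian_product' sum_distrib_left)
  moreover have "(\<Sum>k\<in>{..<n} \<times> S. \<zeta> (fst k) * U k \<omega>) = (\<Sum>a<n. \<Sum>j\<in>S. \<zeta> a * \<xi> \<omega> (a, j))" for \<omega>
    by (subst sum.cartesian_product') simp
  ultimately show ?thesis by simp
qed

text \<open>The row sums of the signal columns are independent across rows and normal with variance \<open>k / n\<close>.\<close>

lemma signal_sum_tail: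
  fixes \<mu> :: real
  assumes \<mu>: "0 < \<mu>" "\<mu> \<le> 1"
  shows "prob {\<omega> \<in> space M. \<mu> * card S < \<bar>(\<Sum>a<n. (\<Sum>j\<in>S. \<xi> \<omega> (a, j))\<^sup>2) - card S\<bar>} \<le> 2 * exp (- real n * \<mu>\<^sup>2 / 16)"
proof -
  define c where "c = 1 / sqrt n * sqrt (card S)"
  have c: "0 < c" "c\<^sup>2 = card S / n" using n_pos cardS_pos by (auto simp: c_def power_mult_distrib power_divide)
  define Z where "Z a \<omega> = (\<Sum>j\<in>S. U (a, j) \<omega>) / c" for a \<omega>
  have D: "distributed M lborel (Z a) std_normal_density" if a: "a \<in> {..<n}" for a
  proof -
    have ind': "indep_vars (\<lambda>_. borel) U ({a} \<times> S)" by (rule indep_block) (use a S_sub in auto)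
    have nor: "distributed M lborel (U i) (normal_density 0 (1 / sqrt n))" if "i \<in> {a} \<times> S" for i
      using that normal a S_sub by auto
    have pos: "0 < (\<Sum>i\<in>{a} \<times> S. (1::real)\<^sup>2)" using cardS_pos by (simp add: card_cartesian_product_singleton)
    show ?thesis
      using standard_normal_projection[OF _ ind' tau_pos nor pos] S_fin
      unfolding Z_def[abs_def] c_def sum_row by simp
  qed
  have iZ: "indep_vars (\<lambda>_. borel) Z {..<n}"
  proof -
    have "indep_vars (\<lambda>_. borel) (\<lambda>a \<omega>. (\<lambda>f. (\<Sum>j\<in>S. f (a, j)) / c) (\<lambda>k\<in>{a} \<times> S. U k \<omega>)) {..<n}"
    proof (rule indep_vars_compose2[where Y = "\<lambda>a f. (\<Sum>j\<in>S. f (a, j)) / c" and M' = "\<lambda>a. PiM ({a} \<times> S) (\<lambda>_. borel)"])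
      show "indep_vars (\<lambda>a. PiM ({a} \<times> S) (\<lambda>_. borel)) (\<lambda>a \<omega>. \<lambda>k\<in>{a} \<times> S. U k \<omega>) {..<n}"
        by (rule indep_vars_restrict[OF ind]) (use S_sub in \<open>auto simp: disjoint_family_on_def\<close>)
      fix a assume "a \<in> {..<n}"
      have [measurable]: "(\<lambda>f. f (a, j)) \<in> borel_measurable (PiM ({a} \<times> S) (\<lambda>_. borel))" if "j \<in> S" for j
        by (rule measurable_component_singleton) (use that in simp)
      show "(\<lambda>f. (\<Sum>j\<in>S. f (a, j)) / c) \<in> borel_measurable (PiM ({a} \<times> S) (\<lambda>_. borel))"
        by measurable
    qed
    then show ?thesis unfolding Z_def[abs_def] by (simp cong: sum.cong)
  qed
  have *: "(\<Sum>a<n. (Z a \<omega>)\<^sup>2) = n / card S * (\<Sum>a<n. (\<Sum>j\<in>S. \<xi> \<omega> (a, j))\<^sup>2)" for \<omega>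
    using c by (simp add: Z_def power_divide sum_distrib_left mult.commute)
  have "(\<mu> * card S < \<bar>(\<Sum>a<n. (\<Sum>j\<in>S. \<xi> \<omega> (a, j))\<^sup>2) - card S\<bar>) = (\<mu> * n < \<bar>(\<Sum>a<n. (Z a \<omega>)\<^sup>2) - n\<bar>)" for \<omega>
  proof -
    have "(\<Sum>a<n. (Z a \<omega>)\<^sup>2) - n = n / card S * ((\<Sum>a<n. (\<Sum>j\<in>S. \<xi> \<omega> (a, j))\<^sup>2) - card S)"
      unfolding * using cardS_pos by (simp add: right_diff_distrib)
    then have "\<bar>(\<Sum>a<n. (Z a \<omega>)\<^sup>2) - n\<bar> = n / card S * \<bar>(\<Sum>a<n. (\<Sum>j\<in>S. \<xi> \<omega> (a, j))\<^sup>2) - card S\<bar>"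
      by (simp add: abs_mult)
    moreover have "n / card S * (\<mu> * card S) = \<mu> * n" using cardS_pos by simp
    moreover have "0 < real n / card S" using n_pos cardS_pos by simp
    ultimately show ?thesis by (metis mult_less_cancel_left_pos)
  qed
  moreover have "prob {\<omega> \<in> space M. \<mu> * card {..<n} < \<bar>(\<Sum>a<n. (Z a \<omega>)\<^sup>2) - card {..<n}\<bar>}
      \<le> 2 * exp (- real (card {..<n}) * \<mu>\<^sup>2 / 16)"
    by (rule chi_square_concentration) (use iZ D \<mu> in auto)
  ultimately show ?thesis by simp
qed

text \<open>The response depends on the signal columns only, once \<open>\<zeta>\<close> is fixed, and is hence independent of the noise
columns.\<close>

lemma noise_max_tail:
  assumes x: "0 \<le> x" "0 \<le> h"
  shows "prob {\<omega> \<in> space M. \<not> good_noise n p S m x (\<xi> \<omega>) \<zeta>} \<le> (1 - h * std_normal_density (x + h)) ^ (p - card S)"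
proof -
  let ?N = "{..<p} - S"
  let ?V = "\<lambda>\<omega>. \<lambda>k\<in>{..<n} \<times> S. U k \<omega>"
  have re: "response S m (?V \<omega>) \<zeta> a = response S m (\<xi> \<omega>) \<zeta> a" if "a < n" for a \<omega>
    using that by (intro response_cong) auto
  have re1: "(\<Sum>a\<in>{..<n}. (response S m (?V \<omega>) \<zeta> a)\<^sup>2) = (\<Sum>a<n. (response S m (\<xi> \<omega>) \<zeta> a)\<^sup>2)" for \<omega>
    by (intro sum.cong) (auto simp: re)
  have re2: "(\<Sum>a\<in>{..<n}. response S m (?V \<omega>) \<zeta> a * U (a, j) \<omega>) = (\<Sum>a<n. response S m (\<xi> \<omega>) \<zeta> a * U (a, j) \<omega>)" for \<omega> j
    by (intro sum.cong) (auto simp: re)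
  have "prob {\<omega> \<in> space M. 0 < (\<Sum>a\<in>{..<n}. (response S m (?V \<omega>) \<zeta> a)\<^sup>2) \<and>
      (\<forall>j\<in>?N. (\<Sum>a\<in>{..<n}. response S m (?V \<omega>) \<zeta> a * U (a, j) \<omega>)
         \<le> x * (1 / sqrt n * sqrt (\<Sum>a\<in>{..<n}. (response S m (?V \<omega>) \<zeta> a)\<^sup>2)))}
    \<le> (1 - h * std_normal_density (x + h)) ^ card ?N"
  proof (rule all_projections_small[where w = "\<lambda>v. response S m v \<zeta>" and V = ?V and MV = "PiM ({..<n} \<times> S) (\<lambda>_. borel)"])
    show "indep_vars (\<lambda>_. borel) U ({..<n} \<times> ?N)" by (rule indep_block) auto
    show "indep_var (PiM ({..<n} \<times> ?N) (\<lambda>_. borel)) (\<lambda>\<omega>. \<lambda>k\<in>{..<n} \<times> ?N. U k \<omega>)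
        (PiM ({..<n} \<times> S) (\<lambda>_. borel)) ?V"
      by (rule indep_var_restrict[OF ind]) (use S_sub in auto)
    fix a assume a: "a \<in> {..<n}"
    have "(\<lambda>v. v (a, j)) \<in> borel_measurable (PiM ({..<n} \<times> S) (\<lambda>_. borel))" if "j \<in> S" for j
      using a that by (intro measurable_component_singleton) auto
    then show "(\<lambda>v. response S m v \<zeta> a) \<in> borel_measurable (PiM ({..<n} \<times> S) (\<lambda>_. borel))"
      unfolding response_def by (intro borel_measurable_add borel_measurable_times borel_measurable_sum) auto
  qed (use tau_pos normal x in auto)
  also have "card ?N = p - card S" using S_sub by (simp add: card_Diff_subset S_fin)
  finally show ?thesis
    unfolding re1 re2 by (simp add: good_noise_def l2norm_def not_less)
qed

lemma U_zeta_measurable: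
  "a < n \<Longrightarrow> j < p \<Longrightarrow> (\<lambda>\<omega>. \<xi> \<omega> (a, j)) \<in> borel_measurable M"
  "a < n \<Longrightarrow> (\<lambda>\<omega>. \<zeta> a) \<in> borel_measurable M" for \<zeta> :: "nat \<Rightarrow> real"
  by simp_all

lemma prob_not_good_columns:
  assumes \<mu>: "0 < \<mu>" "\<mu> \<le> 1" and s: "0 \<le> s"
  shows "prob {\<omega> \<in> space M. \<not> good_columns n p \<mu> s (\<xi> \<omega>)}
    \<le> real p * (2 * exp (- real n * \<mu>\<^sup>2 / 16)) + (real p)\<^sup>2 * (2 * exp (- s\<^sup>2 / 2))"
proof -
  note ms = U_zeta_measurable S_sub
  define A where "A i = {\<omega> \<in> space M. \<mu> < \<bar>gram_entry n (\<xi> \<omega>) i i - 1\<bar>}" for i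
  define B where "B ij = {\<omega> \<in> space M. s * (1 / sqrt n * l2norm n (\<lambda>a. \<xi> \<omega> (a, snd ij)))
      < \<bar>gram_entry n (\<xi> \<omega>) (fst ij) (snd ij)\<bar>}" for ij
  define K where "K = {ij \<in> {..<p} \<times> {..<p}. fst ij \<noteq> snd ij}"
  have [measurable]: "(\<lambda>\<omega>. gram_entry n (\<xi> \<omega>) i j) \<in> borel_measurable M" if "i < p" "j < p" for i j
    by (rule gram_entry_measurable[where F = \<xi> and S = S and p = p and H = "\<lambda>_ _. 0"]) (use that ms in auto)
  have [measurable]: "(\<lambda>\<omega>. l2norm n (\<lambda>a. \<xi> \<omega> (a, j))) \<in> borel_measurable M" if "j < p" for j
    unfolding l2norm_def using that by measurable
  have A: "A i \<in> events" if "i < p" for i unfolding A_def using that by measurable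
  have B: "B ij \<in> events" if "ij \<in> K" for ij unfolding B_def using that unfolding K_def by auto
  have K: "finite K" "card K \<le> p\<^sup>2"
  proof -
    show "finite K" unfolding K_def by auto
    have "card K \<le> card ({..<p} \<times> {..<p})" unfolding K_def by (intro card_mono) auto
    then show "card K \<le> p\<^sup>2" by (simp add: card_cartesian_product power2_eq_square)
  qed
  have "{\<omega> \<in> space M. \<not> good_columns n p \<mu> s (\<xi> \<omega>)} \<subseteq> (\<Union>i\<in>{..<p}. A i) \<union> (\<Union>ij\<in>K. B ij)"
    unfolding good_columns_def A_def B_def K_def by (auto simp: not_le)
  then have "prob {\<omega> \<in> space M. \<not> good_columns n p \<mu> s (\<xi> \<omega>)} \<le> prob ((\<Union>i\<in>{..<p}. A i) \<union> (\<Union>ij\<in>K. B ij))"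
    using A B K by (intro finite_measure_mono) auto
  also have "\<dots> \<le> prob (\<Union>i\<in>{..<p}. A i) + prob (\<Union>ij\<in>K. B ij)"
    using A B K by (intro measure_Un_le) auto
  also have "prob (\<Union>i\<in>{..<p}. A i) \<le> (\<Sum>i\<in>{..<p}. prob (A i))"
    using A by (intro finite_measure_subadditive_finite) auto
  also have "\<dots> \<le> (\<Sum>i\<in>{..<p}. 2 * exp (- real n * \<mu>\<^sup>2 / 16))"
    unfolding A_def by (intro sum_mono diag_entry_tail \<mu>) auto
  also have "prob (\<Union>ij\<in>K. B ij) \<le> (\<Sum>ij\<in>K. prob (B ij))"
    using B K by (intro finite_measure_subadditive_finite) auto
  also have "\<dots> \<le> (\<Sum>ij\<in>K. 2 * exp (- s\<^sup>2 / 2))"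
    unfolding B_def by (intro sum_mono off_diag_entry_tail s) (auto simp: K_def)
  also have "\<dots> \<le> (real p)\<^sup>2 * (2 * exp (- s\<^sup>2 / 2))"
    using K(2) by (simp add: of_nat_mono[of "card K" "p\<^sup>2", simplified])
  finally show ?thesis by simp
qed

text \<open>Union bound over the exceptional events. The last summand is Markov's inequality for the number of strong
signals.\<close>

lemma prob_not_good:
  fixes \<zeta> :: "nat \<Rightarrow> real"
  assumes \<mu>: "0 < \<mu>" "\<mu> \<le> 1" and s: "0 \<le> s" and x: "0 \<le> x" "0 \<le> h" and x': "0 \<le> x'" and t: "0 < t"
  shows "prob {\<omega> \<in> space M. \<not> good n p S m \<mu> s x x' t (\<xi> \<omega>) \<zeta>}
    \<le> (2 * real p + 2) * exp (- real n * \<mu>\<^sup>2 / 16) + (2 * (real p)\<^sup>2 + 2 * real p + 2) * exp (- s\<^sup>2 / 2)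
      + (1 - h * std_normal_density (x + h)) ^ (p - card S) + 2 * card S * exp (- x'\<^sup>2 / 2) / t"
proof -
  note ms = U_zeta_measurable S_sub
  have fin: "finite S" by (rule S_fin)
  define C where "C = {\<omega> \<in> space M. \<not> good_columns n p \<mu> s (\<xi> \<omega>)}"
  define L where "L i = {\<omega> \<in> space M. s * (1 / sqrt n * l2norm n (response (S - {i}) m (\<xi> \<omega>) \<zeta>)) < \<bar>leave_out_corr n S m (\<xi> \<omega>) \<zeta> i\<bar>}" for i
  define A1 where "A1 = {\<omega> \<in> space M. s * (1 / sqrt n * sqrt (card S * (\<Sum>a<n. (\<zeta> a)\<^sup>2))) < \<bar>\<Sum>a<n. \<Sum>j\<in>S. \<zeta> a * \<xi> \<omega> (a, j)\<bar>}"
  define A2 where "A2 = {\<omega> \<in> space M. \<mu> * card S < \<bar>(\<Sum>a<n. (\<Sum>j\<in>S. \<xi> \<omega> (a, j))\<^sup>2) - card S\<bar>}"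
  define Nz where "Nz = {\<omega> \<in> space M. \<not> good_noise n p S m x (\<xi> \<omega>) \<zeta>}"
  define Ct where "Ct = {\<omega> \<in> space M. t \<le> real (card {i \<in> S. strong_signal n S m x' (\<xi> \<omega>) \<zeta> i})}"
  have C: "C \<in> events"
  proof -
    have "Measurable.pred M (\<lambda>\<omega>. good_columns n p \<mu> s (\<xi> \<omega>))"
      by (rule good_columns_measurable[where H = "\<lambda>_. \<zeta>" and S = S]) (use ms in auto)
    then show ?thesis unfolding C_def by simp
  qed
  have Nz: "Nz \<in> events"
  proof -
    have "Measurable.pred M (\<lambda>\<omega>. good_noise n p S m x (\<xi> \<omega>) \<zeta>)"
      by (rule good_noise_measurable[where H = "\<lambda>_. \<zeta>"]) (use ms in auto)
    then show ?thesis unfolding Nz_def by simp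
  qed
  have Ct: "Ct \<in> events"
  proof -
    have "Measurable.pred M (\<lambda>\<omega>. good_count n S m x' t (\<xi> \<omega>) \<zeta>)"
      by (rule good_count_measurable[where H = "\<lambda>_. \<zeta>" and p = p]) (use ms in auto)
    then have "Measurable.pred M (\<lambda>\<omega>. \<not> good_count n S m x' t (\<xi> \<omega>) \<zeta>)" by measurable
    then show ?thesis unfolding Ct_def good_count_def by (simp add: not_less)
  qed
  have L: "L i \<in> events" if "i < p" for i
  proof -
    have [measurable]: "(\<lambda>\<omega>. leave_out_corr n S m (\<xi> \<omega>) \<zeta> i) \<in> borel_measurable M"
      by (rule leave_out_corr_measurable[where H = "\<lambda>_. \<zeta>" and p = p]) (use ms that in auto)
    have [measurable]: "(\<lambda>\<omega>. l2norm n (response (S - {i}) m (\<xi> \<omega>) \<zeta>)) \<in> borel_measurable M"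
      unfolding l2norm_def response_def by measurable
    show ?thesis unfolding L_def by measurable
  qed
  have A: "A1 \<in> events" "A2 \<in> events" unfolding A1_def A2_def by measurable
  have pC: "prob C \<le> real p * (2 * exp (- real n * \<mu>\<^sup>2 / 16)) + (real p)\<^sup>2 * (2 * exp (- s\<^sup>2 / 2))"
    unfolding C_def by (rule prob_not_good_columns[OF \<mu> s])
  have pL: "prob (\<Union>i\<in>{..<p}. L i) \<le> real p * (2 * exp (- s\<^sup>2 / 2))"
  proof -
    have "prob (\<Union>i\<in>{..<p}. L i) \<le> (\<Sum>i\<in>{..<p}. prob (L i))"
      using L by (intro finite_measure_subadditive_finite) auto
    also have "\<dots> \<le> (\<Sum>i\<in>{..<p}. 2 * exp (- s\<^sup>2 / 2))"
      unfolding L_def by (intro sum_mono leave_out_tail s) auto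
    finally show ?thesis by simp
  qed
  have pA: "prob A1 \<le> 2 * exp (- s\<^sup>2 / 2)" "prob A2 \<le> 2 * exp (- real n * \<mu>\<^sup>2 / 16)"
    unfolding A1_def A2_def by (rule noise_product_tail[OF s], rule signal_sum_tail[OF \<mu>])
  have pN: "prob Nz \<le> (1 - h * std_normal_density (x + h)) ^ (p - card S)"
    unfolding Nz_def by (rule noise_max_tail[OF x])
  have pCt: "prob Ct \<le> card S * (2 * exp (- x'\<^sup>2 / 2)) / t"
    unfolding Ct_def
  proof (rule markov_count[OF fin _ _ t])
    fix i assume i: "i \<in> S"
    then have "i < p" using S_sub by auto
    show "{\<omega> \<in> space M. strong_signal n S m x' (\<xi> \<omega>) \<zeta> i} \<in> events"
    proof -
      have "Measurable.pred M (\<lambda>\<omega>. strong_signal n S m x' (\<xi> \<omega>) \<zeta> i)"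
        by (rule strong_signal_measurable[where H = "\<lambda>_. \<zeta>" and p = p]) (use ms i in auto)
      then show ?thesis by simp
    qed
    show "prob {\<omega> \<in> space M. strong_signal n S m x' (\<xi> \<omega>) \<zeta> i} \<le> 2 * exp (- x'\<^sup>2 / 2)"
      unfolding strong_signal_def by (rule leave_out_tail[OF \<open>i < p\<close> x'])
  qed
  have "{\<omega> \<in> space M. \<not> good n p S m \<mu> s x x' t (\<xi> \<omega>) \<zeta>} \<subseteq> C \<union> ((\<Union>i\<in>{..<p}. L i) \<union> (A1 \<union> (A2 \<union> (Nz \<union> Ct))))"
    unfolding good_def C_def L_def A1_def A2_def Nz_def Ct_def good_correlations_def good_signal_sum_def good_count_def
    by (auto simp: not_le not_less)
  then have "prob {\<omega> \<in> space M. \<not> good n p S m \<mu> s x x' t (\<xi> \<omega>) \<zeta>} \<le> prob (C \<union> ((\<Union>i\<in>{..<p}. L i) \<union> (A1 \<union> (A2 \<union> (Nz \<union> Ct)))))"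
    using C L A Nz Ct by (intro finite_measure_mono sets.Un sets.finite_UN) auto
  also have "\<dots> \<le> prob C + (prob (\<Union>i\<in>{..<p}. L i) + (prob A1 + (prob A2 + (prob Nz + prob Ct))))"
    using C L A Nz Ct by (intro order_trans[OF measure_Un_le] add_left_mono order_refl sets.Un sets.finite_UN) auto
  finally show ?thesis using pC pL pA pN pCt by (simp add: algebra_simps)
qed

end

section \<open>The rank on the good event\<close>

lemma l2norm_triangle: "l2norm n (\<lambda>a. f a + g a) \<le> l2norm n f + l2norm n g"
  using L2_set_triangle_ineq[of f g "{..<n}"] by (simp add: l2norm_def L2_set_def)

lemma l2norm_scale: "l2norm n (\<lambda>a. r * f a) = \<bar>r\<bar> * l2norm n f"
  by (simp add: l2norm_def power_mult_distrib sum_distrib_left[symmetric] real_sqrt_mult)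

lemma l2norm_nonneg: "0 \<le> l2norm n f"
  by (simp add: l2norm_def sum_nonneg)

text \<open>The numerical conditions under which the good event controls the rank. \<open>A\<close> bounds \<open>|m| / \<rho>\<close>, \<open>K\<close> bounds all
scores in units of \<open>\<rho>\<close>, \<open>x\<close> is the level in units of \<open>\<rho>\<close> reached by the noise, \<open>x'\<close> the level that a signal has
to reach without its own contribution, and \<open>t\<close> bounds the number of signals that do.\<close>

locale good_model =
  fixes n p :: nat and S :: "nat set" and m \<mu> s x x' t h A K :: real
    and \<xi> :: "nat \<times> nat \<Rightarrow> real" and \<zeta> :: "nat \<Rightarrow> real"
  assumes good: "good n p S m \<mu> s x x' t \<xi> \<zeta>"
    and S_sub: "S \<subseteq> {..<p}" and S_ne: "S \<noteq> {}" and n_pos: "0 < n" and m_nz: "m \<noteq> 0"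
    and h_pos: "0 < h" and A_nonneg: "0 \<le> A" and s_nonneg: "0 \<le> s" and x'_nonneg: "0 \<le> x'" and \<mu>1: "\<mu> \<le> 1"
    and signal_size: "1 \<le> A\<^sup>2 * (card S / n * (1 - \<mu> - s\<^sup>2 / n))"
    and K: "s * (1 + 2 * A / sqrt n) + 2 * A \<le> K"
    and h_le: "h \<le> x"
    and coherence: "2 * s / sqrt n \<le> \<mu>"
    and gap: "x' * (1 + 2 * A / sqrt n) < x - h - A * (1 + \<mu>)"
    and small_coherence: "32 * (t + 1)\<^sup>2 * \<mu> * K\<^sup>2 \<le> h\<^sup>2"
begin

text \<open>Given the response, \<open>\<rho>\<close> is the standard deviation of a noise score.\<close>

definition \<rho> where "\<rho> = 1 / sqrt n * l2norm n (response S m \<xi> \<zeta>)"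
definition corr where "corr i = (\<Sum>a<n. response S m \<xi> \<zeta> a * \<xi> (a, i))"

lemma S_fin: "finite S" using S_sub finite_subset by blast

lemma mu_nonneg: "0 \<le> \<mu>"
proof -
  have "0 \<le> 2 * s / sqrt n" using s_nonneg by simp
  then show ?thesis using coherence by simp
qed

text \<open>Expanding \<open>n \<rho>\<^sup>2\<close> as the squared norm of \<open>m u + \<zeta>\<close>, where \<open>u\<close> is the sum of the signal columns, and
minimising over the norm of \<open>\<zeta>\<close> leaves at least \<open>m\<^sup>2 k (1 - \<mu> - s\<^sup>2 / n)\<close>.\<close>

lemma m_le: "\<bar>m\<bar> \<le> A * \<rho>" and rho_pos: "0 < \<rho>"
proof -
  define k where "k = real (card S)"
  define u where "u a = (\<Sum>j\<in>S. \<xi> (a, j))" for a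
  define Z where "Z = (\<Sum>a<n. (\<zeta> a)\<^sup>2)"
  define V where "V = (\<Sum>a<n. u a * \<zeta> a)"
  have Z0: "0 \<le> Z" by (simp add: Z_def sum_nonneg)
  have k0: "0 \<le> k" by (simp add: k_def)
  have V: "\<bar>V\<bar> \<le> s * (1 / sqrt n * sqrt (k * Z))"
    using good unfolding good_def good_signal_sum_def V_def u_def Z_def k_def
    by (simp add: sum_distrib_left mult.commute)
  have U: "(1 - \<mu>) * k \<le> (\<Sum>a<n. (u a)\<^sup>2)"
  proof -
    have "\<bar>(\<Sum>a<n. (u a)\<^sup>2) - k\<bar> \<le> \<mu> * k"
      using good unfolding good_def good_signal_sum_def u_def k_def by blast
    then have "k - \<mu> * k \<le> (\<Sum>a<n. (u a)\<^sup>2)" by linarith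
    then show ?thesis by (simp add: left_diff_distrib)
  qed
  have "n * \<rho>\<^sup>2 = (\<Sum>a<n. (m * u a + \<zeta> a)\<^sup>2)"
    using n_pos by (simp add: \<rho>_def l2norm_def response_def u_def power_mult_distrib power_divide sum_nonneg)
  also have "\<dots> = m\<^sup>2 * (\<Sum>a<n. (u a)\<^sup>2) + 2 * m * V + Z"
    by (simp add: power2_sum sum.distrib V_def Z_def sum_distrib_left power_mult_distrib mult_ac)
  finally have eq: "n * \<rho>\<^sup>2 = m\<^sup>2 * (\<Sum>a<n. (u a)\<^sup>2) + 2 * m * V + Z" .
  have "- (2 * m * V) \<le> 2 * (\<bar>m\<bar> * \<bar>V\<bar>)" using abs_ge_minus_self[of "2 * m * V"] by (simp add: abs_mult)
  also have "\<dots> \<le> 2 * (\<bar>m\<bar> * (s * (1 / sqrt n * sqrt (k * Z))))"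
    using V by (intro mult_left_mono) auto
  also have "\<dots> = 2 * (\<bar>m\<bar> * s * sqrt k / sqrt n) * sqrt Z" by (simp add: real_sqrt_mult)
  also have "\<dots> \<le> (\<bar>m\<bar> * s * sqrt k / sqrt n)\<^sup>2 + (sqrt Z)\<^sup>2"
    by (rule sum_squares_bound)
  also have "\<dots> = m\<^sup>2 * (s\<^sup>2 / n * k) + Z"
    using k0 Z0 by (simp add: power_mult_distrib power_divide)
  finally have "m\<^sup>2 * ((1 - \<mu>) * k) - m\<^sup>2 * (s\<^sup>2 / n * k) \<le> n * \<rho>\<^sup>2"
    using eq mult_left_mono[OF U, of "m\<^sup>2"] by simp
  then have le: "m\<^sup>2 * (k / n * (1 - \<mu> - s\<^sup>2 / n)) \<le> \<rho>\<^sup>2"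
    using n_pos by (simp add: field_simps)
  have "m\<^sup>2 * 1 \<le> m\<^sup>2 * (A\<^sup>2 * (k / n * (1 - \<mu> - s\<^sup>2 / n)))"
    using signal_size by (intro mult_left_mono) (auto simp: k_def)
  also have "\<dots> \<le> A\<^sup>2 * \<rho>\<^sup>2"
    using mult_left_mono[OF le, of "A\<^sup>2"] by (simp add: mult_ac)
  finally have sq: "m\<^sup>2 \<le> (A * \<rho>)\<^sup>2" by (simp add: power_mult_distrib)
  have r0: "0 \<le> \<rho>" by (simp add: \<rho>_def l2norm_nonneg)
  show "\<bar>m\<bar> \<le> A * \<rho>"
    using power2_le_imp_le[of "\<bar>m\<bar>" "A * \<rho>"] sq A_nonneg r0 by simp
  then have "\<rho> \<noteq> 0" using m_nz by auto
  then show "0 < \<rho>" using r0 by simp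
qed

lemma gram_diag: "i < p \<Longrightarrow> \<bar>gram_entry n \<xi> i i - 1\<bar> \<le> \<mu>"
  using good by (auto simp: good_def good_columns_def)

lemma column_norm: "i < p \<Longrightarrow> l2norm n (\<lambda>a. \<xi> (a, i)) \<le> 2"
proof -
  assume "i < p"
  then have "gram_entry n \<xi> i i \<le> 4" using gram_diag[of i] \<mu>1 by linarith
  then have "sqrt (gram_entry n \<xi> i i) \<le> sqrt 4" by (rule real_sqrt_le_mono)
  then show ?thesis by (simp add: l2norm_def gram_entry_def power2_eq_square)
qed

lemma gram_near_identity:
  assumes "i < p" "j < p"
  shows "\<bar>gram_entry n \<xi> i j - (if i = j then 1 else 0)\<bar> \<le> \<mu>"
proof (cases "i = j")
  case False
  then have "\<bar>gram_entry n \<xi> i j\<bar> \<le> s * (1 / sqrt n * l2norm n (\<lambda>a. \<xi> (a, j)))"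
    using good assms by (auto simp: good_def good_columns_def)
  also have "\<dots> \<le> s * (1 / sqrt n * 2)"
    using column_norm[OF assms(2)] s_nonneg by (intro mult_left_mono) auto
  also have "\<dots> = 2 * s / sqrt n" by simp
  also have "\<dots> \<le> \<mu>" by (rule coherence)
  finally show ?thesis using False by simp
qed (use gram_diag assms in auto)

lemma response_split:
  assumes "i \<in> S"
  shows "response S m \<xi> \<zeta> a = response (S - {i}) m \<xi> \<zeta> a + m * \<xi> (a, i)"
  using assms S_fin by (simp add: response_def sum.remove algebra_simps)

lemma leave_out_norm:
  assumes "i < p"
  shows "1 / sqrt n * l2norm n (response (S - {i}) m \<xi> \<zeta>) \<le> \<rho> * (1 + 2 * A / sqrt n)"
proof -
  have "l2norm n (response (S - {i}) m \<xi> \<zeta>) \<le> l2norm n (response S m \<xi> \<zeta>) + 2 * \<bar>m\<bar>"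
  proof (cases "i \<in> S")
    case True
    have "response (S - {i}) m \<xi> \<zeta> = (\<lambda>a. response S m \<xi> \<zeta> a + (- m) * \<xi> (a, i))"
      by (auto simp: response_split[OF True])
    then have "l2norm n (response (S - {i}) m \<xi> \<zeta>) \<le> l2norm n (response S m \<xi> \<zeta>) + l2norm n (\<lambda>a. (- m) * \<xi> (a, i))"
      using l2norm_triangle[of n "response S m \<xi> \<zeta>" "\<lambda>a. (- m) * \<xi> (a, i)"] by simp
    also have "l2norm n (\<lambda>a. (- m) * \<xi> (a, i)) \<le> \<bar>m\<bar> * 2"
      unfolding l2norm_scale using column_norm[OF assms] by (simp add: mult_left_mono)
    finally show ?thesis by simp
  qed simp
  also have "\<dots> \<le> l2norm n (response S m \<xi> \<zeta>) + 2 * (A * \<rho>)" using m_le by simp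
  finally have "1 / sqrt n * l2norm n (response (S - {i}) m \<xi> \<zeta>) \<le> 1 / sqrt n * (l2norm n (response S m \<xi> \<zeta>) + 2 * (A * \<rho>))"
    by (rule mult_left_mono) simp
  also have "\<dots> = \<rho> * (1 + 2 * A / sqrt n)"
    unfolding distrib_left \<rho>_def[symmetric] by simp
  finally show ?thesis .
qed

lemma corr_split: "corr i = leave_out_corr n S m \<xi> \<zeta> i + (if i \<in> S then m * gram_entry n \<xi> i i else 0)"
proof (cases "i \<in> S")
  case True
  then show ?thesis
    by (simp add: corr_def leave_out_corr_def response_split[OF True] gram_entry_def sum.distrib
        sum_distrib_left algebra_simps)
qed (simp add: corr_def leave_out_corr_def)

lemma corr_near:
  assumes "i < p"
  shows "\<bar>corr i\<bar> \<le> \<bar>leave_out_corr n S m \<xi> \<zeta> i\<bar> + A * \<rho> * (1 + \<mu>)"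
proof -
  have G: "\<bar>gram_entry n \<xi> i i\<bar> \<le> 1 + \<mu>" using gram_diag[OF assms] by linarith
  have "\<bar>m * gram_entry n \<xi> i i\<bar> \<le> A * \<rho> * (1 + \<mu>)"
    unfolding abs_mult using m_le G A_nonneg rho_pos by (intro mult_mono) auto
  moreover have "0 \<le> A * \<rho> * (1 + \<mu>)" using A_nonneg rho_pos mu_nonneg by simp
  ultimately show ?thesis unfolding corr_split by (auto split: if_splits)
qed

lemma corr_le:
  assumes "i < p"
  shows "\<bar>corr i\<bar> \<le> K * \<rho>"
proof -
  have "\<bar>leave_out_corr n S m \<xi> \<zeta> i\<bar> \<le> s * (1 / sqrt n * l2norm n (response (S - {i}) m \<xi> \<zeta>))"
    using good assms by (auto simp: good_def good_correlations_def)
  also have "\<dots> \<le> s * (\<rho> * (1 + 2 * A / sqrt n))"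
    using leave_out_norm[OF assms] s_nonneg by (rule mult_left_mono)
  finally have "\<bar>corr i\<bar> \<le> s * (\<rho> * (1 + 2 * A / sqrt n)) + A * \<rho> * (1 + \<mu>)"
    using corr_near[OF assms] by linarith
  also have "A * \<rho> * (1 + \<mu>) \<le> A * \<rho> * 2"
    using A_nonneg rho_pos \<mu>1 by (intro mult_left_mono) auto
  also have "s * (\<rho> * (1 + 2 * A / sqrt n)) + A * \<rho> * 2 = (s * (1 + 2 * A / sqrt n) + 2 * A) * \<rho>"
    by (simp add: algebra_simps)
  also have "\<dots> \<le> K * \<rho>" using K rho_pos by (intro mult_right_mono) auto
  finally show ?thesis by simp
qed

lemma noise_winner: "\<exists>j\<in>{..<p} - S. x * \<rho> < corr j"
proof -
  have "0 < sqrt (\<Sum>a<n. (response S m \<xi> \<zeta> a)\<^sup>2)"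
    using rho_pos n_pos unfolding \<rho>_def l2norm_def by (simp add: zero_less_divide_iff)
  then have "0 < (\<Sum>a<n. (response S m \<xi> \<zeta> a)\<^sup>2)" by simp
  then show ?thesis using good unfolding good_def good_noise_def \<rho>_def corr_def by blast
qed

text \<open>The score of \<open>i\<close> differs from its leave-out version by at most \<open>A \<rho> (1 + \<mu>)\<close>, and the gap between \<open>x\<close> and
\<open>x'\<close> is made for that.\<close>

lemma large_score_strong_signal:
  assumes "i \<in> S" "(x - h) * \<rho> \<le> \<bar>corr i\<bar>"
  shows "strong_signal n S m x' \<xi> \<zeta> i"
proof -
  have i: "i < p" using assms S_sub by auto
  have "x' * (1 / sqrt n * l2norm n (response (S - {i}) m \<xi> \<zeta>)) \<le> x' * (\<rho> * (1 + 2 * A / sqrt n))"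
    using leave_out_norm[OF i] x'_nonneg by (rule mult_left_mono)
  also have "\<dots> = (x' * (1 + 2 * A / sqrt n)) * \<rho>" by simp
  also have "\<dots> < (x - h - A * (1 + \<mu>)) * \<rho>" using gap rho_pos by (rule mult_strict_right_mono)
  also have "\<dots> = (x - h) * \<rho> - A * \<rho> * (1 + \<mu>)" by (simp add: algebra_simps)
  also have "\<dots> \<le> \<bar>leave_out_corr n S m \<xi> \<zeta> i\<bar>" using corr_near[OF i] assms(2) by linarith
  finally show ?thesis unfolding strong_signal_def .
qed

lemma rank_less:
  assumes X: "X \<in> carrier_mat n p" and \<xi>: "\<And>a j. a < n \<Longrightarrow> j < p \<Longrightarrow> \<xi> (a, j) = X $$ (a, j)"
    and z: "z \<in> carrier_vec n" and \<zeta>: "\<And>a. a < n \<Longrightarrow> \<zeta> a = z $ a"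
    and \<beta>: "\<beta> \<in> carrier_vec p" and \<beta>_S: "\<And>j. j < p \<Longrightarrow> \<beta> $ j = (if j \<in> S then m else 0)"
    and rank: "first_noise_rank proc X (X *\<^sub>v \<beta> + z) \<beta> T"
  shows "real T < 1 + t"
proof -
  let ?y = "X *\<^sub>v \<beta> + z"
  have dims: "dim_row X = n" "dim_col X = p" using X by auto
  have col: "col X i $ a = \<xi> (a, i)" if "a < n" "i < p" for a i
    using that X \<xi> by simp
  have y: "?y $ a = response S m \<xi> \<zeta> a" if a: "a < n" for a
  proof -
    have "(X *\<^sub>v \<beta>) $ a = (\<Sum>j<p. X $$ (a, j) * \<beta> $ j)"
      using a X \<beta> by (auto simp: scalar_prod_def lessThan_atLeast0 intro!: sum.cong)
    also have "\<dots> = (\<Sum>j<p. if j \<in> S then m * \<xi> (a, j) else 0)"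
      using \<beta>_S \<xi> a by (intro sum.cong) auto
    also have "\<dots> = m * (\<Sum>j\<in>S. \<xi> (a, j))"
      using S_sub by (simp add: sum.If_cases Int_absorb1 sum_distrib_left)
    finally show ?thesis using a X z \<zeta> by (simp add: response_def)
  qed
  have y_dim: "?y \<in> carrier_vec n" using X z \<beta> by (intro add_carrier_vec) auto
  have cy: "col X i \<bullet> ?y = corr i" if "i < p" for i
    unfolding scalar_prod_def corr_def carrier_vecD[OF y_dim] lessThan_atLeast0[symmetric]
  proof (rule sum.cong)
    fix a assume "a \<in> {..<n}"
    then have "a < n" by simp
    then show "col X i $ a * ?y $ a = response S m \<xi> \<zeta> a * \<xi> (a, i)"
      unfolding y[OF \<open>a < n\<close>] col[OF \<open>a < n\<close> that] by simp
  qed simp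
  have cc: "col X i \<bullet> col X j = gram_entry n \<xi> i j" if "i < p" "j < p" for i j
    unfolding scalar_prod_def gram_entry_def using dims col that
    by (auto simp: lessThan_atLeast0 intro!: sum.cong)
  obtain j0 where j0: "j0 < p" "j0 \<notin> S" "x * \<rho> < corr j0" using noise_winner by auto
  define L where "L = \<bar>corr j0\<bar>"
  define e where "e = h * \<rho>"
  define B where "B = K * \<rho>"
  define Big where "Big = {i. i < p \<and> \<beta> $ i \<noteq> 0 \<and> L - e \<le> \<bar>corr i\<bar>}"
  have Big: "Big \<subseteq> {i \<in> S. strong_signal n S m x' \<xi> \<zeta> i}"
  proof
    fix i assume "i \<in> Big"
    then have i: "i < p" "\<beta> $ i \<noteq> 0" "L - e \<le> \<bar>corr i\<bar>" by (auto simp: Big_def)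
    then have "i \<in> S" using \<beta>_S by (auto split: if_splits)
    moreover have "(x - h) * \<rho> \<le> \<bar>corr i\<bar>" using i(3) j0(3) by (simp add: L_def e_def left_diff_distrib)
    ultimately show "i \<in> {i \<in> S. strong_signal n S m x' \<xi> \<zeta> i}" using large_score_strong_signal by auto
  qed
  have "card Big \<le> card {i \<in> S. strong_signal n S m x' \<xi> \<zeta> i}" using Big S_fin by (intro card_mono) auto
  moreover have "real (card {i \<in> S. strong_signal n S m x' \<xi> \<zeta> i}) < t"
    using good by (simp add: good_def good_count_def)
  ultimately have card: "real (card Big) < t" by linarith
  have hL: "e \<le> L"
  proof -
    have "h * \<rho> \<le> x * \<rho>" using h_le rho_pos by simp
    then show ?thesis using j0(3) by (simp add: e_def L_def)
  qed
  have small: "32 * (real (Suc (card Big)))\<^sup>2 * \<mu> * B\<^sup>2 \<le> e\<^sup>2"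
  proof -
    have "(real (Suc (card Big)))\<^sup>2 \<le> (t + 1)\<^sup>2" using card by (intro power_mono) auto
    then have "32 * (real (Suc (card Big)))\<^sup>2 * \<mu> * K\<^sup>2 \<le> 32 * (t + 1)\<^sup>2 * \<mu> * K\<^sup>2"
      using mu_nonneg by (intro mult_right_mono mult_left_mono) auto
    also have "\<dots> \<le> h\<^sup>2" by (rule small_coherence)
    finally have "32 * (real (Suc (card Big)))\<^sup>2 * \<mu> * K\<^sup>2 * \<rho>\<^sup>2 \<le> h\<^sup>2 * \<rho>\<^sup>2" by (rule mult_right_mono) simp
    then show ?thesis by (simp add: B_def e_def power_mult_distrib mult_ac)
  qed
  have base: "near_orthonormal_design X ?y \<mu> B"
    using y_dim gram_near_identity cc corr_le cy
    by unfold_locales (auto simp: dims B_def)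
  then have scr: "screening X ?y \<mu> B L e Big (Suc (card Big))"
    using h_pos rho_pos hL corr_le[OF j0(1)] small
    by (intro screening.intro screening_axioms.intro) (auto simp: dims B_def L_def e_def Big_def)
  have "noise_screening X ?y \<mu> B L e Big (Suc (card Big)) \<beta> j0"
    using scr \<beta> j0 \<beta>_S cy near_orthonormal_design.score_def[OF base]
    by (intro noise_screening.intro noise_screening_axioms.intro) (auto simp: dims L_def Big_def)
  then have "T \<le> 1 + card Big" using rank by (rule noise_screening.first_noise_rank_le)
  then show ?thesis using card by linarith
qed

end

section \<open>Rates\<close>

text \<open>In this section \<open>q\<close> stands for \<open>log p\<close>, and \<open>exp (- q / 2) * c\<close> for an upper bound of \<open>1 / sqrt n\<close>.\<close>

lemma diagonal_tail_lim: "((\<lambda>q::real. (2 * exp q + 2) * exp (- (q ^ 4) / 16)) \<longlongrightarrow> 0) at_top"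
  by real_asymp

lemma off_diagonal_tail_lim: "((\<lambda>q::real. (2 * (exp q)\<^sup>2 + 2 * exp q + 2) * exp (- q\<^sup>2 / 2)) \<longlongrightarrow> 0) at_top"
  by real_asymp

lemma noise_maximum_tail_lim:
  fixes h a :: real
  assumes "h > 0" "a > 0"
  shows "((\<lambda>q::real. exp (- (a * exp (h * sqrt (2 * q)))))  \<longlongrightarrow> 0) at_top"
  using assms by real_asymp

lemma count_tail_lim:
  fixes h a :: real
  assumes "h > 0"
  shows "((\<lambda>q::real. a * exp (- h * sqrt (2 * q)))  \<longlongrightarrow> 0) at_top"
  using assms by real_asymp

lemma coherence_error_lim:
  fixes b c :: real
  assumes "b > 0" "c > 0"
  shows "((\<lambda>q::real. 32 * (exp (b * sqrt (2 * q)) + 1)\<^sup>2 * (q\<^sup>2 * (exp (- q / 2) * c)) * (3 * q)\<^sup>2)  \<longlongrightarrow> 0) at_top"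
  using assms by real_asymp

lemma one_plus_exp_sqrt_le:
  fixes b h :: real
  assumes "b > 0" "h > 0"
  shows "eventually (\<lambda>q::real. 1 + exp (b * sqrt (2 * q)) \<le> exp ((b + h) * sqrt (2 * q))) at_top"
  using assms by real_asymp

lemma gap_error_lim:
  fixes A c :: real
  assumes "A > 0" "c > 0"
  shows "((\<lambda>q::real. A * (q\<^sup>2 * (exp (- q / 2) * c)) + sqrt (2 * q) * (2 * A * (exp (- q / 2) * c)))  \<longlongrightarrow> 0) at_top"
  using assms by real_asymp

lemma score_bound_eventually:
  fixes A c :: real
  assumes "A > 0" "c > 0"
  shows "eventually (\<lambda>q::real. q * (1 + 2 * A * (exp (- q / 2) * c)) + 2 * A \<le> 3 * q) at_top"
  using assms by real_asymp

lemma sqrt_eventually_ge: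
  fixes b :: real
  shows "eventually (\<lambda>q::real. b \<le> sqrt (2 * q)) at_top"
  by real_asymp

lemma coherence_lim:
  fixes c :: real
  assumes "c > 0"
  shows "((\<lambda>q::real. q\<^sup>2 * (exp (- q / 2) * c)) \<longlongrightarrow> 0) at_top"
  using assms by real_asymp

section \<open>Random noise vector, diagonal choice and crude bound on the rank\<close>

lemma good_measurable_PiM:
  assumes f: "f \<in> measurable N (PiM ({..<n} \<times> {..<p}) (\<lambda>_. borel))" and g: "g \<in> measurable N (PiM {..<n} (\<lambda>_. borel))"
    and S: "S \<subseteq> {..<p}"
  shows "Measurable.pred N (\<lambda>\<omega>. good n p S m \<mu> s x x' t (f \<omega>) (g \<omega>))"
proof (rule good_measurable[OF _ _ S])
  fix a j assume "a < n" "j < p"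
  then show "(\<lambda>\<omega>. f \<omega> (a, j)) \<in> borel_measurable N"
    by (intro measurable_compose[OF f measurable_component_singleton]) auto
next
  fix a assume "a < n"
  then show "(\<lambda>\<omega>. g \<omega> a) \<in> borel_measurable N"
    by (intro measurable_compose[OF g measurable_component_singleton]) auto
qed

lemma (in prob_space) distributed_normal_law:
  assumes X: "X \<in> borel_measurable M" and law: "distr M borel X = normal_law 0 v" and v: "0 < v"
  shows "distributed M lborel X (normal_density 0 (sqrt v))"
proof -
  have "distr M lborel X = distr M borel X" by (rule distr_cong) auto
  then show ?thesis using X law v unfolding distributed_def normal_law_def by simp
qed

text \<open>The bound for fixed \<open>\<zeta>\<close> does not depend on \<open>\<zeta>\<close>, so that independence of design and noise carries it
over to the random noise vector.\<close>

lemma (in prob_space) prob_bad_le: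
  fixes X :: "'a \<Rightarrow> real mat" and z :: "'a \<Rightarrow> real vec" and n p :: nat
  defines "F \<equiv> \<lambda>\<omega>. \<lambda>ij\<in>{..<n} \<times> {..<p}. X \<omega> $$ ij" and "H \<equiv> \<lambda>\<omega>. \<lambda>i\<in>{..<n}. z \<omega> $ i"
  assumes n: "0 < n" and S: "S \<subseteq> {..<p}" "S \<noteq> {}"
    and X_indep: "indep_vars (\<lambda>_. borel) (\<lambda>ij \<omega>. X \<omega> $$ ij) ({..<n} \<times> {..<p})"
    and X_law: "\<And>i j. i < n \<Longrightarrow> j < p \<Longrightarrow> distr M borel (\<lambda>\<omega>. X \<omega> $$ (i, j)) = normal_law 0 (1 / real n)"
    and z_rv: "\<And>i. i < n \<Longrightarrow> (\<lambda>\<omega>. z \<omega> $ i) \<in> borel_measurable M"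
    and X_z_indep: "indep_set (sets (vimage_algebra (space M) F (PiM ({..<n} \<times> {..<p}) (\<lambda>_. borel))))
          (sets (vimage_algebra (space M) H (PiM {..<n} (\<lambda>_. borel))))"
    and \<mu>: "0 < \<mu>" "\<mu> \<le> 1" and s: "0 \<le> s" and x: "0 \<le> x" "0 \<le> h" and x': "0 \<le> x'" and t: "0 < t"
  shows "{\<omega> \<in> space M. good n p S m \<mu> s x x' t (F \<omega>) (H \<omega>)} \<in> events" (is "?E1 \<in> _")
    and "prob (space M - {\<omega> \<in> space M. good n p S m \<mu> s x x' t (F \<omega>) (H \<omega>)})
    \<le> (2 * real p + 2) * exp (- real n * \<mu>\<^sup>2 / 16) + (2 * (real p)\<^sup>2 + 2 * real p + 2) * exp (- s\<^sup>2 / 2)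
      + (1 - h * std_normal_density (x + h)) ^ (p - card S) + 2 * card S * exp (- x'\<^sup>2 / 2) / t" (is "_ \<le> ?b")
proof -
  let ?I = "{..<n} \<times> {..<p}"
  let ?MU = "PiM ?I (\<lambda>_. borel :: real measure)" and ?MV = "PiM {..<n} (\<lambda>_. borel :: real measure)"
  have X_rv: "(\<lambda>\<omega>. X \<omega> $$ ij) \<in> borel_measurable M" if "ij \<in> ?I" for ij
    using X_indep that unfolding indep_vars_def2 by auto
  have F: "F \<in> measurable M ?MU" unfolding F_def by (rule measurable_restrict) (rule X_rv)
  have H: "H \<in> measurable M ?MV" unfolding H_def by (rule measurable_restrict) (use z_rv in auto)
  have product: "prob {\<omega> \<in> space M. F \<omega> \<in> A \<and> H \<omega> \<in> B} = prob {\<omega> \<in> space M. F \<omega> \<in> A} * prob {\<omega> \<in> space M. H \<omega> \<in> B}"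
    if "A \<in> sets ?MU" "B \<in> sets ?MV" for A B
  proof -
    have "prob ((F -` A \<inter> space M) \<inter> (H -` B \<inter> space M)) = prob (F -` A \<inter> space M) * prob (H -` B \<inter> space M)"
      by (rule indep_setD[OF X_z_indep]) (use that in \<open>auto intro: in_vimage_algebra\<close>)
    moreover have "{\<omega> \<in> space M. F \<omega> \<in> A} = F -` A \<inter> space M" "{\<omega> \<in> space M. H \<omega> \<in> B} = H -` B \<inter> space M"
      "{\<omega> \<in> space M. F \<omega> \<in> A \<and> H \<omega> \<in> B} = (F -` A \<inter> space M) \<inter> (H -` B \<inter> space M)" by auto
    ultimately show ?thesis by simp
  qed
  have gd: "gaussian_design M n p (\<lambda>ij \<omega>. F \<omega> ij) S"
  proof (unfold_locales)
    have "indep_vars (\<lambda>_. borel) (\<lambda>ij \<omega>. F \<omega> ij) ?I \<longleftrightarrow> indep_vars (\<lambda>_. borel) (\<lambda>ij \<omega>. X \<omega> $$ ij) ?I"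
      by (rule indep_vars_cong) (auto simp: F_def)
    then show "indep_vars (\<lambda>_. borel) (\<lambda>ij \<omega>. F \<omega> ij) ?I" using X_indep by simp
    fix ij assume ij: "ij \<in> ?I"
    have "distributed M lborel (\<lambda>\<omega>. X \<omega> $$ ij) (normal_density 0 (sqrt (1 / real n)))"
      using X_law n ij by (intro distributed_normal_law X_rv) auto
    moreover have "(\<lambda>\<omega>. F \<omega> ij) = (\<lambda>\<omega>. X \<omega> $$ ij)" using ij by (simp add: F_def)
    ultimately show "distributed M lborel (\<lambda>\<omega>. F \<omega> ij) (\<lambda>x. ennreal (normal_density 0 (1 / sqrt (real n)) x))"
      by (simp add: real_sqrt_divide)
  qed (use n S in auto)
  have "Measurable.pred (?MU \<Otimes>\<^sub>M ?MV) (\<lambda>uv. good n p S m \<mu> s x x' t (fst uv) (snd uv))"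
    by (rule good_measurable_PiM[OF measurable_fst measurable_snd S(1)])
  then have E: "{uv \<in> space (?MU \<Otimes>\<^sub>M ?MV). \<not> good n p S m \<mu> s x x' t (fst uv) (snd uv)} \<in> sets (?MU \<Otimes>\<^sub>M ?MV)" (is "?E \<in> _")
    by measurable
  have "Measurable.pred M (\<lambda>\<omega>. good n p S m \<mu> s x x' t (F \<omega>) (H \<omega>))"
    by (rule good_measurable_PiM[OF F H S(1)])
  then show "?E1 \<in> events" by measurable
  have "prob {\<omega> \<in> space M. (F \<omega>, H \<omega>) \<in> ?E} \<le> ?b"
  proof (rule prob_freeze[OF F H product E])
    fix v assume v: "v \<in> space ?MV"
    have "{\<omega> \<in> space M. (F \<omega>, v) \<in> ?E} = {\<omega> \<in> space M. \<not> good n p S m \<mu> s x x' t (F \<omega>) v}"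
      using v measurable_space[OF F] by (auto simp: space_pair_measure)
    then show "prob {\<omega> \<in> space M. (F \<omega>, v) \<in> ?E} \<le> ?b"
      using gaussian_design.prob_not_good[OF gd \<mu> s x x' t, of m v] by simp
  qed
  also have "{\<omega> \<in> space M. (F \<omega>, H \<omega>) \<in> ?E} = space M - ?E1"
    using measurable_space[OF F] measurable_space[OF H] by (auto simp: space_pair_measure)
  finally show "prob (space M - ?E1) \<le> ?b" .
qed

text \<open>\<open>f l\<close> is the largest \<open>m\<close> not above \<open>l\<close> such that the thresholds of \<open>Q 0\<close>, ..., \<open>Q m\<close> have been passed.\<close>

lemma diagonal_choice:
  fixes Q :: "nat \<Rightarrow> nat \<Rightarrow> bool"
  assumes "\<And>m. eventually (Q m) sequentially"
  shows "\<exists>f. filterlim f at_top sequentially \<and> (\<forall>\<^sub>F l in sequentially. Q (f l) l)"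
proof -
  from assms have "\<forall>m. \<exists>N. \<forall>l\<ge>N. Q m l" by (simp add: eventually_sequentially)
  then obtain N where N: "\<And>m l. N m \<le> l \<Longrightarrow> Q m l" by metis
  define G where "G l = {m. m \<le> l \<and> (\<forall>j\<le>m. N j \<le> l)}" for l
  define f where "f l = Max (G l)" for l
  have fin: "finite (G l)" for l unfolding G_def by (rule finite_subset[of _ "{..l}"]) auto
  have "Q (f l) l" if "N 0 \<le> l" for l
  proof -
    have "0 \<in> G l" using that by (simp add: G_def)
    then have "f l \<in> G l" unfolding f_def using fin Max_in by blast
    then show ?thesis using N by (simp add: G_def)
  qed
  then have "\<forall>\<^sub>F l in sequentially. Q (f l) l" by (auto simp: eventually_sequentially)
  moreover have "filterlim f at_top sequentially"
    unfolding filterlim_at_top eventually_sequentially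
  proof
    fix m
    show "\<exists>L. \<forall>l\<ge>L. m \<le> f l"
    proof (intro exI allI impI)
      fix l assume l: "max m (Max (N ` {..m})) \<le> l"
      have "N j \<le> l" if "j \<le> m" for j
      proof -
        have "N j \<le> Max (N ` {..m})" using that by (intro Max_ge) auto
        then show ?thesis using l by linarith
      qed
      then have "m \<in> G l" using l by (simp add: G_def)
      then show "m \<le> f l" unfolding f_def using fin by simp
    qed
  qed
  ultimately show ?thesis by blast
qed

lemma lars_steps_distinct:
  assumes "(lars_step X y)\<^sup>*\<^sup>* s s'" "distinct (fst s)" "set (fst s) \<subseteq> {..<dim_col X}"
  shows "distinct (fst s') \<and> set (fst s') \<subseteq> {..<dim_col X}"
  using assms(1)
proof (induction rule: rtranclp_induct)
  case base
  then show ?case using assms by simp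
next
  case (step s1 s2)
  from step(2,3) show ?case by (cases rule: lars_step.cases) (auto simp: lars_catches_up_def)
qed

text \<open>Serves on the exceptional event, where the exponent is chosen so large that this bound suffices.\<close>

lemma first_noise_rank_le_Suc_dim:
  assumes "\<beta> \<in> carrier_vec (dim_col X)" "first_noise_rank proc X y \<beta> T"
  shows "T \<le> Suc (dim_col X)"
proof -
  have list: "list_rank \<beta> js \<le> Suc (dim_col X)" if "distinct js" "set js \<subseteq> {..<dim_col X}" for js
  proof -
    have "length js = card (set js)" using that by (simp add: distinct_card)
    also have "\<dots> \<le> card {..<dim_col X}" using that by (intro card_mono) auto
    finally have "length js \<le> dim_col X" by simp
    then show ?thesis using length_takeWhile_le[of "\<lambda>j. \<beta> $ j \<noteq> 0" js] by (simp add: list_rank_def)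
  qed
  show ?thesis
  proof (cases proc)
    case Forward_Stepwise
    then show ?thesis using assms list by (auto simp: forward_stepwise_order_def)
  next
    case Lasso
    have "card {i. i < dim_vec \<beta> \<and> Q i} \<le> card {..<dim_vec \<beta>}" for Q by (intro card_mono) auto
    then show ?thesis using assms Lasso by (auto simp: path_rank_def)
  next
    case Least_Angle_Regression
    then obtain js s b where js: "T = list_rank \<beta> js" "lars_start X y s" "(lars_step X y)\<^sup>*\<^sup>* s (js, b)"
      using assms by (auto simp: lars_order_def)
    then show ?thesis using lars_steps_distinct[OF js(3)] list by (auto simp: lars_start_def)
  qed
qed

section \<open>The proportional regime\<close>

locale proportional_models =
  fixes P :: "nat \<Rightarrow> 'a measure" and k n p :: "nat \<Rightarrow> nat"
    and X :: "nat \<Rightarrow> 'a \<Rightarrow> real mat" and y z :: "nat \<Rightarrow> 'a \<Rightarrow> real vec"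
    and \<beta> :: "nat \<Rightarrow> real vec" and M :: "nat \<Rightarrow> real" and \<theta> \<epsilon> \<delta> :: real
  assumes prob: "\<And>l. prob_space (P l)"
    and p_lim: "filterlim p at_top sequentially"
    and X_dim: "\<And>l \<omega>. \<omega> \<in> space (P l) \<Longrightarrow> X l \<omega> \<in> carrier_mat (n l) (p l)"
    and z_dim: "\<And>l \<omega>. \<omega> \<in> space (P l) \<Longrightarrow> z l \<omega> \<in> carrier_vec (n l)"
    and X_indep: "\<And>l. prob_space.indep_vars (P l) (\<lambda>_. borel)
                     (\<lambda>ij \<omega>. X l \<omega> $$ ij) ({..<n l} \<times> {..<p l})"
    and X_law: "\<And>l i j. i < n l \<Longrightarrow> j < p l \<Longrightarrow>
                  distr (P l) borel (\<lambda>\<omega>. X l \<omega> $$ (i, j)) = normal_law 0 (1 / real (n l))"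
    and z_measurable: "\<And>l i. i < n l \<Longrightarrow> (\<lambda>\<omega>. z l \<omega> $ i) \<in> borel_measurable (P l)"
    and X_z_indep: "\<And>l. prob_space.indep_set (P l)
          (sets (vimage_algebra (space (P l)) (\<lambda>\<omega>. \<lambda>ij\<in>{..<n l} \<times> {..<p l}. X l \<omega> $$ ij)
                  (PiM ({..<n l} \<times> {..<p l}) (\<lambda>_. borel))))
          (sets (vimage_algebra (space (P l)) (\<lambda>\<omega>. \<lambda>i\<in>{..<n l}. z l \<omega> $ i)
                  (PiM {..<n l} (\<lambda>_. borel))))"
    and \<beta>_dim: "\<And>l. \<beta> l \<in> carrier_vec (p l)"
    and \<beta>_entries: "\<And>l j. j < p l \<Longrightarrow> \<beta> l $ j = M l \<or> \<beta> l $ j = 0"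
    and \<beta>_card: "\<And>l. card {j. j < p l \<and> \<beta> l $ j = M l} = k l"
    and M_nz: "\<And>l. M l \<noteq> 0"
    and model: "\<And>l \<omega>. \<omega> \<in> space (P l) \<Longrightarrow> y l \<omega> = X l \<omega> *\<^sub>v \<beta> l + z l \<omega>"
    and k_le: "\<And>l. real (k l) \<le> \<theta> * real (p l)" and \<theta>: "\<theta> < 1"
    and \<epsilon>: "0 < \<epsilon>" "(\<lambda>l. real (k l) / real (p l)) \<longlonglongrightarrow> \<epsilon>"
    and \<delta>: "0 < \<delta>" "(\<lambda>l. real (n l) / real (p l)) \<longlonglongrightarrow> \<delta>"
begin

definition q where "q l = ln (real (p l))"
text \<open>The limit of \<open>sqrt (n / k)\<close>, which bounds the mean of a signal score in units of \<open>\<rho>\<close>.\<close>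

definition A0 where "A0 = sqrt (\<delta> / \<epsilon>)"
definition S where "S l = {j. j < p l \<and> \<beta> l $ j = M l}"
definition w where "w = 1 / sqrt (\<delta> / 2)"

lemma A0_pos: "0 < A0" and w_pos: "0 < w"
  using \<epsilon> \<delta> by (auto simp: A0_def w_def)

lemma q_lim: "filterlim q at_top sequentially"
  unfolding q_def using p_lim
  by (intro filterlim_compose[OF ln_at_top] filterlim_compose[OF filterlim_real_sequentially])

lemma along_q: "eventually Q at_top \<Longrightarrow> \<forall>\<^sub>F l in sequentially. Q (q l)"
  by (rule eventually_compose_filterlim[OF _ q_lim])

lemma p_pos: "\<forall>\<^sub>F l in sequentially. 0 < p l"
  by (rule eventually_compose_filterlim[OF eventually_gt_at_top p_lim])

lemma exp_q: "0 < p l \<Longrightarrow> exp (q l) = real (p l)"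
  by (simp add: q_def)

lemma n_lower: "\<forall>\<^sub>F l in sequentially. 0 < n l \<and> 1 / sqrt (n l) \<le> exp (- q l / 2) * w"
proof -
  have "\<forall>\<^sub>F l in sequentially. \<delta> / 2 < real (n l) / real (p l)"
    by (rule order_tendstoD(1)[OF \<delta>(2)]) (use \<delta>(1) in simp)
  then show ?thesis using p_pos
  proof eventually_elim
    case (elim l)
    then have "\<delta> / 2 * exp (q l) < n l" using exp_q[of l] by (simp add: field_simps)
    moreover have "0 < \<delta> / 2 * exp (q l)" using \<delta>(1) by simp
    ultimately have le: "\<delta> / 2 * exp (q l) \<le> n l" and n: "0 < n l" by auto
    have "sqrt (\<delta> / 2) * exp (q l / 2) = sqrt (\<delta> / 2 * exp (q l))"
    proof -
      have "exp (q l) = (exp (q l / 2))\<^sup>2" by (simp add: power2_eq_square exp_add[symmetric])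
      then show ?thesis by (simp only: real_sqrt_mult real_sqrt_abs abs_exp_cancel)
    qed
    also have "\<dots> \<le> sqrt (n l)" using le by (rule real_sqrt_le_mono)
    finally have sqrt_le: "sqrt (\<delta> / 2) * exp (q l / 2) \<le> sqrt (n l)" .
    have pos: "0 < sqrt (\<delta> / 2) * exp (q l / 2)" using \<delta>(1) by simp
    have "1 / sqrt (n l) \<le> 1 / (sqrt (\<delta> / 2) * exp (q l / 2))"
      using sqrt_le pos by (rule frac_le[OF zero_le_one order_refl, rotated])
    also have "\<dots> = inverse (exp (q l / 2)) * w"
      unfolding w_def by (simp only: divide_inverse inverse_mult_distrib mult_1_left mult.commute)
    also have "inverse (exp (q l / 2)) = exp (- q l / 2)"
      by (simp only: exp_minus[symmetric] minus_divide_left)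
    finally show ?case using n by simp
  qed
qed

lemma k_pos: "\<forall>\<^sub>F l in sequentially. 0 < k l"
proof -
  have "\<forall>\<^sub>F l in sequentially. 0 < real (k l) / real (p l)"
    by (rule order_tendstoD(1)[OF \<epsilon>(2)]) (use \<epsilon>(1) in simp)
  then show ?thesis by eventually_elim (auto intro: Nat.gr0I)
qed

lemma k_over_n: "(\<lambda>l. real (k l) / real (n l)) \<longlonglongrightarrow> \<epsilon> / \<delta>"
proof (rule Lim_transform_eventually)
  show "(\<lambda>l. (real (k l) / real (p l)) / (real (n l) / real (p l))) \<longlonglongrightarrow> \<epsilon> / \<delta>"
    using \<epsilon> \<delta> by (intro tendsto_divide) auto
  show "\<forall>\<^sub>F l in sequentially. (real (k l) / real (p l)) / (real (n l) / real (p l)) = real (k l) / real (n l)"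
    using p_pos by eventually_elim simp
qed

context
  fixes h :: real assumes h: "0 < h"
begin

text \<open>The coherence is given a few more logarithms than its true order, so that the union bounds over columns and
pairs of columns need no care. Of the \<open>2 h\<close> in \<open>x\<close>, one \<open>h\<close> is the length of the interval in the lower bound
for the normal tail and one makes the expected number of large noise scores diverge. The gap between \<open>x\<close> and
\<open>x'\<close> pays for the mean of a signal score, at most \<open>(A0 + h) \<rho> (1 + \<mu>)\<close>, for \<open>e = h \<rho>\<close> and, with one more \<open>h\<close>, for
the vanishing errors. The step from \<open>5 h\<close> to \<open>6 h\<close> pays for Markov's inequality.\<close>

definition \<mu> where "\<mu> l = (q l)\<^sup>2 / sqrt (n l)"
definition x where "x l = sqrt (2 * q l) - 2 * h"
definition x' where "x' l = sqrt (2 * q l) - A0 - 5 * h"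
definition t where "t l = exp ((A0 + 6 * h) * sqrt (2 * q l))"

lemma mu_le: "\<forall>\<^sub>F l in sequentially. \<mu> l \<le> (q l)\<^sup>2 * (exp (- q l / 2) * w)"
  using n_lower
proof eventually_elim
  case (elim l)
  then have "(q l)\<^sup>2 * (1 / sqrt (n l)) \<le> (q l)\<^sup>2 * (exp (- q l / 2) * w)"
    by (intro mult_left_mono) auto
  then show ?case by (simp add: \<mu>_def)
qed

lemma mu_lim: "\<mu> \<longlonglongrightarrow> 0"
proof (rule tendsto_sandwich[OF _ mu_le tendsto_const])
  show "\<forall>\<^sub>F l in sequentially. 0 \<le> \<mu> l" by (simp add: \<mu>_def)
  show "(\<lambda>l. (q l)\<^sup>2 * (exp (- q l / 2) * w)) \<longlonglongrightarrow> 0"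
    by (rule filterlim_compose[OF coherence_lim[OF w_pos] q_lim])
qed

text \<open>In the limit the right-hand side is \<open>((A0 + h) / A0)\<^sup>2\<close>.\<close>

lemma signal_size_eventually:
  "\<forall>\<^sub>F l in sequentially. 1 \<le> (A0 + h)\<^sup>2 * (card (S l) / n l * (1 - \<mu> l - (q l)\<^sup>2 / n l))"
proof -
  have c: "card (S l) = k l" for l using \<beta>_card by (simp add: S_def)
  have "(\<lambda>l. (q l)\<^sup>2 / n l) \<longlonglongrightarrow> 0"
  proof (rule tendsto_sandwich[OF _ _ tendsto_const mu_lim])
    show "\<forall>\<^sub>F l in sequentially. (q l)\<^sup>2 / n l \<le> \<mu> l"
      using n_lower
    proof eventually_elim
      case (elim l)
      have "1 \<le> real (n l)" using elim by simp
      then have "sqrt (n l) * 1 \<le> sqrt (n l) * sqrt (n l)" by (intro mult_left_mono) auto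
      then show ?case unfolding \<mu>_def using elim by (intro divide_left_mono) auto
    qed
  qed simp
  then have "(\<lambda>l. (A0 + h)\<^sup>2 * (card (S l) / n l * (1 - \<mu> l - (q l)\<^sup>2 / n l))) \<longlonglongrightarrow> (A0 + h)\<^sup>2 * (\<epsilon> / \<delta> * (1 - 0 - 0))"
    unfolding c by (intro tendsto_intros mu_lim k_over_n)
  moreover have "1 < (A0 + h)\<^sup>2 * (\<epsilon> / \<delta> * (1 - 0 - 0))"
  proof -
    have "A0\<^sup>2 < (A0 + h)\<^sup>2" using h A0_pos by (intro power_strict_mono) auto
    moreover have "A0\<^sup>2 = \<delta> / \<epsilon>" using \<delta>(1) \<epsilon>(1) by (simp add: A0_def)
    ultimately show ?thesis using \<delta>(1) \<epsilon>(1) by (simp add: field_simps)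
  qed
  ultimately show ?thesis using order_tendstoD(1) by (blast intro: eventually_mono less_imp_le)
qed

lemma model_conditions_eventually:
  "\<forall>\<^sub>F l in sequentially. 0 < n l \<and> 0 < p l \<and> 0 < k l \<and> 0 \<le> q l \<and> 0 < \<mu> l \<and> \<mu> l \<le> 1 \<and> 0 \<le> x l \<and> 0 \<le> x' l \<and>
     h \<le> x l \<and> q l * (1 + 2 * (A0 + h) / sqrt (n l)) + 2 * (A0 + h) \<le> 3 * q l \<and> 2 * q l / sqrt (n l) \<le> \<mu> l \<and>
     x' l * (1 + 2 * (A0 + h) / sqrt (n l)) < x l - h - (A0 + h) * (1 + \<mu> l) \<and>
     32 * (t l + 1)\<^sup>2 * \<mu> l * (3 * q l)\<^sup>2 \<le> h\<^sup>2"
proof -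
  let ?W = "\<lambda>l. exp (- q l / 2) * w"
  have Ah: "0 < A0 + h" "0 < A0 + 6 * h" using A0_pos h by auto
  have q2: "\<forall>\<^sub>F l in sequentially. 2 \<le> q l" by (rule along_q[OF eventually_ge_at_top])
  have e1: "\<forall>\<^sub>F l in sequentially. (q l)\<^sup>2 * ?W l < 1"
    by (rule along_q[OF order_tendstoD(2)[OF coherence_lim[OF w_pos]]]) simp
  have e2: "\<forall>\<^sub>F l in sequentially. q l * (1 + 2 * (A0 + h) * ?W l) + 2 * (A0 + h) \<le> 3 * q l"
    by (rule along_q[OF score_bound_eventually[OF Ah(1) w_pos]])
  have e3: "\<forall>\<^sub>F l in sequentially. A0 + 5 * h \<le> sqrt (2 * q l)" by (rule along_q[OF sqrt_eventually_ge])
  have e4: "\<forall>\<^sub>F l in sequentially. (A0 + h) * ((q l)\<^sup>2 * ?W l) + sqrt (2 * q l) * (2 * (A0 + h) * ?W l) < h"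
    by (rule along_q[OF order_tendstoD(2)[OF gap_error_lim[OF Ah(1) w_pos] h]])
  have e5: "\<forall>\<^sub>F l in sequentially. 32 * (exp ((A0 + 6 * h) * sqrt (2 * q l)) + 1)\<^sup>2 * ((q l)\<^sup>2 * ?W l) * (3 * q l)\<^sup>2 < h\<^sup>2"
    by (rule along_q[OF order_tendstoD(2)[OF coherence_error_lim[OF Ah(2) w_pos]]]) (use h in simp)
  show ?thesis using n_lower p_pos k_pos mu_le q2 e1 e2 e3 e4 e5
  proof eventually_elim
    case (elim l)
    let ?\<nu> = "1 / sqrt (n l)"
    have n: "0 < n l" and \<nu>: "?\<nu> \<le> ?W l" and q: "2 \<le> q l" using elim by auto
    have \<nu>0: "0 < ?\<nu>" using n by simp
    have mu: "\<mu> l = (q l)\<^sup>2 * ?\<nu>" "0 < \<mu> l" using q n by (auto simp: \<mu>_def)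
    have A\<nu>: "2 * (A0 + h) / sqrt (n l) \<le> 2 * (A0 + h) * ?W l"
      using mult_left_mono[OF \<nu>, of "2 * (A0 + h)"] Ah by simp
    have b: "A0 + 5 * h \<le> sqrt (2 * q l)" using elim by simp
    then have x: "0 \<le> x l" "0 \<le> x' l" "h \<le> x l" using A0_pos h by (auto simp: x_def x'_def)
    have "q l * (2 * (A0 + h) / sqrt (n l)) \<le> q l * (2 * (A0 + h) * ?W l)"
      using A\<nu> q by (intro mult_left_mono) auto
    then have K: "q l * (1 + 2 * (A0 + h) / sqrt (n l)) + 2 * (A0 + h) \<le> 3 * q l"
      using elim(7) by (simp add: distrib_left)
    have coh: "2 * q l / sqrt (n l) \<le> \<mu> l"
    proof -
      have "2 * q l \<le> (q l)\<^sup>2" using q by (simp add: power2_eq_square)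
      then show ?thesis unfolding \<mu>_def by (intro divide_right_mono) auto
    qed
    have gap: "x' l * (1 + 2 * (A0 + h) / sqrt (n l)) < x l - h - (A0 + h) * (1 + \<mu> l)"
    proof -
      have "x' l * (2 * (A0 + h) / sqrt (n l)) \<le> sqrt (2 * q l) * (2 * (A0 + h) * ?W l)"
        using A\<nu> x Ah h A0_pos q by (intro mult_mono) (auto simp: x'_def)
      moreover have "(A0 + h) * \<mu> l \<le> (A0 + h) * ((q l)\<^sup>2 * ?W l)"
        using elim(4) Ah by (intro mult_left_mono) auto
      ultimately have "x' l * (2 * (A0 + h) / sqrt (n l)) + (A0 + h) * \<mu> l < h"
        using elim(9) by linarith
      moreover have "x' l * (1 + 2 * (A0 + h) / sqrt (n l)) = x' l + x' l * (2 * (A0 + h) / sqrt (n l))"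
        "(A0 + h) * (1 + \<mu> l) = A0 + h + (A0 + h) * \<mu> l" by (auto simp: distrib_left)
      ultimately show ?thesis unfolding x_def x'_def by linarith
    qed
    have "32 * (t l + 1)\<^sup>2 * \<mu> l * (3 * q l)\<^sup>2 \<le> 32 * (t l + 1)\<^sup>2 * ((q l)\<^sup>2 * ?W l) * (3 * q l)\<^sup>2"
      using elim(4) by (intro mult_right_mono mult_left_mono) auto
    then have small: "32 * (t l + 1)\<^sup>2 * \<mu> l * (3 * q l)\<^sup>2 \<le> h\<^sup>2"
      using elim(10) unfolding t_def by linarith
    have "\<mu> l \<le> 1" using elim(4,6) by linarith
    then show ?case using elim(1,2,3) mu q x K coh gap small by auto
  qed
qed

definition bad_bound where
  "bad_bound l = (2 * real (p l) + 2) * exp (- real (n l) * (\<mu> l)\<^sup>2 / 16)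
     + (2 * (real (p l))\<^sup>2 + 2 * real (p l) + 2) * exp (- (q l)\<^sup>2 / 2)
     + (1 - h * std_normal_density (x l + h)) ^ (p l - card (S l)) + 2 * card (S l) * exp (- (x' l)\<^sup>2 / 2) / t l"

text \<open>The last two summands are the critical ones. The expected number of noise scores above \<open>x\<close> is at least a
multiple of \<open>exp (h sqrt (2 q))\<close>, since \<open>(x + h)\<^sup>2 / 2\<close> is \<open>q - h sqrt (2 q) + h\<^sup>2 / 2\<close>. The
expected number of strong signals is at most a multiple of \<open>exp ((A0 + 5 h) sqrt (2 q))\<close>, which is
\<open>t exp (- h sqrt (2 q))\<close>.\<close>

lemma bad_bound_lim: "bad_bound \<longlonglongrightarrow> 0"
proof -
  define a where "a = (1 - \<theta>) * h / sqrt (2 * pi) * exp (- h\<^sup>2 / 2)"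
  define b where "b = 2 * exp (- (A0 + 5 * h)\<^sup>2 / 2)"
  define U where "U r = (2 * exp r + 2) * exp (- (r ^ 4) / 16) + (2 * (exp r)\<^sup>2 + 2 * exp r + 2) * exp (- r\<^sup>2 / 2)
    + exp (- (a * exp (h * sqrt (2 * r)))) + b * exp (- h * sqrt (2 * r))" for r :: real
  have a: "0 < a" using \<theta> h by (simp add: a_def)
  have "(U \<longlongrightarrow> 0 + 0 + 0 + 0) at_top"
    unfolding U_def[abs_def] by (intro tendsto_add diagonal_tail_lim off_diagonal_tail_lim noise_maximum_tail_lim[OF h a] count_tail_lim[OF h])
  then have U: "(\<lambda>l. U (q l)) \<longlonglongrightarrow> 0"
    using filterlim_compose[OF _ q_lim] by simp
  show ?thesis
  proof (rule tendsto_sandwich[OF _ _ tendsto_const U])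
    show "\<forall>\<^sub>F l in sequentially. 0 \<le> bad_bound l"
      using model_conditions_eventually
    proof eventually_elim
      case (elim l)
      then show ?case using scaled_density_le_1[of "x l" h] h by (simp add: bad_bound_def t_def)
    qed
    show "\<forall>\<^sub>F l in sequentially. bad_bound l \<le> U (q l)"
      using model_conditions_eventually
    proof eventually_elim
      case (elim l)
      then have n: "0 < n l" and p: "real (p l) = exp (q l)" and q: "0 \<le> q l" and x: "0 \<le> x l"
        using exp_q[of l] by auto
      have rt: "(sqrt (2 * q l))\<^sup>2 = 2 * q l" using q by simp
      have kS: "card (S l) = k l" using \<beta>_card by (simp add: S_def)
      have "real (n l) * (\<mu> l)\<^sup>2 = q l ^ 4"
        using n by (simp add: \<mu>_def power_divide)
      then have 1: "(2 * real (p l) + 2) * exp (- real (n l) * (\<mu> l)\<^sup>2 / 16) = (2 * exp (q l) + 2) * exp (- (q l ^ 4) / 16)"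
        by (simp add: p)
      have kle: "real (k l) \<le> real (p l)"
        using k_le[of l] \<theta> mult_right_mono[of \<theta> 1 "real (p l)"] by simp
      let ?y = "h * std_normal_density (x l + h)"
      have y: "0 \<le> ?y" "?y \<le> 1" using h scaled_density_le_1[of "x l" h] x by auto
      have "(1 - ?y) ^ (p l - k l) \<le> exp (- ?y) ^ (p l - k l)"
        using y exp_ge_add_one_self[of "- ?y"] by (intro power_mono) auto
      also have "\<dots> = exp (- (real (p l - k l) * ?y))" by (simp add: exp_of_nat_mult[symmetric])
      also have "\<dots> \<le> exp (- (a * exp (h * sqrt (2 * q l))))"
      proof -
        have "- (x l + h)\<^sup>2 / 2 = - q l + h * sqrt (2 * q l) + - h\<^sup>2 / 2"
          unfolding x_def using rt by (simp add: power2_diff algebra_simps) (simp add: field_simps)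
        then have d: "std_normal_density (x l + h) = 1 / sqrt (2 * pi) * (exp (- q l) * exp (h * sqrt (2 * q l)) * exp (- h\<^sup>2 / 2))"
          unfolding std_normal_density_def by (simp only: exp_add)
        have "(1 - \<theta>) * exp (q l) \<le> real (p l - k l)"
          using k_le[of l] kle by (simp add: p[symmetric] algebra_simps of_nat_diff)
        then have "(1 - \<theta>) * exp (q l) * ?y \<le> real (p l - k l) * ?y"
          using y by (intro mult_right_mono) auto
        also have "(1 - \<theta>) * exp (q l) * ?y = a * exp (h * sqrt (2 * q l))"
          unfolding d a_def by (simp add: exp_minus)
        finally show ?thesis by simp
      qed
      finally have 3: "(1 - ?y) ^ (p l - card (S l)) \<le> exp (- (a * exp (h * sqrt (2 * q l))))"
        by (simp add: kS)
      have "2 * card (S l) * exp (- (x' l)\<^sup>2 / 2) / t l \<le> 2 * exp (q l) * exp (- (x' l)\<^sup>2 / 2) / t l"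
        using kle by (intro divide_right_mono mult_right_mono) (auto simp: kS p t_def)
      also have "\<dots> = 2 * exp (q l + - (x' l)\<^sup>2 / 2 - (A0 + 6 * h) * sqrt (2 * q l))"
        unfolding t_def exp_diff exp_add by simp
      also have "q l + - (x' l)\<^sup>2 / 2 - (A0 + 6 * h) * sqrt (2 * q l) = - (A0 + 5 * h)\<^sup>2 / 2 + - h * sqrt (2 * q l)"
      proof -
        have "(x' l)\<^sup>2 = (sqrt (2 * q l))\<^sup>2 - 2 * (A0 + 5 * h) * sqrt (2 * q l) + (A0 + 5 * h)\<^sup>2"
          unfolding x'_def by (simp add: power2_eq_square algebra_simps)
        then show ?thesis unfolding rt by (simp add: field_simps)
      qed
      also have "2 * exp (- (A0 + 5 * h)\<^sup>2 / 2 + - h * sqrt (2 * q l)) = b * exp (- h * sqrt (2 * q l))"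
        unfolding exp_add b_def by simp
      finally have 4: "2 * card (S l) * exp (- (x' l)\<^sup>2 / 2) / t l \<le> b * exp (- h * sqrt (2 * q l))" .
      show ?case unfolding bad_bound_def U_def 1 by (intro add_mono 3 4) (simp_all add: p)
    qed
  qed
qed

lemma eventually_rank_bound:
  assumes \<kappa>: "0 < \<kappa>"
  shows "\<forall>\<^sub>F l in sequentially. \<exists>E \<in> sets (P l). measure (P l) (space (P l) - E) \<le> \<kappa> \<and>
    (\<forall>\<omega>\<in>E. \<forall>proc T. first_noise_rank proc (X l \<omega>) (y l \<omega>) (\<beta> l) T \<longrightarrow>
       real T \<le> exp ((A0 + 7 * h) * sqrt (2 * q l)))"
proof -
  have "\<forall>\<^sub>F l in sequentially. bad_bound l < \<kappa>" by (rule order_tendstoD(2)[OF bad_bound_lim \<kappa>])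
  moreover have "\<forall>\<^sub>F l in sequentially. 1 + t l \<le> exp (((A0 + 6 * h) + h) * sqrt (2 * q l))"
    unfolding t_def by (rule along_q[OF one_plus_exp_sqrt_le]) (use h A0_pos in auto)
  ultimately show ?thesis using model_conditions_eventually signal_size_eventually
  proof eventually_elim
    case (elim l)
    interpret prob_space "P l" by (rule prob)
    define F where "F \<omega> = (\<lambda>ij\<in>{..<n l} \<times> {..<p l}. X l \<omega> $$ ij)" for \<omega>
    define H where "H \<omega> = (\<lambda>i\<in>{..<n l}. z l \<omega> $ i)" for \<omega>
    define E where "E = {\<omega> \<in> space (P l). good (n l) (p l) (S l) (M l) (\<mu> l) (q l) (x l) (x' l) (t l) (F \<omega>) (H \<omega>)}"
    have n: "0 < n l" using elim by simp
    have S: "S l \<subseteq> {..<p l}" "S l \<noteq> {}"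
    proof -
      show "S l \<subseteq> {..<p l}" by (auto simp: S_def)
      have "card (S l) = k l" using \<beta>_card by (simp add: S_def)
      then show "S l \<noteq> {}" using elim by auto
    qed
    have cond: "0 < \<mu> l" "\<mu> l \<le> 1" "0 \<le> q l" "0 \<le> x l" "0 \<le> h" "0 \<le> x' l" "0 < t l"
      using elim h by (auto simp: t_def)
    note bad = prob_bad_le[OF n S X_indep X_law z_measurable X_z_indep cond, of "M l", folded F_def H_def, folded E_def bad_bound_def]
    have "real T \<le> exp ((A0 + 7 * h) * sqrt (2 * q l))"
      if \<omega>: "\<omega> \<in> E" and rank: "first_noise_rank proc (X l \<omega>) (y l \<omega>) (\<beta> l) T" for \<omega> proc T
    proof -
      have \<omega>s: "\<omega> \<in> space (P l)" using \<omega> by (simp add: E_def)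
      have gm: "good_model (n l) (p l) (S l) (M l) (\<mu> l) (q l) (x l) (x' l) (t l) h (A0 + h) (3 * q l) (F \<omega>) (H \<omega>)"
        using \<omega> S n M_nz h A0_pos elim by unfold_locales (auto simp: E_def)
      have "real T < 1 + t l"
      proof (rule good_model.rank_less[OF gm X_dim[OF \<omega>s] _ z_dim[OF \<omega>s] _ \<beta>_dim])
        show "\<beta> l $ j = (if j \<in> S l then M l else 0)" if "j < p l" for j
          using \<beta>_entries[OF that] that by (auto simp: S_def)
        show "first_noise_rank proc (X l \<omega>) (X l \<omega> *\<^sub>v \<beta> l + z l \<omega>) (\<beta> l) T"
          using rank model[OF \<omega>s] by simp
      qed (auto simp: F_def H_def)
      also have "\<dots> \<le> exp ((A0 + 7 * h) * sqrt (2 * q l))" using elim(2) by (simp add: algebra_simps)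
      finally show ?thesis by simp
    qed
    then show ?case using bad elim(1) by (intro bexI[of _ E]) auto
  qed
qed

end

text \<open>Along the diagonal choice, \<open>R\<close> is the slack on the good event. Elsewhere it is taken so large that the
bound is at least \<open>p + 1\<close>; this happens with vanishing probability, so that \<open>R\<close> is still \<open>o(1)\<close> in
probability.\<close>

lemma random_exponent_bound:
  "\<exists>R. little_o_P_1 P R \<and> (\<forall>\<^sub>F l in sequentially. AE \<omega> in P l. \<forall>T.
     first_noise_rank proc (X l \<omega>) (y l \<omega>) (\<beta> l) T \<longrightarrow>
     real T \<le> exp ((1 + R l \<omega>) * (A0 * sqrt (2 * q l))))"
proof -
  let ?D = "\<lambda>l. A0 * sqrt (2 * q l)"
  let ?\<eta> = "\<lambda>m. 1 / real (Suc m)"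
  define Good where "Good m l E \<longleftrightarrow> E \<in> sets (P l) \<and> measure (P l) (space (P l) - E) \<le> ?\<eta> m \<and>
    (\<forall>\<omega>\<in>E. \<forall>T. first_noise_rank proc (X l \<omega>) (y l \<omega>) (\<beta> l) T \<longrightarrow> real T \<le> exp ((1 + ?\<eta> m) * ?D l))" for m l E
  have "\<forall>\<^sub>F l in sequentially. \<exists>E. Good m l E" for m
  proof -
    \<comment> \<open>\<open>A0 + 7 h\<close> becomes \<open>(1 + \<eta>) A0\<close>\<close>
    have h: "0 < A0 * ?\<eta> m / 7" using A0_pos by simp
    have e: "(A0 + 7 * (A0 * g / 7)) * r = (1 + g) * (A0 * r)" for g r :: real by (simp add: algebra_simps)
    have "0 < ?\<eta> m" by simp
    from eventually_rank_bound[OF h this] show ?thesis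
      unfolding e Good_def by (rule eventually_mono) blast
  qed
  then obtain f where f: "filterlim f at_top sequentially"
    and fG: "\<forall>\<^sub>F l in sequentially. \<exists>E. Good (f l) l E"
    using diagonal_choice[of "\<lambda>m l. \<exists>E. Good m l E"] by blast
  define E where "E l = (if \<exists>E. Good (f l) l E then (SOME E. Good (f l) l E) else {})" for l
  have EG: "Good (f l) l (E l)" if "\<exists>E. Good (f l) l E" for l
    using that someI_ex[OF that] by (simp add: E_def)
  have E_sets: "E l \<in> sets (P l)" for l
    using EG[of l] by (cases "\<exists>E. Good (f l) l E") (auto simp: Good_def E_def)
  define R where "R l \<omega> = (if \<omega> \<in> E l then ?\<eta> (f l) else ln (real (p l) + 1) / ?D l)" for l \<omega>
  have \<eta>_lim: "(\<lambda>l. ?\<eta> (f l)) \<longlonglongrightarrow> 0"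
    by (rule filterlim_compose[OF LIMSEQ_inverse_real_of_nat[unfolded inverse_eq_divide] f])
  have "little_o_P_1 P R"
    unfolding little_o_P_1_def
  proof (intro conjI allI impI)
    fix l
    show "R l \<in> borel_measurable (P l)"
      unfolding R_def using E_sets[of l] by measurable
  next
    fix e :: real assume e: "0 < e"
    have small: "\<forall>\<^sub>F l in sequentially. ?\<eta> (f l) < e" by (rule order_tendstoD(2)[OF \<eta>_lim e])
    show "(\<lambda>l. measure (P l) {\<omega> \<in> space (P l). \<bar>R l \<omega>\<bar> > e}) \<longlonglongrightarrow> 0"
    proof (rule tendsto_sandwich[OF _ _ tendsto_const \<eta>_lim])
      show "\<forall>\<^sub>F l in sequentially. measure (P l) {\<omega> \<in> space (P l). \<bar>R l \<omega>\<bar> > e} \<le> ?\<eta> (f l)"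
        using small fG
      proof eventually_elim
        case (elim l)
        interpret prob_space "P l" by (rule prob)
        have "{\<omega> \<in> space (P l). \<bar>R l \<omega>\<bar> > e} \<subseteq> space (P l) - E l"
          using elim(1) by (auto simp: R_def)
        then have "measure (P l) {\<omega> \<in> space (P l). \<bar>R l \<omega>\<bar> > e} \<le> measure (P l) (space (P l) - E l)"
          by (rule finite_measure_mono) (use E_sets in auto)
        also have "\<dots> \<le> ?\<eta> (f l)" using EG[OF elim(2)] by (simp add: Good_def)
        finally show ?case .
      qed
    qed simp
  qed
  moreover have "\<forall>\<^sub>F l in sequentially. AE \<omega> in P l. \<forall>T. first_noise_rank proc (X l \<omega>) (y l \<omega>) (\<beta> l) T \<longrightarrow>
     real T \<le> exp ((1 + R l \<omega>) * ?D l)"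
    using fG along_q[OF eventually_gt_at_top[of 0]]
  proof eventually_elim
    case (elim l)
    have D: "0 < ?D l" using elim(2) A0_pos by simp
    show ?case
    proof (intro AE_I2 allI impI)
      fix \<omega> T assume \<omega>: "\<omega> \<in> space (P l)" and rank: "first_noise_rank proc (X l \<omega>) (y l \<omega>) (\<beta> l) T"
      show "real T \<le> exp ((1 + R l \<omega>) * ?D l)"
      proof (cases "\<omega> \<in> E l")
        case True
        then show ?thesis using EG[OF elim(1)] rank unfolding Good_def R_def by simp
      next
        case False
        have "T \<le> Suc (dim_col (X l \<omega>))"
          using first_noise_rank_le_Suc_dim[OF _ rank] \<beta>_dim[of l] X_dim[OF \<omega>] by auto
        then have "real T \<le> real (p l) + 1" using X_dim[OF \<omega>] by auto
        also have "\<dots> = exp (ln (real (p l) + 1))" by simp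
        also have "\<dots> \<le> exp ((1 + R l \<omega>) * ?D l)"
        proof -
          have "(1 + g / d) * d = d + g" if "0 < d" for g d :: real using that by (simp add: distrib_right)
          note this[OF D, of "ln (real (p l) + 1)"]
          moreover have "R l \<omega> = ln (real (p l) + 1) / ?D l" using False by (simp only: R_def if_False)
          ultimately have "(1 + R l \<omega>) * ?D l = ?D l + ln (real (p l) + 1)" by (simp only:)
          then have "ln (real (p l) + 1) \<le> (1 + R l \<omega>) * ?D l" using D by linarith
          then show ?thesis by (simp only: exp_le_cancel_iff)
        qed
        finally show ?thesis .
      qed
    qed
  qed
  ultimately show ?thesis by blast
qed

end

theorem corollary3:
  fixes P :: "nat \<Rightarrow> 'a measure"
    and k n p :: "nat \<Rightarrow> nat"
    and X :: "nat \<Rightarrow> 'a \<Rightarrow> real mat"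
    and y z :: "nat \<Rightarrow> 'a \<Rightarrow> real vec"
    and \<beta> :: "nat \<Rightarrow> real vec"
    and \<sigma> M :: "nat \<Rightarrow> real"
    and c1 c2 c3 c4 c5 \<theta>1 \<theta>2 \<epsilon> \<delta> :: real
    and proc :: procedure
  assumes prob: "\<And>l. prob_space (P l)"
    and k_lim: "filterlim k at_top sequentially"
    and n_lim: "filterlim n at_top sequentially"
    and p_lim: "filterlim p at_top sequentially"
    and X_dim: "\<And>l \<omega>. \<omega> \<in> space (P l) \<Longrightarrow> X l \<omega> \<in> carrier_mat (n l) (p l)"
    and z_dim: "\<And>l \<omega>. \<omega> \<in> space (P l) \<Longrightarrow> z l \<omega> \<in> carrier_vec (n l)"
    and X_indep: "\<And>l. prob_space.indep_vars (P l) (\<lambda>_. borel)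
                     (\<lambda>ij \<omega>. X l \<omega> $$ ij) ({..<n l} \<times> {..<p l})"
    and X_law: "\<And>l i j. i < n l \<Longrightarrow> j < p l \<Longrightarrow>
                  distr (P l) borel (\<lambda>\<omega>. X l \<omega> $$ (i, j)) = normal_law 0 (1 / real (n l))"
    and z_indep: "\<And>l. prob_space.indep_vars (P l) (\<lambda>_. borel) (\<lambda>i \<omega>. z l \<omega> $ i) {..<n l}"
    and z_law: "\<And>l i. i < n l \<Longrightarrow>
                  distr (P l) borel (\<lambda>\<omega>. z l \<omega> $ i) = normal_law 0 ((\<sigma> l)\<^sup>2)"
    and X_z_indep: "\<And>l. prob_space.indep_set (P l)
          (sets (vimage_algebra (space (P l)) (\<lambda>\<omega>. \<lambda>ij\<in>{..<n l} \<times> {..<p l}. X l \<omega> $$ ij)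
                  (PiM ({..<n l} \<times> {..<p l}) (\<lambda>_. borel))))
          (sets (vimage_algebra (space (P l)) (\<lambda>\<omega>. \<lambda>i\<in>{..<n l}. z l \<omega> $ i)
                  (PiM {..<n l} (\<lambda>_. borel))))"
    and \<beta>_dim: "\<And>l. \<beta> l \<in> carrier_vec (p l)"
    and \<beta>_entries: "\<And>l j. j < p l \<Longrightarrow> \<beta> l $ j = M l \<or> \<beta> l $ j = 0"
    and \<beta>_card: "\<And>l. card {j. j < p l \<and> \<beta> l $ j = M l} = k l"
    and M_nz: "\<And>l. M l \<noteq> 0"
    and \<sigma>_nonneg: "\<And>l. 0 \<le> \<sigma> l"
    and model: "\<And>l \<omega>. \<omega> \<in> space (P l) \<Longrightarrow> y l \<omega> = X l \<omega> *\<^sub>v \<beta> l + z l \<omega>"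
    and c_pos: "0 < c1" "0 < c2" "0 < c3" "0 < c4" "0 < c5"
    and theta_range: "0 < \<theta>1" "\<theta>1 < 1" "0 < \<theta>2" "\<theta>2 < 1"
    and n_bounds: "\<And>l. c1 * real (p l) / ln (real (p l)) powr c2 \<le> real (n l)"
                  "\<And>l. real (n l) \<le> c3 * real (p l)"
    and k_bounds: "\<And>l. c4 * real (n l) \<le> real (k l)"
                  "\<And>l. real (k l) \<le> min (\<theta>1 * real (p l)) (c5 * real (n l) * ln (real (p l)) powr \<theta>2)"
    and \<epsilon>: "0 < \<epsilon>" "\<epsilon> < 1" "(\<lambda>l. real (k l) / real (p l)) \<longlonglongrightarrow> \<epsilon>"
    and \<delta>: "0 < \<delta>" "(\<lambda>l. real (n l) / real (p l)) \<longlonglongrightarrow> \<delta>"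
  shows "\<exists>R. little_o_P_1 P R \<and>
           (\<forall>\<^sub>F l in sequentially. AE \<omega> in P l. \<forall>T.
              first_noise_rank proc (X l \<omega>) (y l \<omega>) (\<beta> l) T \<longrightarrow>
              real T \<le> exp ((1 + R l \<omega>) * sqrt (2 * \<delta> * ln (real (p l)) / \<epsilon>)))"
proof -
  interpret proportional_models P k n p X y z \<beta> M \<theta>1 \<epsilon> \<delta>
  proof (rule proportional_models.intro)
    fix l
    show "real (k l) \<le> \<theta>1 * real (p l)" using k_bounds(2)[of l] by simp
    show "(\<lambda>\<omega>. z l \<omega> $ i) \<in> borel_measurable (P l)" if "i < n l" for i
      using z_indep[of l] that unfolding prob_space.indep_vars_def2[OF prob] by auto
  qed (fact assms)+
  have "A0 * sqrt (2 * q l) = sqrt (2 * \<delta> * ln (real (p l)) / \<epsilon>)" for l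
    unfolding A0_def q_def real_sqrt_mult[symmetric] by (simp add: mult_ac)
  then show ?thesis using random_exponent_bound[of proc] by simp
qed

end
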